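(* If $c\ge 1.261$, then there exist $0<\alpha<1$, $\beta>0$, $\eta>0$ (and a number of iterations $t$ as specified in the context) for which running the variant algorithm described in the context on a random graph in $G(n,\tfrac12,c\sqrt n)$ finds the hidden clique (i.e. outputs $K^*$ equal to the hidden clique) with probability at least $1-\mathrm{e}^{-\Theta(n^{\varepsilon_0})}$ for some $\varepsilon_0=\varepsilon_0(c)>0$.
   Context: Hidden clique model $G(n,\tfrac12,k)$: on a vertex set of size $n$, a uniformly random subset $K$ of $k$ vertices is made into a clique, and every other pair of vertices is an edge independently with probability $\tfrac12$. $d_S(v)$ is the number of neighbors of $v$ in $S$; $\bar\Phi=1-\Phi$ with $\Phi$ the standard Gaussian CDF; logarithms base 2. Set $\tau=(1-\alpha)\bar\Phi(\beta)$, $\gamma=\alpha\bar\Phi(\eta)$, $\delta=\alpha\bar\Phi(\eta-c\sqrt\alpha)$, $\rho=(1-\alpha)\bar\Phi\big(\beta-\tfrac{c\delta}{\sqrt\gamma}\big)$. Variant algorithm (parameters $\alpha,\beta,\eta$, iterations $t$) on input $G$ with $n$ vertices and clique size $k$: Phase 1: $G_0=G$; given $G_i$, choose $S_i\subseteq V(G_i)$ containing each vertex independently with probability $\alpha$, let $\tilde S_i=\{v\in S_i: d_{S_i}(v)\ge\tfrac12|S_i|+\eta\tfrac{\sqrt{|S_i|}}2\}$, let $\tilde V_i=\{v\in V(G_i)\setminus S_i: d_{\tilde S_i}(v)\ge\tfrac12|\tilde S_i|+\beta\tfrac{\sqrt{|\tilde S_i|}}2\}$ (all degrees in $G_i$),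 and let $G_{i+1}$ be the subgraph of $G_i$ induced on $\tilde V_i$; repeat for $i=0,\dots,t-1$, with $t=\varepsilon_4\log n/\log(\rho^2/\tau)$ for a suitable constant $\varepsilon_4>0$. Phase 2: let $k_t=\rho^tk$, $K'$ the $k_t$ largest degree vertices of $G_t$, and $\tilde K=\{v\in V(G_t): d_{K'}(v)\ge\tfrac{3k_t}4\}$. Phase 3: let $G'$ be the subgraph of $G$ induced on $\tilde K$ and all vertices adjacent to every vertex of $\tilde K$, and output $K^*$, the $k$ largest degree vertices of $G'$. *)

theory Defs
  imports
    "HOL-Probability.Probability"
    "HOL-Probability.Product_PMF"
    "HOL-Library.Landau_Symbols"
begin

type_synonym 'a ugraph = "'a set \<times> 'a set set"

abbreviation verts :: "'a ugraph \<Rightarrow> 'a set" where "verts \<equiv> fst"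
abbreviation edges :: "'a ugraph \<Rightarrow> 'a set set" where "edges \<equiv> snd"

definition pairs :: "'a set \<Rightarrow> 'a set set" where
  "pairs V = {e. e \<subseteq> V \<and> card e = 2}"

definition induced :: "'a ugraph \<Rightarrow> 'a set \<Rightarrow> 'a ugraph" where
  "induced G W = (verts G \<inter> W, {e \<in> edges G. e \<subseteq> W})"

definition deg_into :: "'a ugraph \<Rightarrow> 'a set \<Rightarrow> 'a \<Rightarrow> nat" where
  "deg_into G S v = card {u \<in> S. {u, v} \<in> edges G}"

definition random_subset :: "real \<Rightarrow> 'a set \<Rightarrow> 'a set pmf" where
  "random_subset p A =
     map_pmf (\<lambda>b. {x \<in> A. b x}) (Pi_pmf A False (\<lambda>_. bernoulli_pmf p))"

text \<open>
  The model $G(n, 1/2, k)$ on the vertex set $\{0, \dots, n-1\}$, returned together with the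
  hidden clique. It is only meaningful for \<open>k \<le> n\<close>.
\<close>
definition hidden_clique_model :: "nat \<Rightarrow> nat \<Rightarrow> (nat set \<times> nat ugraph) pmf" where
  "hidden_clique_model n k =
     bind_pmf (pmf_of_set {K. K \<subseteq> {..<n} \<and> card K = k}) (\<lambda>K.
     map_pmf (\<lambda>E. (K, ({..<n}, pairs K \<union> E)))
       (random_subset (1/2) (pairs {..<n} - pairs K)))"

definition Phi_bar :: "real \<Rightarrow> real" where
  "Phi_bar x = 1 - cdf std_normal_distribution x"

definition tau :: "real \<Rightarrow> real \<Rightarrow> real" where
  "tau \<alpha> \<beta> = (1 - \<alpha>) * Phi_bar \<beta>"

definition gam :: "real \<Rightarrow> real \<Rightarrow> real" where
  "gam \<alpha> \<eta> = \<alpha> * Phi_bar \<eta>"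

definition del :: "real \<Rightarrow> real \<Rightarrow> real \<Rightarrow> real" where
  "del c \<alpha> \<eta> = \<alpha> * Phi_bar (\<eta> - c * sqrt \<alpha>)"

definition rho :: "real \<Rightarrow> real \<Rightarrow> real \<Rightarrow> real \<Rightarrow> real" where
  "rho c \<alpha> \<beta> \<eta> = (1 - \<alpha>) * Phi_bar (\<beta> - c * del c \<alpha> \<eta> / sqrt (gam \<alpha> \<eta>))"

definition refine :: "real \<Rightarrow> real \<Rightarrow> 'a ugraph \<Rightarrow> 'a set \<Rightarrow> 'a ugraph" where
  "refine \<beta> \<eta> G S =
     (let S' = {v \<in> S. deg_into G S v \<ge> 1/2 * card S + \<eta> * (sqrt (card S) / 2)};
          V' = {v \<in> verts G - S. deg_into G S' v \<ge> 1/2 * card S' + \<beta> * (sqrt (card S') / 2)}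
      in induced G V')"

fun phase1 :: "real \<Rightarrow> real \<Rightarrow> real \<Rightarrow> nat \<Rightarrow> 'a ugraph \<Rightarrow> 'a ugraph pmf" where
  "phase1 \<alpha> \<beta> \<eta> 0 G = return_pmf G"
| "phase1 \<alpha> \<beta> \<eta> (Suc i) G =
     bind_pmf (phase1 \<alpha> \<beta> \<eta> i G) (\<lambda>H. map_pmf (refine \<beta> \<eta> H) (random_subset \<alpha> (verts H)))"

text \<open>
  Several sets may qualify as ``the \<open>m\<close> largest degree vertices'' because of ties, so this is a
  predicate. If there are fewer than \<open>m\<close> vertices, all of them are taken.
\<close>
definition largest_degree :: "nat \<Rightarrow> 'a ugraph \<Rightarrow> 'a set \<Rightarrow> bool" where
  "largest_degree m G A \<longleftrightarrow>
     A \<subseteq> verts G \<and> card A = min m (card (verts G)) \<and>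
     (\<forall>u\<in>A. \<forall>v\<in>verts G - A. deg_into G (verts G) v \<le> deg_into G (verts G) u)"

definition phase2 :: "nat \<Rightarrow> 'a ugraph \<Rightarrow> 'a set \<Rightarrow> 'a set" where
  "phase2 k\<^sub>t G K' = {v \<in> verts G. deg_into G K' v \<ge> 3 * k\<^sub>t / 4}"

definition phase3_graph :: "'a ugraph \<Rightarrow> 'a set \<Rightarrow> 'a ugraph" where
  "phase3_graph G K = induced G (K \<union> {v \<in> verts G. \<forall>u\<in>K. {u, v} \<in> edges G})"

text \<open>
  All sets that phases 2 and 3 can output, over all ways of breaking ties; \<open>G\<close> is the input
  graph and \<open>H\<close> the result of phase 1.
\<close>
definition outputs :: "nat \<Rightarrow> nat \<Rightarrow> 'a ugraph \<Rightarrow> 'a ugraph \<Rightarrow> 'a set set" where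
  "outputs k k\<^sub>t G H =
     {A. \<exists>K'. largest_degree k\<^sub>t H K' \<and> largest_degree k (phase3_graph G (phase2 k\<^sub>t H K')) A}"

definition clique_size :: "real \<Rightarrow> nat \<Rightarrow> nat" where
  "clique_size c n = nat \<lfloor>c * sqrt n\<rfloor>"

definition num_iterations :: "real \<Rightarrow> real \<Rightarrow> real \<Rightarrow> real \<Rightarrow> real \<Rightarrow> nat \<Rightarrow> nat" where
  "num_iterations c \<alpha> \<beta> \<eta> \<epsilon> n =
     nat \<lfloor>\<epsilon> * log 2 n / log 2 ((rho c \<alpha> \<beta> \<eta>)\<^sup>2 / tau \<alpha> \<beta>)\<rfloor>"

text \<open>
  Joint law of the hidden clique of $G(n, 1/2, c\sqrt n)$ and the possible outputs on that graph.
\<close>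
definition run ::
  "real \<Rightarrow> real \<Rightarrow> real \<Rightarrow> real \<Rightarrow> real \<Rightarrow> nat \<Rightarrow> (nat set \<times> nat set set) pmf" where
  "run c \<alpha> \<beta> \<eta> \<epsilon> n =
     (let k = clique_size c n;
          t = num_iterations c \<alpha> \<beta> \<eta> \<epsilon> n;
          k\<^sub>t = nat \<lfloor>rho c \<alpha> \<beta> \<eta> ^ t * k\<rfloor>
      in bind_pmf (hidden_clique_model n k) (\<lambda>(K, G).
         map_pmf (\<lambda>H. (K, outputs k k\<^sub>t G H)) (phase1 \<alpha> \<beta> \<eta> t G)))"

text \<open>
  The set of possible outputs is never empty, so equality with \<open>{K}\<close> says that the hidden clique
  \<open>K\<close> is returned however ties are broken.
\<close>
definition success_prob :: "real \<Rightarrow> real \<Rightarrow> real \<Rightarrow> real \<Rightarrow> real \<Rightarrow> nat \<Rightarrow> real" where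
  "success_prob c \<alpha> \<beta> \<eta> \<epsilon> n =
     measure_pmf.prob (run c \<alpha> \<beta> \<eta> \<epsilon> n) {(K, Out). Out = {K}}"

end

theory Submission
  imports Defs "HOL-Real_Asymp.Real_Asymp"
begin

text \<open>
  The vertices that survive an iteration of phase 1 are chosen by looking only at edges touching
  the sample \<open>S\<close>, so the surviving graph is again a planted clique with fresh edges. In one
  iteration the non-clique vertices shrink by the factor \<open>\<tau>\<close> and the clique by at least \<open>\<rho>(w)\<close>
  as soon as its size is at least \<open>w\<close> times the square root of the number of other vertices; since
  \<open>\<rho>\<^sup>2 > \<tau>\<close>, that ratio grows geometrically. The relative error of an iteration may be a
  fixed constant, hence the central limit theorem suffices. Concentration is obtained without
  martingales: if every small set \<open>B\<close> of \<open>b\<close> vertices is contained in a random set with probability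
  at most \<open>q\<^sup>b\<close>, then counting \<open>b\<close>-subsets bounds the size of the random set, and the degrees of
  the vertices of \<open>B\<close> into the complement of \<open>B\<close> are independent.

  The true clique of the last graph is much larger than \<open>k\<^sub>t\<close>, so the set \<open>K'\<close> of phase 2
  depends on all edges. For a vertex \<open>v\<close> outside the clique, deleting \<open>v\<close> changes the degrees by at
  most one, and few clique vertices have the same degree; so \<open>K'\<close> differs little from a set that is
  independent of the edges at \<open>v\<close>. In phase 3 a union bound over all small subsets of the
  clique replaces any information about which subset phase 2 has found.
\<close>

section \<open>Random subsets\<close>

text \<open>Degrees of vertices inside one sample share edges and are therefore dependent. Cutting
  out a block of \<open>b\<close> vertices removes the shared edges and changes each degree by at
  most \<open>b\<close>, which is invisible on the scale of the standard deviation while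
  \<open>b\<close> is of smaller order than the square root of the sample. With \<open>b\<close>
  about N^(1/8), for N remaining non-clique vertices, the error of an iteration is exponentially
  small in a power of N. The number of iterations balances two demands. It is a small multiple of
  log n, so that all iterations together divide the non-clique vertices and the quantity \<rho>^t k
  by at most a small power of n. Yet it tends to infinity, so that the ratio of clique size to the
  square root of the graph size gains a factor of order n^\<mu> with \<mu> > 0. Phase 2 lives on
  this polynomial gain: Hoeffding's inequality then separates the clique degrees from all others
  with failure probability exponentially small in a power of n, whereas for a bounded ratio the same
  bound would not tend to 0.\<close>

abbreviation prb :: "'a pmf \<Rightarrow> 'a set \<Rightarrow> real" where
  "prb \<equiv> measure_pmf.prob"

section \<open>Expectation, union bounds and conditioning for probability mass functions\<close>

lemma prb_bind:
  "prb (bind_pmf M f) A = measure_pmf.expectation M (\<lambda>x. prb (f x) A)"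
proof -
  have "ennreal (prb (bind_pmf M f) A) = emeasure (bind_pmf M f) A"
    by (simp only: measure_pmf.emeasure_eq_measure)
  also have "\<dots> = (\<integral>\<^sup>+x. emeasure (f x) A \<partial>M)"
    by (rule emeasure_bind_pmf)
  also have "\<dots> = (\<integral>\<^sup>+x. ennreal (prb (f x) A) \<partial>M)"
    by (simp only: measure_pmf.emeasure_eq_measure)
  also have "\<dots> = ennreal (measure_pmf.expectation M (\<lambda>x. prb (f x) A))"
    by (intro nn_integral_eq_integral measure_pmf.integrable_const_bound[where B=1]) auto
  finally show ?thesis
    by (subst (asm) ennreal_inj) (auto intro!: integral_nonneg_AE)
qed

lemma prb_map: "prb (map_pmf f M) A = prb M {x. f x \<in> A}"
  by (simp add: vimage_def)

lemma prb_union_le: "prb M (A \<union> B) \<le> prb M A + prb M B"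
  by (intro measure_Un_le) auto

lemma prb_mono:
  assumes "\<And>x. x \<in> set_pmf M \<Longrightarrow> x \<in> A \<Longrightarrow> x \<in> B"
  shows "prb M A \<le> prb M B"
  by (rule measure_pmf.finite_measure_mono_AE) (auto simp: AE_measure_pmf_iff assms)

lemma prb_UN_le:
  fixes e :: real
  assumes "finite I" "\<And>i. i \<in> I \<Longrightarrow> prb M (A i) \<le> e"
  shows "prb M (\<Union>i\<in>I. A i) \<le> card I * e"
proof -
  have "prb M (\<Union>i\<in>I. A i) \<le> (\<Sum>i\<in>I. prb M (A i))"
    using assms(1) by (intro measure_UNION_le) auto
  also have "\<dots> \<le> (\<Sum>i\<in>I. e)"
    by (intro sum_mono assms)
  finally show ?thesis by simp
qed

text \<open>This is the conditioning step used throughout: a first draw that lands in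
  \<open>Bad\<close> is given up at the price of its probability, and \<open>e\<close> bounds the
  conditional failure otherwise. Pointwise the integrand is at most the indicator of
  \<open>Bad\<close> plus \<open>e\<close>.\<close>

lemma prb_bind_le:
  assumes "\<And>x. x \<in> set_pmf M \<Longrightarrow> x \<notin> Bad \<Longrightarrow> prb (f x) A \<le> e" "e \<ge> 0"
  shows "prb (bind_pmf M f) A \<le> prb M Bad + e"
proof -
  have "prb (bind_pmf M f) A = measure_pmf.expectation M (\<lambda>x. prb (f x) A)"
    by (rule prb_bind)
  also have "\<dots> \<le> measure_pmf.expectation M (\<lambda>x. indicator Bad x + e)"
  proof (intro integral_mono_AE)
    show "AE x in M. prb (f x) A \<le> indicator Bad x + e"
      using assms by (auto simp: AE_measure_pmf_iff indicator_def intro: order_trans[OF measure_pmf.prob_le_1])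
    show "integrable M (\<lambda>x. prb (f x) A)"
      by (intro measure_pmf.integrable_const_bound[where B=1]) auto
    show "integrable M (\<lambda>x. indicator Bad x + e)"
      using assms(2)
      by (intro measure_pmf.integrable_const_bound[where B="1 + e"]) (auto simp: indicator_def)
  qed
  also have "\<dots> = prb M Bad + e"
    by (subst Bochner_Integration.integral_add) 
      (auto intro!: measure_pmf.integrable_const_bound[where B="1"])
  finally show ?thesis .
qed

lemma prb_bind_le':
  assumes "\<And>x. x \<in> set_pmf M \<Longrightarrow> prb (f x) A \<le> e" "e \<ge> 0"
  shows "prb (bind_pmf M f) A \<le> e"
  using prb_bind_le[where Bad="{}", OF assms] by simp

section \<open>Random subsets: independence over disjoint blocks, and counts\<close>

lemma set_random_subset: "X \<in> set_pmf (random_subset p A) \<Longrightarrow> X \<subseteq> A"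
  by (auto simp: random_subset_def)

text \<open>Coordinates of a product measure over disjoint index sets can be drawn one block after
  the other. In this form the exposure of edges is deferred below.\<close>

lemma random_subset_Un:
  assumes "finite A" "finite B" "A \<inter> B = {}"
  shows "random_subset p (A \<union> B) =
    bind_pmf (random_subset p A) (\<lambda>X. map_pmf (\<lambda>Y. X \<union> Y) (random_subset p B))"
proof -
  have "random_subset p (A \<union> B) = map_pmf (\<lambda>(f,g). {x\<in>A. f x} \<union> {x\<in>B. g x})
      (pair_pmf (Pi_pmf A False (\<lambda>_. bernoulli_pmf p)) (Pi_pmf B False (\<lambda>_. bernoulli_pmf p)))"
    unfolding random_subset_def Pi_pmf_union[OF assms] map_pmf_comp
    by (intro map_pmf_cong refl) (use assms(3) in auto)
  then show ?thesis
    by (simp add: random_subset_def pair_pmf_def map_bind_pmf bind_map_pmf map_pmf_def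
        bind_assoc_pmf bind_return_pmf)
qed

lemma random_subset_Int:
  assumes "finite A"
  shows "map_pmf (\<lambda>X. X \<inter> B) (random_subset p A) = random_subset p (A \<inter> B)"
proof -
  have A: "A = (A \<inter> B) \<union> (A - B)"
    by blast
  have "map_pmf (\<lambda>X. X \<inter> B) (random_subset p A) =
    bind_pmf (random_subset p (A \<inter> B)) (\<lambda>X. map_pmf (\<lambda>Y. (X \<union> Y) \<inter> B) (random_subset p (A - B)))"
    using assms by (subst A, subst random_subset_Un) (auto simp: map_bind_pmf map_pmf_comp)
  also have "\<dots> = bind_pmf (random_subset p (A \<inter> B)) (\<lambda>X. map_pmf (\<lambda>Y. X) (random_subset p (A - B)))"
    by (intro bind_pmf_cong refl map_pmf_cong) (auto dest: set_random_subset)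
  finally show ?thesis
    by (simp add: bind_return_pmf')
qed

lemma random_subset_split:
  assumes "finite A" "B \<subseteq> A"
  shows "random_subset p A =
    bind_pmf (random_subset p B) (\<lambda>X. map_pmf (\<lambda>Y. X \<union> Y) (random_subset p (A - B)))"
proof -
  have "random_subset p (B \<union> (A - B)) =
      bind_pmf (random_subset p B) (\<lambda>X. map_pmf (\<lambda>Y. X \<union> Y) (random_subset p (A - B)))"
    using assms by (intro random_subset_Un) (auto intro: finite_subset)
  moreover have "B \<union> (A - B) = A"
    using assms by blast
  ultimately show ?thesis by simp
qed

text \<open>Independence of events that each read their own block \<open>D v\<close>. The induction
  draws the block of the new index before everything else; the event then splits into a factor
  decided by that block and the remaining events on \<open>A - D w\<close>.\<close>

lemma prb_random_subset_Ball:
  assumes "finite W" "finite A" "\<And>v. v \<in> W \<Longrightarrow> D v \<subseteq> A" "disjoint_family_on D W"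
  shows "prb (random_subset p A) {X. \<forall>v\<in>W. P v (X \<inter> D v)} =
    (\<Prod>v\<in>W. prb (random_subset p (D v)) {X. P v X})"
  using assms
proof (induction W arbitrary: A rule: finite_induct)
  case (insert w W)
  have fin: "finite (D w)"
    using insert.prems by (auto intro: finite_subset)
  have *: "prb (random_subset p A) {X. \<forall>v\<in>insert w W. P v (X \<inter> D v)} =
    measure_pmf.expectation (random_subset p (D w))
      (\<lambda>X. indicator {X. P w X} X * prb (random_subset p (A - D w)) {Y. \<forall>v\<in>W. P v (Y \<inter> D v)})"
  proof (subst random_subset_split[of A "D w" p], goal_cases)
    case 3
    show ?case unfolding prb_bind
    proof (intro integral_cong_AE)
      show "AE X in random_subset p (D w).
         prb (map_pmf ((\<union>) X) (random_subset p (A - D w))) {X. \<forall>v\<in>insert w W. P v (X \<inter> D v)} =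
         indicator {X. P w X} X * prb (random_subset p (A - D w)) {Y. \<forall>v\<in>W. P v (Y \<inter> D v)}"
        unfolding AE_measure_pmf_iff
      proof
        fix X assume X: "X \<in> set_pmf (random_subset p (D w))"
        have XD: "X \<subseteq> D w"
          using X by (rule set_random_subset)
        have eq: "(X \<union> Y) \<inter> D w = X" if "Y \<subseteq> A - D w" for Y
          using XD that by blast
        have eq2: "(X \<union> Y) \<inter> D v = Y \<inter> D v" if "v \<in> W" for Y v
        proof -
          have "D w \<inter> D v = {}"
            using insert.prems(3) insert.hyps that by (auto simp: disjoint_family_on_def)
          then show ?thesis using XD by blast
        qed
        have "prb (map_pmf ((\<union>) X) (random_subset p (A - D w))) {X. \<forall>v\<in>insert w W. P v (X \<inter> D v)}
          = prb (random_subset p (A - D w)) {Y. P w X \<and> (\<forall>v\<in>W. P v (Y \<inter> D v))}"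
          unfolding prb_map
        proof (intro antisym prb_mono)
          fix Y assume "Y \<in> set_pmf (random_subset p (A - D w))"
          then have Y: "Y \<subseteq> A - D w" by (rule set_random_subset)
          show "Y \<in> {Y. P w X \<and> (\<forall>v\<in>W. P v (Y \<inter> D v))}"
            if "Y \<in> {Y. X \<union> Y \<in> {X. \<forall>v\<in>insert w W. P v (X \<inter> D v)}}"
            using that eq[OF Y] eq2 by simp
          show "Y \<in> {Y. X \<union> Y \<in> {X. \<forall>v\<in>insert w W. P v (X \<inter> D v)}}"
            if "Y \<in> {Y. P w X \<and> (\<forall>v\<in>W. P v (Y \<inter> D v))}"
            using that eq[OF Y] eq2 by simp
        qed
        then show "prb (map_pmf ((\<union>) X) (random_subset p (A - D w))) {X. \<forall>v\<in>insert w W. P v (X \<inter> D v)} =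
         indicator {X. P w X} X * prb (random_subset p (A - D w)) {Y. \<forall>v\<in>W. P v (Y \<inter> D v)}"
          by (auto simp: indicator_def)
      qed
    qed auto
  qed (use insert.prems in auto)
  have "prb (random_subset p (A - D w)) {Y. \<forall>v\<in>W. P v (Y \<inter> D v)} =
      (\<Prod>v\<in>W. prb (random_subset p (D v)) {X. P v X})"
  proof (rule insert.IH)
    show "D v \<subseteq> A - D w" if "v \<in> W" for v
      using insert.prems that insert.hyps by (fastforce simp: disjoint_family_on_def)
    show "disjoint_family_on D W"
      using insert.prems by (auto simp: disjoint_family_on_def)
  qed (use insert.prems in auto)
  then show ?case
    unfolding * using insert.hyps by (simp add: measure_pmf.emeasure_eq_measure)
qed simp

lemma map_card_random_subset:
  assumes "finite D"
  shows "map_pmf card (random_subset (1/2) D) = binomial_pmf (card D) (1/2)"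
  using binomial_pmf_altdef'[of D "card D" "1/2" False] assms
  by (simp add: random_subset_def map_pmf_comp)

lemma prb_random_subset_cards:
  assumes "finite W" "finite A" "\<And>v. v \<in> W \<Longrightarrow> D v \<subseteq> A" "disjoint_family_on D W"
  shows "prb (random_subset (1/2) A) {X. \<forall>v\<in>W. Q v (card (X \<inter> D v))} =
    (\<Prod>v\<in>W. prb (binomial_pmf (card (D v)) (1/2)) {j. Q v j})"
proof -
  have "prb (binomial_pmf (card (D v)) (1/2)) {j. Q v j} = prb (random_subset (1/2) (D v)) {X. Q v (card X)}"
    if "v \<in> W" for v
    using assms(2) assms(3)[OF that]
    by (subst map_card_random_subset[symmetric]) (auto intro: finite_subset simp: prb_map)
  then show ?thesis
    using prb_random_subset_Ball[OF assms, of "1/2" "\<lambda>v X. Q v (card X)"] by simp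
qed

lemma prb_random_subset_card:
  assumes "finite A" "D \<subseteq> A"
  shows "prb (random_subset (1/2) A) {X. Q (card (X \<inter> D))} = prb (binomial_pmf (card D) (1/2)) {j. Q j}"
  using prb_random_subset_cards[of "{()}" A "\<lambda>_. D" "\<lambda>_. Q"] assms by (auto simp: disjoint_family_on_def)

lemma prb_random_subset_superset:
  assumes "finite A" "B \<subseteq> A" "p \<in> {0..1}"
  shows "prb (random_subset p A) {X. B \<subseteq> X} = p ^ card B"
proof -
  have fin: "finite B" using assms finite_subset by blast
  have "prb (random_subset p A) {X. B \<subseteq> X} = prb (random_subset p A) {X. \<forall>v\<in>B. X \<inter> {v} = {v}}"
    by (intro arg_cong2[of _ _ _ _ prb] refl) auto
  also have "\<dots> = (\<Prod>v\<in>B. prb (random_subset p {v}) {X. X = {v}})"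
    using assms fin
    by (subst prb_random_subset_Ball[where P="\<lambda>v X. X = {v}"]) (auto simp: disjoint_family_on_def)
  also have "\<dots> = (\<Prod>v\<in>B. p)"
  proof (intro prod.cong refl)
    fix v
    have "{X. X = {v}} = {{v}}" by auto
    have "prb (random_subset p {v}) {X. X = {v}} = prb (Pi_pmf {v} False (\<lambda>_. bernoulli_pmf p)) (PiE_dflt {v} False (\<lambda>_. {True}))"
      unfolding random_subset_def prb_map
      by (intro antisym prb_mono) (auto simp: set_Pi_pmf PiE_dflt_def)
    also have "\<dots> = p"
      using assms(3) by (subst measure_Pi_pmf_PiE_dflt) (auto simp: measure_pmf_single)
    finally show "prb (random_subset p {v}) {X. X = {v}} = p" .
  qed
  finally show ?thesis by simp
qed

lemma prb_random_subset_disjoint: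
  assumes "finite A" "B \<subseteq> A" "p \<in> {0..1}"
  shows "prb (random_subset p A) {X. B \<inter> X = {}} = (1 - p) ^ card B"
proof -
  have fin: "finite B" using assms finite_subset by blast
  have "prb (random_subset p A) {X. B \<inter> X = {}} = prb (random_subset p A) {X. \<forall>v\<in>B. X \<inter> {v} = {}}"
    by (intro arg_cong2[of _ _ _ _ prb] refl) auto
  also have "\<dots> = (\<Prod>v\<in>B. prb (random_subset p {v}) {X. X = {}})"
    using assms fin
    by (subst prb_random_subset_Ball[where P="\<lambda>v X. X = {}"]) (auto simp: disjoint_family_on_def)
  also have "\<dots> = (\<Prod>v\<in>B. 1 - p)"
  proof (intro prod.cong refl)
    fix v
    have "prb (random_subset p {v}) {X. X = {}} = prb (Pi_pmf {v} False (\<lambda>_. bernoulli_pmf p)) (PiE_dflt {v} False (\<lambda>_. {False}))"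
      unfolding random_subset_def prb_map
      by (intro antisym prb_mono) (auto simp: set_Pi_pmf PiE_dflt_def)
    also have "\<dots> = 1 - p"
      using assms(3) by (subst measure_Pi_pmf_PiE_dflt) (auto simp: measure_pmf_single)
    finally show "prb (random_subset p {v}) {X. X = {}} = 1 - p" .
  qed
  finally show ?thesis by simp
qed

section \<open>Concentration\<close>

text \<open>Both binomial coefficients are compared with falling factorials: \<open>b\<close>
  factors counting down from \<open>m\<close> multiply to at least \<open>(m - b) ^ b\<close>, and
  \<open>b\<close> factors counting down from \<open>s\<close> to at most \<open>s ^ b\<close>. The
  inequality is cross-multiplied to stay in the natural numbers.\<close>

lemma choose_ratio:
  assumes "b \<le> m"
  shows "(s choose b) * (m - b) ^ b \<le> (m choose b) * s ^ b"
proof -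
  have fact_ge: "fact j * j ^ i \<le> (fact (j + i) :: nat)" for i j
  proof (induction i)
    case (Suc i)
    have "fact j * j ^ Suc i = j * (fact j * j ^ i)" by simp
    also have "\<dots> \<le> (j + Suc i) * fact (j + i)"
      by (intro mult_mono Suc.IH) auto
    finally show ?case by (simp add: algebra_simps)
  qed simp
  have "fact (m - b) * (m - b) ^ b \<le> (fact (m - b + b) :: nat)"
    by (rule fact_ge)
  also have "\<dots> = fact (m - b) * (fact b * (m choose b))"
    using binomial_fact_lemma[OF assms] assms by (simp add: mult_ac)
  finally have 1: "(m - b) ^ b \<le> fact b * (m choose b)"
    by simp
  have "fact b * ((s choose b) * (m - b) ^ b) \<le> s ^ b * (fact b * (m choose b))"
    using mult_mono[OF binomial_fact_pow[of s b] 1] by (simp add: mult_ac)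
  then have "fact b * ((s choose b) * (m - b) ^ b) \<le> fact b * ((m choose b) * s ^ b)"
    by (simp add: mult_ac)
  then show ?thesis
    by (simp only: mult_le_cancel1) simp
qed

text \<open>Markov's inequality for the number of \<open>b\<close>-subsets of the random set; it plays the role of a Chernoff
  bound but only needs the events ``\<open>B\<close> is contained in the random set'' for small \<open>B\<close>.\<close>
lemma prb_card_ge_le_choose:
  fixes q :: real
  assumes "finite S" "\<And>B. B \<subseteq> S \<Longrightarrow> card B = b \<Longrightarrow> prb M {x. B \<subseteq> X x} \<le> q"
  shows "prb M {x. m \<le> card (X x \<inter> S)} * (m choose b) \<le> (card S choose b) * q"
proof -
  have "finite {B. B \<subseteq> S \<and> card B = b}"
    using assms(1) by simp
  have "prb M {x. m \<le> card (X x \<inter> S)} * (m choose b) =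
      measure_pmf.expectation M (\<lambda>x. indicat_real {x. m \<le> card (X x \<inter> S)} x * (m choose b))"
    by simp
  also have "\<dots> \<le> measure_pmf.expectation M (\<lambda>x. \<Sum>B\<in>{B. B \<subseteq> S \<and> card B = b}. indicator {x. B \<subseteq> X x} x)"
  proof (intro integral_mono_AE)
    show "integrable M (\<lambda>x. \<Sum>B\<in>{B. B \<subseteq> S \<and> card B = b}. indicator {x. B \<subseteq> X x} x :: real)"
      by (intro Bochner_Integration.integrable_sum measure_pmf.integrable_const_bound[where B=1]) auto
    show "integrable M (\<lambda>x. indicat_real {x. m \<le> card (X x \<inter> S)} x * (m choose b))"
      by (intro integrable_mult_left measure_pmf.integrable_const_bound[where B=1]) auto
    have "indicator {x. m \<le> card (X x \<inter> S)} x * real (m choose b) \<le>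
        (\<Sum>B\<in>{B. B \<subseteq> S \<and> card B = b}. indicator {x. B \<subseteq> X x} x)" for x
    proof (cases "m \<le> card (X x \<inter> S)")
      case True
      have "m choose b \<le> (card (X x \<inter> S) choose b)"
        using True by (rule binomial_right_mono)
      also have "\<dots> = card {B. B \<subseteq> X x \<inter> S \<and> card B = b}"
        using assms(1) by (subst n_subsets) auto
      also have "{B. B \<subseteq> X x \<inter> S \<and> card B = b} = {B. B \<subseteq> S \<and> card B = b} \<inter> {B. B \<subseteq> X x}"
        by auto
      finally show ?thesis
        using True assms(1) by (simp add: sum.If_cases indicator_def)
    qed (auto intro!: sum_nonneg)
    then show "AE x in M. indicator {x. m \<le> card (X x \<inter> S)} x * real (m choose b) \<le>
        (\<Sum>B\<in>{B. B \<subseteq> S \<and> card B = b}. indicator {x. B \<subseteq> X x} x)" by simp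
  qed
  also have "\<dots> = (\<Sum>B\<in>{B. B \<subseteq> S \<and> card B = b}. prb M {x. B \<subseteq> X x})"
    by (subst Bochner_Integration.integral_sum)
      (auto intro!: measure_pmf.integrable_const_bound[where B=1])
  also have "\<dots> \<le> (\<Sum>B\<in>{B. B \<subseteq> S \<and> card B = b}. q)"
    by (intro sum_mono assms) auto
  also have "\<dots> = (card S choose b) * q"
    using assms(1) by (simp add: n_subsets)
  finally show ?thesis .
qed

text \<open>The counting bound divided by \<open>m choose b\<close>. It is useful when
  \<open>m\<close> exceeds the expected size \<open>card S * q\<close> by clearly more than
  \<open>b\<close>.\<close>

lemma prb_card_ge_le_power:
  fixes q :: real
  assumes S: "finite S" and B: "\<And>B. B \<subseteq> S \<Longrightarrow> card B = b \<Longrightarrow> prb M {x. B \<subseteq> X x} \<le> q ^ b"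
    and b: "b < m" and q: "0 \<le> q"
  shows "prb M {x. m \<le> card (X x \<inter> S)} \<le> (card S * q / (real m - real b)) ^ b"
proof -
  define P where "P = prb M {x. m \<le> card (X x \<inter> S)}"
  have P: "P * (m choose b) \<le> (card S choose b) * q ^ b"
    unfolding P_def by (rule prb_card_ge_le_choose[OF S B])
  have pos: "(0::real) < m choose b" "0 < real m - real b"
    using b by auto
  have ratio: "real (card S choose b) * (real m - real b) ^ b \<le> real (m choose b) * real (card S) ^ b"
    using choose_ratio[of b m "card S"] b
    by (metis (mono_tags) less_imp_le of_nat_diff of_nat_le_iff of_nat_mult of_nat_power)
  have "P * (m choose b) * (real m - real b) ^ b \<le> (card S choose b) * q ^ b * (real m - real b) ^ b"
    using P pos by (intro mult_right_mono) auto
  also have "\<dots> \<le> q ^ b * (real (m choose b) * real (card S) ^ b)"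
    using mult_left_mono[OF ratio, of "q ^ b"] q by (simp add: mult_ac)
  finally have "(m choose b) * (P * (real m - real b) ^ b) \<le> (m choose b) * (q ^ b * real (card S) ^ b)"
    by (simp add: mult_ac)
  then have "P * (real m - real b) ^ b \<le> q ^ b * real (card S) ^ b"
    using pos by (simp only: mult_le_cancel_left_pos)
  then show ?thesis
    using pos unfolding P_def by (simp add: field_simps power_divide power_mult_distrib)
qed

text \<open>Subtracting \<open>b\<close> from the threshold costs at most half of the slack, which
  leaves the ratio \<open>q / (q + \<zeta> / 2)\<close>. It increases with \<open>q\<close> and
  equals \<open>4 / (4 + \<zeta>)\<close> at \<open>q = 2\<close>. The range up to 2 lets
  \<open>q\<close> be a probability plus an approximation error.\<close>

lemma prb_card_ge_fraction:
  fixes q \<zeta> :: real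
  assumes S: "finite S" and B: "\<And>B. B \<subseteq> S \<Longrightarrow> card B = b \<Longrightarrow> prb M {x. B \<subseteq> X x} \<le> q ^ b"
    and q: "0 \<le> q" "q \<le> 2" and \<zeta>: "0 < \<zeta>" and b: "b \<le> \<zeta> / 2 * card S"
  shows "prb M {x. (q + \<zeta>) * card S \<le> card (X x \<inter> S)} \<le> (4 / (4 + \<zeta>)) ^ b"
proof (cases "card S = 0")
  case True
  then have "b = 0" using b by simp
  then show ?thesis by simp
next
  case False
  define m where "m = nat \<lceil>(q + \<zeta>) * card S\<rceil>"
  have s: "real (card S) > 0" using False by simp
  have m: "real m \<ge> (q + \<zeta>) * card S"
    unfolding m_def by linarith
  have "\<zeta> / 2 * card S + (q + \<zeta> / 2) * card S = (q + \<zeta>) * card S"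
    by (simp add: field_simps)
  moreover have pos: "(q + \<zeta> / 2) * card S > 0"
    using s q \<zeta> by simp
  ultimately have mb: "real m - real b \<ge> (q + \<zeta> / 2) * card S" "b < m"
    using m b by linarith+
  have "{x. (q + \<zeta>) * card S \<le> card (X x \<inter> S)} = {x. m \<le> card (X x \<inter> S)}"
    unfolding m_def by (simp add: nat_le_iff ceiling_le_iff)
  then have "prb M {x. (q + \<zeta>) * card S \<le> card (X x \<inter> S)} \<le> (card S * q / (real m - real b)) ^ b"
    using prb_card_ge_le_power[OF S B mb(2) q(1)] by simp
  also have "\<dots> \<le> (4 / (4 + \<zeta>)) ^ b"
  proof (rule power_mono)
    have "card S * q / (real m - real b) \<le> card S * q / ((q + \<zeta> / 2) * card S)"
    proof (rule divide_left_mono[OF mb(1)])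
      have "0 < real m - real b" using mb(1) pos by linarith
      then show "0 < (real m - real b) * ((q + \<zeta> / 2) * card S)" using pos by (rule mult_pos_pos)
    qed (use q in simp)
    also have "\<dots> = q / (q + \<zeta> / 2)"
      using s by simp
    also have "\<dots> \<le> 4 / (4 + \<zeta>)"
    proof -
      have "q * \<zeta> \<le> 2 * \<zeta>" using q \<zeta> by (intro mult_right_mono) auto
      then show ?thesis using q \<zeta> by (simp add: divide_simps algebra_simps)
    qed
    finally show "card S * q / (real m - real b) \<le> 4 / (4 + \<zeta>)" .
  qed (use mb q in auto)
  finally show ?thesis .
qed

text \<open>The upper bound applied to the complement \<open>S - X x\<close>. The limit
  \<open>- 1\<close> for \<open>q\<close> mirrors the limit 2 for \<open>1 - q\<close>, so that a
  small probability minus an error is a legal value.\<close>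

lemma prb_card_le_fraction:
  fixes q \<zeta> :: real
  assumes S: "finite S" and B: "\<And>B. B \<subseteq> S \<Longrightarrow> card B = b \<Longrightarrow> prb M {x. B \<inter> X x = {}} \<le> (1 - q) ^ b"
    and q: "- 1 \<le> q" "q \<le> 1" and \<zeta>: "0 < \<zeta>" and b: "b \<le> \<zeta> / 2 * card S"
  shows "prb M {x. card (X x \<inter> S) \<le> (q - \<zeta>) * card S} \<le> (4 / (4 + \<zeta>)) ^ b"
proof -
  have "prb M {x. (1 - q + \<zeta>) * card S \<le> card ((S - X x) \<inter> S)} \<le> (4 / (4 + \<zeta>)) ^ b"
  proof (rule prb_card_ge_fraction[OF S])
    fix B assume "B \<subseteq> S" "card B = b"
    then have "prb M {x. B \<inter> X x = {}} \<le> (1 - q) ^ b" by (rule B)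
    moreover have "{x. B \<subseteq> S - X x} = {x. B \<inter> X x = {}}"
      using \<open>B \<subseteq> S\<close> by auto
    ultimately show "prb M {x. B \<subseteq> S - X x} \<le> (1 - q) ^ b" by simp
  qed (use q \<zeta> b in auto)
  moreover have "{x. (1 - q + \<zeta>) * card S \<le> card ((S - X x) \<inter> S)} = {x. card (X x \<inter> S) \<le> (q - \<zeta>) * card S}"
  proof -
    have eq: "real (card ((S - X x) \<inter> S)) = real (card S) - real (card (X x \<inter> S))" for x
    proof -
      have "(S - X x) \<inter> S = S - X x \<inter> S" by auto
      then show ?thesis
        using S by (simp add: card_Diff_subset_Int of_nat_diff card_mono Int_commute)
    qed
    show ?thesis unfolding eq by (simp add: algebra_simps)
  qed
  ultimately show ?thesis by simp
qed

section \<open>Tails and point masses of the binomial distribution with success probability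
  1/2\<close>

lemma binomial_half_ge_le:
  assumes "\<epsilon> \<ge> 0"
  shows "prb (binomial_pmf n (1/2)) {j. real j \<ge> n / 2 + \<epsilon>} \<le> exp (- 2 * \<epsilon>\<^sup>2 / n)"
proof (cases "n = 0")
  case False
  then show ?thesis
    using binomial_distribution.prob_ge[of "1/2" n \<epsilon>] assms
    by (simp add: binomial_distribution_def)
qed simp

lemma binomial_half_le_le:
  assumes "\<epsilon> \<ge> 0"
  shows "prb (binomial_pmf n (1/2)) {j. real j \<le> n / 2 - \<epsilon>} \<le> exp (- 2 * \<epsilon>\<^sup>2 / n)"
proof (cases "n = 0")
  case False
  then show ?thesis
    using binomial_distribution.prob_le[of "1/2" n \<epsilon>] assms
    by (simp add: binomial_distribution_def)
qed simp

text \<open>Consecutive central coefficients have quotient 2 (2n + 1) / (n + 1), so by (2n + 1)(2n +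
  3) \<le> (2n + 2)^2 the left-hand side grows by a factor of at most 4 per step.\<close>

lemma central_binomial_le:
  "real ((2 * n) choose n) * sqrt (2 * n + 1) \<le> 4 ^ n"
proof (induction n)
  case (Suc n)
  have "Suc n * (2 * Suc n choose Suc n) = 2 * (2 * n + 1) * (2 * n choose n)"
  proof -
    have "Suc n * (Suc (Suc (2*n)) choose Suc n) = Suc (Suc (2*n)) * (Suc (2*n) choose n)"
      by (rule Suc_times_binomial)
    moreover have "Suc n * (Suc (2*n) choose n) = Suc (2*n) * (2*n choose n)"
      using Suc_times_binomial_eq[of "2*n" n] binomial_symmetric[of n "Suc (2*n)"]
        Suc_times_binomial[of n "2*n"] by (simp add: Suc_diff_le)
    ultimately have "Suc n * (Suc n * (2 * Suc n choose Suc n)) = Suc n * (2 * (2 * n + 1) * (2 * n choose n))"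
      by (simp add: algebra_simps)
    then show ?thesis by (simp only: mult_cancel1) simp
  qed
  then have "real (Suc n * (2 * Suc n choose Suc n)) = real (2 * (2 * n + 1) * (2 * n choose n))"
    by (rule arg_cong)
  then have eq: "real (2 * Suc n choose Suc n) = 2 * (2 * n + 1) * real (2 * n choose n) / Suc n"
    by (simp add: field_simps)
  have "2 * (2 * n + 1) * sqrt (2 * Suc n + 1) \<le> 4 * real (Suc n) * sqrt (2 * n + 1)"
  proof (rule power2_le_imp_le)
    have "real (2 * n + 1) * (2 * n + 3) \<le> (2 * (real n + 1))\<^sup>2"
      by (simp add: power2_eq_square algebra_simps)
    then have "4 * real (2 * n + 1) * (real (2 * n + 1) * (2 * n + 3)) \<le> 4 * real (2 * n + 1) * (2 * (real n + 1))\<^sup>2"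
      by (intro mult_left_mono) auto
    then show "(2 * (2 * n + 1) * sqrt (2 * Suc n + 1))\<^sup>2 \<le> (4 * real (Suc n) * sqrt (2 * n + 1))\<^sup>2"
      by (simp add: power_mult_distrib power2_eq_square algebra_simps)
  qed simp
  then have "2 * (2 * n + 1) / Suc n * sqrt (2 * Suc n + 1) \<le> 4 * sqrt (2 * n + 1)"
    by (simp add: field_simps)
  then have "real (2 * n choose n) * (2 * (2 * n + 1) / Suc n * sqrt (2 * Suc n + 1))
      \<le> real (2 * n choose n) * (4 * sqrt (2 * n + 1))"
    by (intro mult_left_mono) auto
  then have "real (2 * Suc n choose Suc n) * sqrt (2 * Suc n + 1) \<le> 4 * (real (2 * n choose n) * sqrt (2 * n + 1))"
    unfolding eq by (simp add: mult_ac)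
  also have "\<dots> \<le> 4 * 4 ^ n"
    using Suc.IH by simp
  finally show ?case by simp
qed simp

text \<open>The largest point mass sits in the middle. For odd \<open>n\<close> Pascal's rule bounds
  it by two central coefficients of the even number below, which is the origin of the 2. In phase 2
  this keeps many clique vertices from sharing one degree.\<close>

lemma binomial_half_point_le:
  assumes "n > 0"
  shows "prb (binomial_pmf n (1/2)) {x} \<le> 2 / sqrt n"
proof -
  define h where "h = n div 2"
  have pm: "prb (binomial_pmf n (1/2)) {x} = (n choose x) / 2 ^ n"
  proof (cases "x \<le> n")
    case True
    have "(1 / 2 :: real) ^ x * (1 / 2) ^ (n - x) = (1/2) ^ n"
      using True by (simp flip: power_add)
    then show ?thesis
      by (simp add: measure_pmf_single power_one_over field_simps)
  next
    case False
    then show ?thesis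
      by (simp add: measure_pmf_single binomial_eq_0)
  qed
  have "real (n choose x) / 2 ^ n \<le> 2 * (2 * h choose h) / 4 ^ h"
  proof (cases "even n")
    case True
    then have n: "n = 2 * h" by (simp add: h_def)
    have "real (n choose x) \<le> 2 * h choose h"
      using binomial_maximum'[of h x] n by simp
    also have "\<dots> \<le> 2 * (2 * h choose h)" by simp
    finally show ?thesis
      unfolding n by (simp add: power_mult divide_right_mono)
  next
    case False
    then have n: "n = Suc (2 * h)" by (simp add: h_def)
    have "n choose x \<le> 2 * (2 * h choose h)"
    proof (cases x)
      case 0
      have "(2 * h choose h) \<ge> 1"
        by (metis One_nat_def Suc_leI le_add1 mult_2 zero_less_binomial_iff)
      then show ?thesis using 0 by simp
    next
      case (Suc y)
      then show ?thesis
        using binomial_maximum'[of h y] binomial_maximum'[of h "Suc y"] n by simp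
    qed
    then have "real (n choose x) \<le> 2 * (2 * h choose h)"
      by (metis of_nat_le_iff of_nat_mult of_nat_numeral)
    then have "real (n choose x) / 2 ^ n \<le> 2 * (2 * h choose h) / 2 ^ n"
      by (intro divide_right_mono) auto
    also have "\<dots> \<le> 2 * (2 * h choose h) / 4 ^ h"
      unfolding n by (intro divide_left_mono) (auto simp: power_mult)
    finally show ?thesis .
  qed
  also have "\<dots> \<le> 2 / sqrt (2 * h + 1)"
    using central_binomial_le[of h] by (simp add: field_simps)
  also have "\<dots> \<le> 2 / sqrt n"
    using assms by (intro divide_left_mono mult_pos_pos) (auto simp: h_def)
  finally show ?thesis using pm by simp
qed

section \<open>The normal tail as limit of binomial tails\<close>

text \<open>A normalised sum of \<open>n\<close> fair signs: \<open>2 * j - n\<close> has mean 0 and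
  variance \<open>n\<close>.\<close>

definition std_binomial :: "nat \<Rightarrow> real measure" where
  "std_binomial n = distr (binomial_pmf n (1/2)) borel (\<lambda>j. (2 * real j - n) / sqrt n)"

lemma real_distribution_std_binomial: "real_distribution (std_binomial n)"
  unfolding std_binomial_def by (rule prob_space.real_distribution_distr) (auto simp: measure_pmf.prob_space_axioms)

text \<open>A single sign contributes the average of two conjugate exponentials, a cosine, and the
  binomial theorem turns the expectation into its \<open>n\<close>-th power. Levy's theorem then
  leaves only the elementary limit of \<open>cos (t / sqrt n) ^ n\<close>.\<close>

lemma char_std_binomial: "char (std_binomial n) t = complex_of_real (cos (t / sqrt n) ^ n)"
proof -
  define \<theta> where "\<theta> = t / sqrt n"
  have "char (std_binomial n) t = measure_pmf.expectation (binomial_pmf n (1/2)) (\<lambda>j. iexp (t * ((2 * real j - n) / sqrt n)))"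
    unfolding char_def std_binomial_def by (subst integral_distr) auto
  also have "\<dots> = (\<Sum>k\<le>n. of_nat (n choose k) * (iexp \<theta> / 2) ^ k * (iexp (- \<theta>) / 2) ^ (n - k))"
  proof (subst expectation_binomial_pmf', goal_cases)
    case 2
    show ?case
    proof (intro sum.cong refl)
      fix k assume "k \<in> {..n}"
      then have k: "k \<le> n" by simp
      have "t * (2 * real k - n) = (real k - (real n - real k)) * t"
        by (simp add: algebra_simps)
      then have "t * ((2 * real k - n) / sqrt n) = real k * \<theta> + real (n - k) * (- \<theta>)"
        using k unfolding \<theta>_def by (simp add: of_nat_diff diff_divide_distrib algebra_simps)
      then have "iexp (t * ((2 * real k - n) / sqrt n)) = iexp \<theta> ^ k * iexp (- \<theta>) ^ (n - k)"
        by (simp only: exp_of_nat_mult[symmetric] exp_add[symmetric]) (simp add: algebra_simps)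
      then show "(real (n choose k) * (1 / 2) ^ k * (1 - 1 / 2) ^ (n - k)) *\<^sub>R iexp (t * ((2 * real k - n) / sqrt n)) =
         of_nat (n choose k) * (iexp \<theta> / 2) ^ k * (iexp (- \<theta>) / 2) ^ (n - k)"
        by (simp add: scaleR_conv_of_real power_divide)
    qed
  qed simp
  also have "\<dots> = (iexp \<theta> / 2 + iexp (- \<theta>) / 2) ^ n"
    by (simp only: binomial_ring)
  also have "iexp \<theta> / 2 + iexp (- \<theta>) / 2 = complex_of_real (cos \<theta>)"
    by (simp add: cos_of_real[symmetric] cos_exp_eq field_simps)
  finally show ?thesis
    by (simp add: \<theta>_def)
qed

lemma weak_conv_std_binomial: "weak_conv_m std_binomial std_normal_distribution"
proof (rule levy_continuity)
  fix t
  have "(\<lambda>n. cos (t / sqrt (real n)) ^ n) \<longlonglongrightarrow> exp (- (t * t / 2))"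
    by real_asymp
  then have "(\<lambda>n. cos (t / sqrt (real n)) ^ n) \<longlonglongrightarrow> exp (- (t\<^sup>2) / 2)"
    by (simp add: power2_eq_square)
  then show "(\<lambda>n. char (std_binomial n) t) \<longlonglongrightarrow> char std_normal_distribution t"
    unfolding char_std_binomial char_std_normal_distribution by (rule tendsto_of_real)
qed (auto simp: real_distribution_std_binomial real_dist_normal_dist)


text \<open>Near \<open>x\<close> the distribution function differs by a constant from the integral
  \<open>F\<close> of the continuous density with fixed left end, so the fundamental theorem of
  calculus applies. The intervals around \<open>x\<close> are nested to keep every point used in the
  interior.\<close>

lemma DERIV_cdf_std_normal:
  "(cdf std_normal_distribution has_real_derivative std_normal_density x) (at x)"
proof -
  interpret real_distribution std_normal_distribution by (rule real_dist_normal_dist)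
  define F where "F = (\<lambda>u. integral {x - 2..u} std_normal_density)"
  have cont: "continuous_on {x - 2..x + 2} std_normal_density"
    by (auto simp: std_normal_density_def intro!: continuous_intros)
  have F: "(F has_real_derivative std_normal_density u) (at u)" if "u \<in> {x - 1..x + 1}" for u
  proof -
    have "(F has_real_derivative std_normal_density u) (at u within {x - 2..x + 2})"
      unfolding F_def using that by (intro integral_has_real_derivative[OF cont]) auto
    then show ?thesis
      using that by (subst (asm) at_within_interior) (auto simp: interior_atLeastAtMost_real)
  qed
  have diff: "cdf std_normal_distribution u - cdf std_normal_distribution (x - 1) = F u - F (x - 1)"
    if "u \<in> {x - 1<..<x + 1}" for u
  proof -
    have "F (x - 1) \<le> F u"
      using that by (intro DERIV_nonneg_imp_nondecreasing[of _ _ F]) (auto intro!: F exI)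
    have "ennreal (cdf std_normal_distribution u - cdf std_normal_distribution (x - 1)) =
        emeasure std_normal_distribution {x - 1<..u}"
      using that by (simp add: cdf_diff_eq emeasure_eq_measure)
    also have "\<dots> = (\<integral>\<^sup>+ v. ennreal (std_normal_density v) * indicator {x - 1<..u} v \<partial>lborel)"
      by (subst emeasure_density) auto
    also have "\<dots> = (\<integral>\<^sup>+ v. ennreal (std_normal_density v) * indicator {x - 1..u} v \<partial>lborel)"
      by (intro nn_integral_cong_AE AE_I[where N="{x - 1}"]) (auto simp: indicator_def)
    also have "\<dots> = ennreal (F u - F (x - 1))"
      using that by (intro nn_integral_FTC_Icc) (auto intro!: F)
    finally show ?thesis
      using that \<open>F (x - 1) \<le> F u\<close> by (simp add: cdf_diff_eq)
  qed
  have "((\<lambda>u. F u - F (x - 1) + cdf std_normal_distribution (x - 1)) has_real_derivative std_normal_density x) (at x)"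
    by (auto intro!: derivative_eq_intros F)
  then show ?thesis
    by (rule has_field_derivative_transform_within_open[where S="{x - 1<..<x + 1}"])
      (auto simp: diff[symmetric])
qed

text \<open>Reflection at 0 preserves the density, so both half-lines carry the same mass.\<close>

lemma cdf_std_normal_0: "cdf std_normal_distribution 0 = 1 / 2"
proof -
  interpret real_distribution std_normal_distribution by (rule real_dist_normal_dist)
  have "emeasure std_normal_distribution {..0} = (\<integral>\<^sup>+ x. ennreal (std_normal_density x) * indicator {..0} x \<partial>lborel)"
    by (subst emeasure_density) auto
  also have "\<dots> = (\<integral>\<^sup>+ x. ennreal (std_normal_density (0 + (-1) * x)) * indicator {..0} (0 + (-1) * x) \<partial>lborel)"
    by (subst nn_integral_real_affine[where c="-1" and t=0]) auto
  also have "\<dots> = (\<integral>\<^sup>+ x. ennreal (std_normal_density x) * indicator {0<..} x \<partial>lborel)"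
    by (intro nn_integral_cong_AE AE_I[where N="{0}"]) (auto simp: indicator_def std_normal_density_def)
  also have "\<dots> = emeasure std_normal_distribution {0<..}"
    by (subst emeasure_density) auto
  finally have "prob {..0} = prob {0<..}"
    by (simp add: emeasure_eq_measure)
  moreover have "prob {0<..} = 1 - prob {..0}"
    using prob_compl[of "{..0}"] by (simp add: Compl_eq_Diff_UNIV[symmetric])
  ultimately show ?thesis by (simp add: cdf_def)
qed

lemma DERIV_Phi_bar: "(Phi_bar has_real_derivative - std_normal_density x) (at x)"
  unfolding Phi_bar_def[abs_def] by (auto intro!: derivative_eq_intros DERIV_cdf_std_normal)

lemma isCont_Phi_bar [simp]: "isCont Phi_bar x"
  using DERIV_Phi_bar by (rule DERIV_isCont)

lemma Phi_bar_strict_antimono: "x < y \<Longrightarrow> Phi_bar y < Phi_bar x"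
  by (rule DERIV_neg_imp_decreasing[of x y Phi_bar])
    (auto intro!: DERIV_Phi_bar exI simp: normal_density_pos)

lemma Phi_bar_antimono: "x \<le> y \<Longrightarrow> Phi_bar y \<le> Phi_bar x"
  using Phi_bar_strict_antimono[of x y] by (cases "x = y") auto

lemma Phi_bar_pos [simp]: "0 < Phi_bar x"
proof -
  interpret real_distribution std_normal_distribution by (rule real_dist_normal_dist)
  have "0 \<le> Phi_bar (x + 1)"
    by (simp add: Phi_bar_def cdf_def)
  also have "\<dots> < Phi_bar x" by (rule Phi_bar_strict_antimono) simp
  finally show ?thesis .
qed

lemma Phi_bar_less_1 [simp]: "Phi_bar x < 1"
proof -
  interpret real_distribution std_normal_distribution by (rule real_dist_normal_dist)
  have "Phi_bar x < Phi_bar (x - 1)" by (rule Phi_bar_strict_antimono) simp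
  also have "\<dots> \<le> 1" by (simp add: Phi_bar_def cdf_def)
  finally show ?thesis .
qed

section \<open>Binomial tails against the normal tail, uniformly in the threshold\<close>

definition upper_tail :: "nat \<Rightarrow> real \<Rightarrow> real" where
  "upper_tail m z = prb (binomial_pmf m (1/2)) {j. real j \<ge> m / 2 + z * sqrt m / 2}"

lemma upper_tail_antimono: "z \<le> z' \<Longrightarrow> upper_tail m z' \<le> upper_tail m z"
  unfolding upper_tail_def
proof (intro prb_mono)
  fix j assume z: "z \<le> z'" and j: "j \<in> {j. real j \<ge> m / 2 + z' * sqrt m / 2}"
  have "z * sqrt m \<le> z' * sqrt m"
    using z by (intro mult_right_mono) auto
  then show "j \<in> {j. real j \<ge> m / 2 + z * sqrt m / 2}"
    using j by auto
qed

lemma cdf_std_binomial: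
  assumes "m > 0"
  shows "cdf (std_binomial m) z = prb (binomial_pmf m (1/2)) {j. real j \<le> m / 2 + z * sqrt m / 2}"
proof -
  have "cdf (std_binomial m) z = prb (binomial_pmf m (1/2)) {j. (2 * real j - m) / sqrt m \<le> z}"
    unfolding cdf_def std_binomial_def by (subst measure_distr) (auto simp: vimage_def)
  also have "{j. (2 * real j - m) / sqrt m \<le> z} = {j. real j \<le> m / 2 + z * sqrt m / 2}"
    using assms by (auto simp: divide_le_eq field_simps)
  finally show ?thesis .
qed

lemma cdf_std_binomial_tendsto: "(\<lambda>m. cdf (std_binomial m) z) \<longlonglongrightarrow> 1 - Phi_bar z"
  using weak_conv_std_binomial DERIV_isCont[OF DERIV_cdf_std_normal]
  by (simp add: weak_conv_m_def weak_conv_def Phi_bar_def)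

text \<open>Convergence at a single threshold \<open>x\<close> slightly above \<open>z\<close> is
  enough: the tail decreases in its threshold, so the bound passes to every \<open>z'\<close> up to
  \<open>x\<close>. The slack \<zeta> later absorbs lower-order corrections to the degree
  thresholds.\<close>

lemma upper_tail_ge:
  assumes "p < Phi_bar z"
  shows "\<exists>\<zeta>>0. \<exists>M. \<forall>m\<ge>M. \<forall>z'\<le>z + \<zeta>. p \<le> upper_tail m z'"
proof -
  have "\<forall>\<^sub>F x in at_right z. p < Phi_bar x"
    using assms isCont_Phi_bar[of z] by (intro order_tendstoD(1)[of _ "Phi_bar z"])
      (auto simp: continuous_within intro: tendsto_within_subset)
  then obtain x where x: "x > z" "p < Phi_bar x"
    by (metis (no_types, lifting) eventually_at_right_field gt_ex dense order_less_le_trans)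
  have "\<forall>\<^sub>F m in sequentially. cdf (std_binomial m) x < 1 - p"
    using x by (intro order_tendstoD(2)[OF cdf_std_binomial_tendsto]) auto
  then obtain M where M: "\<And>m. m \<ge> M \<Longrightarrow> cdf (std_binomial m) x < 1 - p"
    by (auto simp: eventually_sequentially)
  have *: "p \<le> upper_tail m z'" if "m \<ge> max M 1" "z' \<le> z + (x - z)" for m z'
  proof -
    have "prb (binomial_pmf m (1/2)) (UNIV - {j. real j \<le> m / 2 + x * sqrt m / 2}) = 1 - cdf (std_binomial m) x"
      using that by (subst measure_pmf.prob_compl[simplified]) (auto simp: cdf_std_binomial)
    moreover have "prb (binomial_pmf m (1/2)) (UNIV - {j. real j \<le> m / 2 + x * sqrt m / 2}) \<le> upper_tail m x"
      unfolding upper_tail_def by (intro prb_mono) auto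
    ultimately have "p \<le> upper_tail m x" using M[of m] that by auto
    also have "\<dots> \<le> upper_tail m z'"
      using that by (intro upper_tail_antimono) auto
    finally show ?thesis .
  qed
  show ?thesis
    using x * by (intro exI[of _ "x - z"] conjI exI[of _ "max M 1"] allI impI) (simp, blast)
qed

lemma upper_tail_le:
  assumes "Phi_bar z < p"
  shows "\<exists>\<zeta>>0. \<exists>M. \<forall>m\<ge>M. \<forall>z'\<ge>z - \<zeta>. upper_tail m z' \<le> p"
proof -
  have "\<forall>\<^sub>F x in at_left z. Phi_bar x < p"
    using assms isCont_Phi_bar[of z] by (intro order_tendstoD(2)[of _ "Phi_bar z"])
      (auto simp: continuous_within intro: tendsto_within_subset)
  then obtain x where x: "x < z" "Phi_bar x < p"
    by (metis (no_types, lifting) eventually_at_left_field lt_ex dense order_less_le_trans)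
  have "\<forall>\<^sub>F m in sequentially. 1 - p < cdf (std_binomial m) x"
    using x by (intro order_tendstoD(1)[OF cdf_std_binomial_tendsto]) auto
  then obtain M where M: "\<And>m. m \<ge> M \<Longrightarrow> 1 - p < cdf (std_binomial m) x"
    by (auto simp: eventually_sequentially)
  \<comment> \<open>The distribution function controls the values strictly above \<open>x\<close>,
    while \<open>upper_tail\<close> includes its threshold; a point strictly between
    \<open>x\<close> and \<open>z\<close> reconciles the two.\<close>
  define y where "y = (x + z) / 2"
  have y: "x < y" "y < z" using x by (auto simp: y_def)
  have *: "upper_tail m z' \<le> p" if "m \<ge> max M 1" "z' \<ge> z - (z - y)" for m z'
  proof -
    have "upper_tail m z' \<le> upper_tail m y"
      using that by (intro upper_tail_antimono) auto
    also have "\<dots> \<le> prb (binomial_pmf m (1/2)) (UNIV - {j. real j \<le> m / 2 + x * sqrt m / 2})"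
    proof -
      have "x * sqrt m < y * sqrt m" using that y by (intro mult_strict_right_mono) auto
      then show ?thesis
        unfolding upper_tail_def by (intro prb_mono) auto
    qed
    also have "\<dots> = 1 - cdf (std_binomial m) x"
      using that by (subst measure_pmf.prob_compl[simplified]) (auto simp: cdf_std_binomial)
    finally show ?thesis using M[of m] that by auto
  qed
  show ?thesis
    using y * by (intro exI[of _ "z - y"] conjI exI[of _ "max M 1"] allI impI) (simp, blast)
qed

section \<open>Numerical bounds on the normal tail\<close>

text \<open>Partial sums of the power series of the integral of exp(-u^2 / 2) for u from 0 to
  \<open>x\<close>, from integrating the exponential series term by term.\<close>

definition gauss_sum :: "nat \<Rightarrow> real \<Rightarrow> real" where
  "gauss_sum n x = (\<Sum>k<n. (- 1) ^ k / (2 ^ k * fact k * (2 * real k + 1)) * x ^ (2 * k + 1))"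

lemma DERIV_gauss_sum:
  "(gauss_sum n has_real_derivative (\<Sum>k<n. (- (x\<^sup>2 / 2)) ^ k / fact k)) (at x)"
proof -
  have "(gauss_sum n has_real_derivative
      (\<Sum>k<n. (- 1) ^ k / (2 ^ k * fact k * (2 * real k + 1)) * ((2 * real k + 1) * x ^ (2 * k)))) (at x)"
    unfolding gauss_sum_def[abs_def]
  proof (intro DERIV_sum DERIV_cmult)
    show "((\<lambda>x. x ^ (2 * k + 1)) has_real_derivative (2 * real k + 1) * x ^ (2 * k)) (at x)" for k
      using DERIV_pow[of "2 * k + 1" x UNIV] by (simp add: add.commute)
  qed
  moreover have "(- 1) ^ k / (2 ^ k * fact k * (2 * real k + 1)) * ((2 * real k + 1) * x ^ (2 * k)) = (- (x\<^sup>2 / 2)) ^ k / fact k" for k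
  proof -
    have "(- (x\<^sup>2 / 2)) ^ k = ((- 1) * (x\<^sup>2 / 2)) ^ k" by simp
    also have "\<dots> = (- 1) ^ k * (x ^ (2 * k) / 2 ^ k)"
      by (simp only: power_mult_distrib power_divide power_mult)
    finally have eq: "(- (x\<^sup>2 / 2)) ^ k = (- 1) ^ k * (x ^ (2 * k) / 2 ^ k)" .
    have "2 * real k + 1 \<noteq> 0" by linarith
    then show ?thesis
      unfolding eq by (simp add: divide_simps)
  qed
  ultimately show ?thesis by simp
qed

text \<open>The Lagrange remainder is a positive multiple of \<open>(- y) ^ n\<close>, so its sign
  is decided by the parity of \<open>n\<close>.\<close>

lemma exp_minus_partial_sums:
  fixes y :: real
  assumes "y \<ge> 0"
  shows "even n \<Longrightarrow> (\<Sum>k<n. (- y) ^ k / fact k) \<le> exp (- y)"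
    and "odd n \<Longrightarrow> exp (- y) \<le> (\<Sum>k<n. (- y) ^ k / fact k)"
proof -
  obtain t where "exp (- y) = (\<Sum>k<n. (- y) ^ k / fact k) + exp t / fact n * (- y) ^ n"
    using Maclaurin_exp_le[of "- y" n] by blast
  then show "even n \<Longrightarrow> (\<Sum>k<n. (- y) ^ k / fact k) \<le> exp (- y)"
    and "odd n \<Longrightarrow> exp (- y) \<le> (\<Sum>k<n. (- y) ^ k / fact k)"
    using assms by (auto simp: power_minus_odd)
qed

lemma Phi_bar_0: "Phi_bar 0 = 1 / 2"
  by (simp add: Phi_bar_def cdf_std_normal_0)

text \<open>The difference of the two sides vanishes at 0, where the tail is 1/2, and it is monotone
  because its derivative is a remainder of the exponential series, whose sign is fixed by the parity
  of \<open>n\<close>.\<close>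

lemma Phi_bar_le_gauss_sum:
  assumes "x \<ge> 0" "even n"
  shows "Phi_bar x \<le> 1 / 2 - gauss_sum n x / sqrt (2 * pi)"
proof -
  define g where "g x = 1 / 2 - gauss_sum n x / sqrt (2 * pi) - Phi_bar x" for x
  have "g 0 \<le> g x"
  proof (rule DERIV_nonneg_imp_nondecreasing[OF assms(1)])
    fix x :: real assume "0 \<le> x"
    have "(g has_real_derivative (- (\<Sum>k<n. (- (x\<^sup>2 / 2)) ^ k / fact k) / sqrt (2 * pi) + std_normal_density x)) (at x)"
      using DERIV_diff[OF DERIV_diff[OF DERIV_const DERIV_cdivide[OF DERIV_gauss_sum]] DERIV_Phi_bar]
      unfolding g_def[abs_def] by simp
    moreover have "- (\<Sum>k<n. (- (x\<^sup>2 / 2)) ^ k / fact k) / sqrt (2 * pi) + std_normal_density x \<ge> 0"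
      using exp_minus_partial_sums(1)[of "x\<^sup>2 / 2" n] assms(2)
      by (simp add: std_normal_density_def divide_right_mono)
    ultimately show "\<exists>y. (g has_real_derivative y) (at x) \<and> 0 \<le> y" by blast
  qed
  moreover have "g 0 = 0"
    by (simp add: g_def gauss_sum_def Phi_bar_0)
  ultimately show ?thesis by (simp add: g_def)
qed

lemma Phi_bar_ge_gauss_sum:
  assumes "x \<ge> 0" "odd n"
  shows "1 / 2 - gauss_sum n x / sqrt (2 * pi) \<le> Phi_bar x"
proof -
  define g where "g x = Phi_bar x - (1 / 2 - gauss_sum n x / sqrt (2 * pi))" for x
  have "g 0 \<le> g x"
  proof (rule DERIV_nonneg_imp_nondecreasing[OF assms(1)])
    fix x :: real assume "0 \<le> x"
    have "(g has_real_derivative (- std_normal_density x + (\<Sum>k<n. (- (x\<^sup>2 / 2)) ^ k / fact k) / sqrt (2 * pi))) (at x)"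
      using DERIV_diff[OF DERIV_Phi_bar DERIV_diff[OF DERIV_const DERIV_cdivide[OF DERIV_gauss_sum]]]
      unfolding g_def[abs_def] by simp
    moreover have "- std_normal_density x + (\<Sum>k<n. (- (x\<^sup>2 / 2)) ^ k / fact k) / sqrt (2 * pi) \<ge> 0"
      using exp_minus_partial_sums(2)[of "x\<^sup>2 / 2" n] assms(2)
      by (simp add: std_normal_density_def divide_right_mono)
    ultimately show "\<exists>y. (g has_real_derivative y) (at x) \<and> 0 \<le> y" by blast
  qed
  moreover have "g 0 = 0"
    by (simp add: g_def gauss_sum_def Phi_bar_0)
  ultimately show ?thesis by (simp add: g_def)
qed

lemma inverse_sqrt_2pi: "0.3989422 \<le> 1 / sqrt (2 * pi)" "1 / sqrt (2 * pi) \<le> 0.3989423"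
proof -
  have "sqrt (2 * pi) \<le> 1 / 0.3989422"
    using pi_approx by (intro real_le_lsqrt) (auto simp: power2_eq_square)
  then show "0.3989422 \<le> 1 / sqrt (2 * pi)"
    by (simp add: field_simps)
  have "1 / 0.3989423 \<le> sqrt (2 * pi)"
    using pi_approx by (intro real_le_rsqrt) (auto simp: power2_eq_square)
  then show "1 / sqrt (2 * pi) \<le> 0.3989423"
    by (simp add: field_simps)
qed

text \<open>\<open>y\<close> is a decimal stand-in for the partial sum, which reduces everything to
  rational arithmetic; 0.3989422 rounds 1 / sqrt (2 pi) down, the safe direction for an upper
  bound.\<close>

lemma Phi_bar_leI:
  assumes "x \<ge> 0" "even n" "0 \<le> y" "y \<le> gauss_sum n x" "1 / 2 - y * 0.3989422 \<le> z"
  shows "Phi_bar x \<le> z"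
proof -
  have "y * 0.3989422 \<le> gauss_sum n x * (1 / sqrt (2 * pi))"
    using assms inverse_sqrt_2pi by (intro mult_mono) auto
  moreover have "gauss_sum n x / sqrt (2 * pi) = gauss_sum n x * (1 / sqrt (2 * pi))"
    by simp
  ultimately show ?thesis
    using Phi_bar_le_gauss_sum[OF assms(1,2)] assms(5) by linarith
qed

lemma Phi_bar_geI:
  assumes "x \<ge> 0" "odd n" "0 \<le> y" "gauss_sum n x \<le> y" "z \<le> 1 / 2 - y * 0.3989423"
  shows "z \<le> Phi_bar x"
proof -
  have "gauss_sum n x * (1 / sqrt (2 * pi)) \<le> y * 0.3989423"
    using assms inverse_sqrt_2pi by (intro mult_mono) auto
  moreover have "gauss_sum n x / sqrt (2 * pi) = gauss_sum n x * (1 / sqrt (2 * pi))"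
    by simp
  ultimately show ?thesis
    using Phi_bar_ge_gauss_sum[OF assms(1,2)] assms(5) by linarith
qed

text \<open>The arguments of the four numerical bounds come from the parameters: 1.2 and 2.3 are
  \<eta> and \<beta>, while 0.0722 and 0.7334 bound the shifted thresholds
  \<open>\<eta> - c * sqrt \<alpha>\<close> and
  \<open>\<beta> - c * \<delta> / sqrt \<gamma>\<close> from above for \<alpha> = 0.8 and c \<ge>
  1.261. Larger arguments take more terms of the series.\<close>

lemma Phi_bar_0_0722: "0.47122 \<le> Phi_bar 0.0722"
  by (rule Phi_bar_geI[where n=3 and y="0.07213738"])
    (simp, simp, simp, simp add: gauss_sum_def eval_nat_numeral lessThan_Suc, simp)

lemma Phi_bar_0_7334: "0.2316 \<le> Phi_bar 0.7334"
  by (rule Phi_bar_geI[where n=7 and y="0.6727"])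
    (simp, simp, simp, simp add: gauss_sum_def eval_nat_numeral lessThan_Suc, simp)

lemma Phi_bar_1_2: "Phi_bar 1.2 \<le> 0.11508"
  by (rule Phi_bar_leI[where n=10 and y="0.96487"])
    (simp, simp, simp, simp add: gauss_sum_def eval_nat_numeral lessThan_Suc, simp)

lemma Phi_bar_2_3: "Phi_bar 2.3 \<le> 0.010725"
  by (rule Phi_bar_leI[where n=18 and y="1.226431"])
    (simp, simp, simp, simp add: gauss_sum_def eval_nat_numeral lessThan_Suc, simp)

text \<open>The parameters nearly maximize \<open>\<rho>\<^sup>2 / \<tau>\<close> at \<open>c = 1.261\<close>, where the maximum is only about
  \<open>1.0015\<close>; hence the four digits in the bounds above.\<close>
lemma parameters:
  fixes c :: real
  assumes "c \<ge> 1.261"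
  shows "(rho c 0.8 2.3 1.2)\<^sup>2 / tau 0.8 2.3 > 1"
proof -
  define \<gamma> where "\<gamma> = gam 0.8 1.2"
  define \<delta> where "\<delta> = del c 0.8 1.2"
  have g0: "0 < \<gamma>"
    by (simp add: \<gamma>_def gam_def)
  \<comment> \<open>0.8 times 0.11508 is 0.092064, and 0.303421 is its square root rounded
    up.\<close>
  have "\<gamma> \<le> 0.303421\<^sup>2"
    using Phi_bar_1_2 by (simp add: \<gamma>_def gam_def power2_eq_square)
  then have g: "sqrt \<gamma> \<le> 0.303421"
    by (intro real_le_lsqrt) auto
  have s: "0.8944 \<le> sqrt (0.8 :: real)"
    by (intro real_le_rsqrt) (simp add: power2_eq_square)
  have "1.2 - c * sqrt 0.8 \<le> 1.2 - 1.261 * 0.8944"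
    using mult_mono[OF assms s] assms by simp
  also have "\<dots> \<le> 0.0722" by simp
  finally have "Phi_bar 0.0722 \<le> Phi_bar (1.2 - c * sqrt 0.8)"
    by (rule Phi_bar_antimono)
  then have d: "0.376976 \<le> \<delta>"
    using Phi_bar_0_0722 unfolding \<delta>_def del_def by simp
  have "1.261 * 0.376976 / 0.303421 \<le> c * \<delta> / sqrt \<gamma>"
    using assms d g g0 by (intro frac_le mult_mono) auto
  then have "2.3 - c * \<delta> / sqrt \<gamma> \<le> 0.7334" by simp
  then have "0.2316 \<le> Phi_bar (2.3 - c * \<delta> / sqrt \<gamma>)"
    using Phi_bar_antimono Phi_bar_0_7334 by (meson order_trans)
  then have r: "0.04632 \<le> rho c 0.8 2.3 1.2"
    unfolding rho_def \<gamma>_def \<delta>_def by simp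
  have t: "0 < tau 0.8 2.3" "tau 0.8 2.3 \<le> 0.002145"
    using Phi_bar_2_3 by (auto simp: tau_def)
  \<comment> \<open>The square of 0.04632 is 0.0021455424, so the relative margin over 0.002145 is
    only about 0.00025.\<close>
  have "tau 0.8 2.3 < 0.04632\<^sup>2"
    using t by (simp add: power2_eq_square)
  also have "\<dots> \<le> (rho c 0.8 2.3 1.2)\<^sup>2"
    using r by (intro power_mono) auto
  finally show ?thesis
    using t by simp
qed

section \<open>Phase 1 as a Markov chain on vertex sets\<close>

text \<open>\<open>E\<close> is meant to hold only the random pairs, those not inside
  \<open>K\<close>; the clique edges are implicit. \<open>K\<close> may stick out of
  \<open>V\<close>: the original clique stays the parameter through all iterations while the current
  clique is \<open>K \<inter> V\<close>.\<close>

definition clique_graph :: "'a set \<Rightarrow> 'a set \<Rightarrow> 'a set set \<Rightarrow> 'a ugraph" where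
  "clique_graph K V E = (V, pairs (K \<inter> V) \<union> E)"

definition planted :: "'a set \<Rightarrow> 'a set \<Rightarrow> 'a ugraph pmf" where
  "planted K V = map_pmf (clique_graph K V) (random_subset (1/2) (pairs V - pairs K))"

definition core :: "real \<Rightarrow> 'a ugraph \<Rightarrow> 'a set \<Rightarrow> 'a set" where
  "core \<eta> G S = {v \<in> S. deg_into G S v \<ge> 1/2 * card S + \<eta> * (sqrt (card S) / 2)}"

definition survivors :: "real \<Rightarrow> real \<Rightarrow> 'a ugraph \<Rightarrow> 'a set \<Rightarrow> 'a set" where
  "survivors \<beta> \<eta> G S = {v \<in> verts G - S. deg_into G (core \<eta> G S) v \<ge>
     1/2 * card (core \<eta> G S) + \<beta> * (sqrt (card (core \<eta> G S)) / 2)}"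

text \<open>The potential edges between \<open>v\<close> and \<open>T\<close>. Removing
  \<open>v\<close> keeps the loop \<open>{v}\<close> out when \<open>v \<in> T\<close>.\<close>

definition star :: "'a \<Rightarrow> 'a set \<Rightarrow> 'a set set" where
  "star v T = (\<lambda>u. {u, v}) ` (T - {v})"

lemma verts_clique_graph [simp]: "verts (clique_graph K V E) = V"
  by (simp add: clique_graph_def)

lemma edges_clique_graph: "edges (clique_graph K V E) = pairs (K \<inter> V) \<union> E"
  by (simp add: clique_graph_def)

lemma finite_pairs [simp]: "finite V \<Longrightarrow> finite (pairs V)"
  unfolding pairs_def by (rule finite_subset[of _ "Pow V"]) auto

lemma pair_mem_pairs: "{u, v} \<in> pairs V \<longleftrightarrow> u \<noteq> v \<and> u \<in> V \<and> v \<in> V"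
  by (auto simp: pairs_def card_2_iff doubleton_eq_iff)

lemma singleton_notin_pairs [simp]: "{v} \<notin> pairs V"
  by (simp add: pairs_def)

lemma pairs_mono: "A \<subseteq> B \<Longrightarrow> pairs A \<subseteq> pairs B"
  by (auto simp: pairs_def)

lemma refine_eq: "refine \<beta> \<eta> G S = induced G (survivors \<beta> \<eta> G S)"
  by (simp add: refine_def survivors_def core_def Let_def)

lemma core_subset: "core \<eta> G S \<subseteq> S"
  by (auto simp: core_def)

lemma survivors_subset: "survivors \<beta> \<eta> G S \<subseteq> verts G - S"
  by (auto simp: survivors_def)

lemma deg_into_cong:
  assumes "\<And>u. u \<in> S \<Longrightarrow> {u, v} \<in> edges G \<longleftrightarrow> {u, v} \<in> edges G'"
  shows "deg_into G S v = deg_into G' S v"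
  unfolding deg_into_def using assms by (metis (mono_tags, lifting))

lemma core_cong:
  assumes "\<And>u v. u \<in> S \<Longrightarrow> v \<in> S \<Longrightarrow> {u, v} \<in> edges G \<longleftrightarrow> {u, v} \<in> edges G'"
  shows "core \<eta> G S = core \<eta> G' S"
proof -
  have "deg_into G S v = deg_into G' S v" if "v \<in> S" for v
    using assms that by (intro deg_into_cong) auto
  then show ?thesis by (auto simp: core_def)
qed

lemma survivors_cong:
  assumes "verts G = verts G'"
    "\<And>u v. u \<in> S \<Longrightarrow> v \<in> verts G \<Longrightarrow> {u, v} \<in> edges G \<longleftrightarrow> {u, v} \<in> edges G'" "S \<subseteq> verts G"
  shows "survivors \<beta> \<eta> G S = survivors \<beta> \<eta> G' S"
proof -
  have core: "core \<eta> G S = core \<eta> G' S"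
    using assms by (intro core_cong) auto
  have "deg_into G (core \<eta> G' S) v = deg_into G' (core \<eta> G' S) v" if "v \<in> verts G" for v
    using assms that core_subset[of \<eta> G' S] by (intro deg_into_cong) auto
  then show ?thesis
    unfolding survivors_def core using assms(1) by auto
qed

lemma finite_star [simp]: "finite T \<Longrightarrow> finite (star v T)"
  by (simp add: star_def)

lemma card_star: "v \<notin> T \<Longrightarrow> card (star v T) = card T"
  unfolding star_def by (subst card_image) (auto simp: inj_on_def doubleton_eq_iff)

lemma star_disjoint: "v \<noteq> w \<Longrightarrow> v \<notin> T \<Longrightarrow> w \<notin> T \<Longrightarrow> star v T \<inter> star w T = {}"
  by (auto simp: star_def doubleton_eq_iff)

lemma star_subset:
  assumes "insert v T \<subseteq> V" "v \<notin> K \<or> T \<inter> K = {}"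
  shows "star v T \<subseteq> pairs V - pairs K"
  using assms by (auto simp: star_def pair_mem_pairs)

lemma star_disjoint_pairs: "v \<notin> S \<Longrightarrow> star v T \<inter> pairs S = {}"
  by (auto simp: star_def pair_mem_pairs)

lemma card_star_Int:
  assumes "E \<subseteq> pairs V"
  shows "card (E \<inter> star v T) = card {u \<in> T. {u, v} \<in> E}"
proof -
  have "E \<inter> star v T = (\<lambda>u. {u, v}) ` {u \<in> T. {u, v} \<in> E}"
    using assms by (auto simp: star_def pair_mem_pairs subset_iff)
  moreover have "inj_on (\<lambda>u. {u, v}) {u \<in> T. {u, v} \<in> E}"
    by (auto simp: inj_on_def doubleton_eq_iff)
  ultimately show ?thesis by (simp add: card_image)
qed

lemma deg_into_outside:
  assumes "E \<subseteq> pairs V" "v \<notin> K"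
  shows "deg_into (clique_graph K V E) T v = card (E \<inter> star v T)"
  using assms by (simp add: card_star_Int deg_into_def edges_clique_graph pair_mem_pairs)

text \<open>Inside the clique nothing is random: \<open>v\<close> is adjacent to all of
  \<open>T \<inter> K\<close> except itself. Only the star into \<open>T - K\<close> carries
  randomness.\<close>

lemma deg_into_inside:
  assumes "E \<subseteq> pairs V - pairs K" "v \<in> K" "v \<in> V" "finite T" "T \<subseteq> V"
  shows "deg_into (clique_graph K V E) T v = card (T \<inter> K - {v}) + card (E \<inter> star v (T - K))"
proof -
  have "{u \<in> T. {u, v} \<in> edges (clique_graph K V E)} = (T \<inter> K - {v}) \<union> {u \<in> T - K. {u, v} \<in> E}"
    using assms singleton_notin_pairs[of v V]
    by (auto simp: edges_clique_graph pair_mem_pairs subset_iff simp del: singleton_notin_pairs)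
  then have "deg_into (clique_graph K V E) T v = card ((T \<inter> K - {v}) \<union> {u \<in> T - K. {u, v} \<in> E})"
    by (simp add: deg_into_def)
  also have "\<dots> = card (T \<inter> K - {v}) + card {u \<in> T - K. {u, v} \<in> E}"
    using assms by (intro card_Un_disjoint) auto
  also have "card {u \<in> T - K. {u, v} \<in> E} = card (E \<inter> star v (T - K))"
    using assms by (subst card_star_Int[of _ V]) auto
  finally show ?thesis .
qed

text \<open>Two stars into \<open>T\<close> with distinct centres outside \<open>T\<close> have no
  pair in common, so the degrees into \<open>T\<close> are independent and identically
  distributed.\<close>

lemma prb_stars:
  assumes "finite A" "finite B" "finite T" "B \<inter> T = {}" "\<And>v. v \<in> B \<Longrightarrow> star v T \<subseteq> A"
  shows "prb (random_subset (1/2) A) {E. \<forall>v\<in>B. Q (card (E \<inter> star v T))} =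
    prb (binomial_pmf (card T) (1/2)) {j. Q j} ^ card B"
proof -
  have "prb (random_subset (1/2) A) {E. \<forall>v\<in>B. Q (card (E \<inter> star v T))} =
      (\<Prod>v\<in>B. prb (binomial_pmf (card (star v T)) (1/2)) {j. Q j})"
  proof (intro prb_random_subset_cards)
    show "disjoint_family_on (\<lambda>v. star v T) B"
      using star_disjoint[of _ _ T] assms(4) unfolding disjoint_family_on_def by blast
  qed (use assms in auto)
  also have "\<dots> = (\<Prod>v\<in>B. prb (binomial_pmf (card T) (1/2)) {j. Q j})"
    using assms(4) by (intro prod.cong refl) (subst card_star, auto)
  finally show ?thesis by simp
qed

text \<open>The order of exposure within an iteration: pairs inside \<open>S\<close> determine the
  core, and the remaining ones decide who survives.\<close>

lemma planted_split:
  assumes "finite V" "S \<subseteq> V"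
  shows "planted K V = bind_pmf (random_subset (1/2) (pairs S - pairs K))
    (\<lambda>X. map_pmf (\<lambda>Y. clique_graph K V (X \<union> Y)) (random_subset (1/2) (pairs V - pairs K - pairs S)))"
proof -
  have eq: "pairs V - pairs K - (pairs S - pairs K) = pairs V - pairs K - pairs S"
    by auto
  have sub: "pairs S - pairs K \<subseteq> pairs V - pairs K"
    using pairs_mono[OF assms(2)] by auto
  show ?thesis
    unfolding planted_def random_subset_split[of "pairs V - pairs K", OF finite_Diff[OF finite_pairs[OF assms(1)]] sub] eq
    by (simp add: map_bind_pmf map_pmf_comp)
qed

lemma set_planted: "G \<in> set_pmf (planted K V) \<Longrightarrow> \<exists>E \<subseteq> pairs V - pairs K. G = clique_graph K V E"
  by (auto simp: planted_def dest: set_random_subset)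

lemma verts_planted: "G \<in> set_pmf (planted K V) \<Longrightarrow> verts G = V"
  by (auto dest!: set_planted)

text \<open>The surviving vertices are determined by the edges that touch \<open>S\<close>, so that the edges between
  them are still fresh: the current graph remains distributed like a planted clique.\<close>
lemma refine_planted:
  assumes V: "finite V" "S \<subseteq> V"
  shows "map_pmf (\<lambda>G. refine \<beta> \<eta> G S) (planted K V) =
    bind_pmf (planted K V) (\<lambda>G. planted K (survivors \<beta> \<eta> G S))"
proof -
  \<comment> \<open>\<open>A\<close> collects the random pairs that meet \<open>S\<close>, which is
    all that \<open>survivors\<close> reads; \<open>B\<close> collects those that avoid
    \<open>S\<close>, out of which the next graph is formed.\<close>
  define A where "A = pairs V - pairs K - pairs (V - S)"
  define B where "B = pairs (V - S) - pairs K"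
  have fin: "finite A" "finite B" "A \<inter> B = {}"
    using V by (auto simp: A_def B_def)
  have AB: "pairs V - pairs K = A \<union> B"
    using pairs_mono[of "V - S" V] by (auto simp: A_def B_def)
  have planted: "planted K V = bind_pmf (random_subset (1/2) A)
      (\<lambda>X. map_pmf (\<lambda>Y. clique_graph K V (X \<union> Y)) (random_subset (1/2) B))"
    unfolding planted_def AB random_subset_Un[OF fin] by (simp add: map_bind_pmf map_pmf_comp)
  have surv: "survivors \<beta> \<eta> (clique_graph K V (X \<union> Y)) S = survivors \<beta> \<eta> (clique_graph K V X) S"
    if "Y \<subseteq> B" for X Y
    using that V by (intro survivors_cong)
      (auto simp: edges_clique_graph B_def pair_mem_pairs subset_iff)
  have refine: "map_pmf (\<lambda>Y. refine \<beta> \<eta> (clique_graph K V (X \<union> Y)) S) (random_subset (1/2) B) =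
      planted K (survivors \<beta> \<eta> (clique_graph K V X) S)" if X: "X \<subseteq> A" for X
  proof -
    define W where "W = survivors \<beta> \<eta> (clique_graph K V X) S"
    have W: "W \<subseteq> V - S"
      unfolding W_def using survivors_subset[of \<beta> \<eta> "clique_graph K V X" S] by simp
    have "refine \<beta> \<eta> (clique_graph K V (X \<union> Y)) S = clique_graph K W (Y \<inter> pairs W)"
      if Y: "Y \<subseteq> B" for Y
    proof -
      have "\<not> e \<subseteq> W" if "e \<in> X" for e
        using that X W by (auto simp: A_def pairs_def)
      moreover have "e \<in> pairs W" if "e \<in> Y" "e \<subseteq> W" for e
        using that Y by (auto simp: B_def pairs_def)
      ultimately have "{e \<in> pairs (K \<inter> V) \<union> (X \<union> Y). e \<subseteq> W} = pairs (K \<inter> W) \<union> (Y \<inter> pairs W)"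
        using W by (auto simp: pairs_def)
      then show ?thesis
        unfolding refine_eq surv[OF Y] W_def[symmetric] using W
        by (auto simp: induced_def clique_graph_def)
    qed
    then have "map_pmf (\<lambda>Y. refine \<beta> \<eta> (clique_graph K V (X \<union> Y)) S) (random_subset (1/2) B) =
        map_pmf (\<lambda>Y. clique_graph K W (Y \<inter> pairs W)) (random_subset (1/2) B)"
      by (intro map_pmf_cong refl) (auto dest: set_random_subset)
    also have "\<dots> = map_pmf (clique_graph K W) (random_subset (1/2) (B \<inter> pairs W))"
      unfolding random_subset_Int[OF fin(2), symmetric] by (simp add: map_pmf_comp)
    also have "B \<inter> pairs W = pairs W - pairs K"
      using pairs_mono[OF W] by (auto simp: B_def)
    finally show ?thesis by (simp add: planted_def W_def)
  qed
  have "map_pmf (\<lambda>G. refine \<beta> \<eta> G S) (planted K V) = bind_pmf (random_subset (1/2) A)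
      (\<lambda>X. map_pmf (\<lambda>Y. refine \<beta> \<eta> (clique_graph K V (X \<union> Y)) S) (random_subset (1/2) B))"
    by (simp add: planted map_bind_pmf map_pmf_comp)
  also have "\<dots> = bind_pmf (random_subset (1/2) A)
      (\<lambda>X. planted K (survivors \<beta> \<eta> (clique_graph K V X) S))"
    by (intro bind_pmf_cong refl refine) (auto dest: set_random_subset)
  \<comment> \<open>A draw of \<open>B\<close> edges, which \<open>survivors\<close> does not look
    at, is inserted so that the mixing law can be read as \<open>planted K V\<close> again; the next
    graph is drawn independently of it.\<close>
  also have "\<dots> = bind_pmf (random_subset (1/2) A) (\<lambda>X. bind_pmf (random_subset (1/2) B)
      (\<lambda>Y. planted K (survivors \<beta> \<eta> (clique_graph K V (X \<union> Y)) S)))"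
  proof (intro bind_pmf_cong refl)
    fix X
    have "bind_pmf (random_subset (1/2) B) (\<lambda>Y. planted K (survivors \<beta> \<eta> (clique_graph K V (X \<union> Y)) S)) =
        bind_pmf (random_subset (1/2) B) (\<lambda>Y. planted K (survivors \<beta> \<eta> (clique_graph K V X) S))"
      by (intro bind_pmf_cong refl) (auto dest!: set_random_subset simp: surv)
    then show "planted K (survivors \<beta> \<eta> (clique_graph K V X) S) =
        bind_pmf (random_subset (1/2) B) (\<lambda>Y. planted K (survivors \<beta> \<eta> (clique_graph K V (X \<union> Y)) S))"
      by simp
  qed
  also have "\<dots> = bind_pmf (planted K V) (\<lambda>G. planted K (survivors \<beta> \<eta> G S))"
    by (simp add: planted bind_assoc_pmf bind_map_pmf)
  finally show ?thesis .
qed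

text \<open>The definition appends iterations at the end, whereas the freshness argument splits off
  the first one.\<close>

lemma phase1_Suc_front:
  "phase1 \<alpha> \<beta> \<eta> (Suc t) G =
    bind_pmf (random_subset \<alpha> (verts G)) (\<lambda>S. phase1 \<alpha> \<beta> \<eta> t (refine \<beta> \<eta> G S))"
proof (induction t)
  case 0
  then show ?case by (simp add: bind_return_pmf map_pmf_def)
next
  case (Suc t)
  have "phase1 \<alpha> \<beta> \<eta> (Suc (Suc t)) G = bind_pmf (phase1 \<alpha> \<beta> \<eta> (Suc t) G)
      (\<lambda>H. map_pmf (refine \<beta> \<eta> H) (random_subset \<alpha> (verts H)))"
    by simp
  also have "\<dots> = bind_pmf (random_subset \<alpha> (verts G)) (\<lambda>S. phase1 \<alpha> \<beta> \<eta> (Suc t) (refine \<beta> \<eta> G S))"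
    unfolding Suc by (simp add: bind_assoc_pmf)
  finally show ?case .
qed

text \<open>The transition kernel of the chain. Its state is a bare vertex set, on which a new graph
  is drawn in every round; in law this agrees with keeping the graph, because the surviving edges
  are fresh.\<close>

definition step :: "real \<Rightarrow> real \<Rightarrow> real \<Rightarrow> 'a set \<Rightarrow> 'a set \<Rightarrow> 'a set pmf" where
  "step \<alpha> \<beta> \<eta> K V = bind_pmf (random_subset \<alpha> V) (\<lambda>S. map_pmf (\<lambda>G. survivors \<beta> \<eta> G S) (planted K V))"

lemma set_step: "W \<in> set_pmf (step \<alpha> \<beta> \<eta> K V) \<Longrightarrow> W \<subseteq> V"
  using survivors_subset by (fastforce simp: step_def dest: verts_planted)

lemma phase1_planted:
  assumes "finite V"
  shows "bind_pmf (planted K V) (phase1 \<alpha> \<beta> \<eta> (Suc t)) =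
    bind_pmf (step \<alpha> \<beta> \<eta> K V) (\<lambda>W. bind_pmf (planted K W) (phase1 \<alpha> \<beta> \<eta> t))"
proof -
  have "bind_pmf (planted K V) (phase1 \<alpha> \<beta> \<eta> (Suc t)) =
      bind_pmf (planted K V) (\<lambda>G. bind_pmf (random_subset \<alpha> V) (\<lambda>S. phase1 \<alpha> \<beta> \<eta> t (refine \<beta> \<eta> G S)))"
    unfolding phase1_Suc_front by (intro bind_pmf_cong refl) (simp add: verts_planted)
  also have "\<dots> = bind_pmf (random_subset \<alpha> V) (\<lambda>S. bind_pmf (planted K V) (\<lambda>G. phase1 \<alpha> \<beta> \<eta> t (refine \<beta> \<eta> G S)))"
    by (rule bind_commute_pmf)
  also have "\<dots> = bind_pmf (random_subset \<alpha> V) (\<lambda>S. bind_pmf (bind_pmf (planted K V)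
      (\<lambda>G. planted K (survivors \<beta> \<eta> G S))) (phase1 \<alpha> \<beta> \<eta> t))"
  proof (rule bind_pmf_cong[OF refl])
    fix S assume "S \<in> set_pmf (random_subset \<alpha> V)"
    then have S: "S \<subseteq> V" by (rule set_random_subset)
    show "bind_pmf (planted K V) (\<lambda>G. phase1 \<alpha> \<beta> \<eta> t (refine \<beta> \<eta> G S)) =
        bind_pmf (bind_pmf (planted K V) (\<lambda>G. planted K (survivors \<beta> \<eta> G S))) (phase1 \<alpha> \<beta> \<eta> t)"
      unfolding refine_planted[OF assms S, symmetric] by (simp add: bind_map_pmf)
  qed
  finally show ?thesis
    by (simp add: step_def bind_assoc_pmf bind_map_pmf)
qed

text \<open>A union bound along the chain for an invariant \<open>J i\<close> that depends on time.
  The induction removes the first iteration and shifts the invariant, hence the generalisation over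
  \<open>J\<close>.\<close>

lemma phase1_chain:
  assumes "finite V" "J 0 V" "e \<ge> 0" "e' \<ge> 0"
    and "\<And>i V. i < t \<Longrightarrow> finite V \<Longrightarrow> J i V \<Longrightarrow> prb (step \<alpha> \<beta> \<eta> K V) {W. \<not> J (Suc i) W} \<le> e"
    and "\<And>V. finite V \<Longrightarrow> J t V \<Longrightarrow> prb (planted K V) Bad \<le> e'"
  shows "prb (bind_pmf (planted K V) (phase1 \<alpha> \<beta> \<eta> t)) Bad \<le> real t * e + e'"
  using assms
proof (induction t arbitrary: J V)
  case 0
  then show ?case by (simp add: bind_return_pmf')
next
  case (Suc t)
  have "prb (bind_pmf (step \<alpha> \<beta> \<eta> K V) (\<lambda>W. bind_pmf (planted K W) (phase1 \<alpha> \<beta> \<eta> t))) Bad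
      \<le> prb (step \<alpha> \<beta> \<eta> K V) {W. \<not> J 1 W} + (real t * e + e')"
  proof (rule prb_bind_le)
    fix W assume W: "W \<in> set_pmf (step \<alpha> \<beta> \<eta> K V)" "W \<notin> {W. \<not> J 1 W}"
    show "prb (bind_pmf (planted K W) (phase1 \<alpha> \<beta> \<eta> t)) Bad \<le> real t * e + e'"
    proof (rule Suc.IH[where J = "\<lambda>i. J (Suc i)"])
      show "finite W" using W(1) Suc.prems(1) by (auto dest: set_step intro: finite_subset)
    qed (use W Suc.prems in auto)
  qed (use Suc.prems in auto)
  also have "prb (step \<alpha> \<beta> \<eta> K V) {W. \<not> J 1 W} \<le> e"
    using Suc.prems(5)[of 0 V] Suc.prems(1,2) by simp
  finally show ?case
    unfolding phase1_planted[OF Suc.prems(1)] by (simp add: algebra_simps)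
qed

section \<open>Edges exposed in one iteration\<close>

text \<open>Applied with \<open>W\<close> the clique and with \<open>W\<close> the rest of the
  graph. Vertices are sampled independently, so the block probabilities demanded by the counting
  bounds hold with equality.\<close>

lemma sample_step:
  fixes \<alpha> \<zeta> :: real
  assumes V: "finite V" and \<alpha>: "0 < \<alpha>" "\<alpha> < 1" and \<zeta>: "0 < \<zeta>"
    and b: "b \<le> \<zeta> / 2 * card W" and W: "W \<subseteq> V"
  shows "prb (random_subset \<alpha> V) {S. \<not> \<bar>card (S \<inter> W) - \<alpha> * card W\<bar> \<le> \<zeta> * card W} \<le> 2 * (4 / (4 + \<zeta>)) ^ b"
proof -
  have finW: "finite W" using V W finite_subset by blast
  have "prb (random_subset \<alpha> V) {S. (\<alpha> + \<zeta>) * card W \<le> card (S \<inter> W)} \<le> (4 / (4 + \<zeta>)) ^ b"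
  proof (rule prb_card_ge_fraction[where X = "\<lambda>S. S", OF finW])
    show "prb (random_subset \<alpha> V) {S. B \<subseteq> S} \<le> \<alpha> ^ b" if "B \<subseteq> W" "card B = b" for B
      using prb_random_subset_superset[of V B \<alpha>] assms that by auto
  qed (use assms in auto)
  moreover have "prb (random_subset \<alpha> V) {S. card (S \<inter> W) \<le> (\<alpha> - \<zeta>) * card W} \<le> (4 / (4 + \<zeta>)) ^ b"
  proof (rule prb_card_le_fraction[where X = "\<lambda>S. S", OF finW])
    show "prb (random_subset \<alpha> V) {S. B \<inter> S = {}} \<le> (1 - \<alpha>) ^ b" if "B \<subseteq> W" "card B = b" for B
      using prb_random_subset_disjoint[of V B \<alpha>] assms that by auto
  qed (use assms in auto)
  moreover have "prb (random_subset \<alpha> V) {S. \<not> \<bar>card (S \<inter> W) - \<alpha> * card W\<bar> \<le> \<zeta> * card W} \<le>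
      prb (random_subset \<alpha> V) ({S. (\<alpha> + \<zeta>) * card W \<le> card (S \<inter> W)} \<union> {S. card (S \<inter> W) \<le> (\<alpha> - \<zeta>) * card W})"
    by (intro prb_mono) (auto simp: algebra_simps abs_if split: if_splits)
  ultimately show ?thesis
    using prb_union_le[of "random_subset \<alpha> V" "{S. (\<alpha> + \<zeta>) * card W \<le> card (S \<inter> W)}"
        "{S. card (S \<inter> W) \<le> (\<alpha> - \<zeta>) * card W}"] by linarith
qed

lemma prb_Collect_not: "prb M {j. \<not> P j} = 1 - prb M {j. P j}"
proof -
  have "prb M (UNIV - {j. P j}) = 1 - prb M {j. P j}"
    by (subst measure_pmf.prob_compl[simplified]) auto
  moreover have "{j. \<not> P j} = UNIV - {j. P j}" by auto
  ultimately show ?thesis by simp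
qed

section \<open>Core and survivors for a fixed sample\<close>

context
  fixes V S K :: "'a set" and \<beta> \<eta> :: real
  assumes V: "finite V" and S: "S \<subseteq> V"
begin

abbreviation "inner_edges \<equiv> random_subset (1/2) (pairs S - pairs K)"
abbreviation "outer_edges \<equiv> random_subset (1/2) (pairs V - pairs K - pairs S)"
abbreviation "thr \<equiv> 1/2 * card S + \<eta> * (sqrt (card S) / 2)"

lemma finS: "finite S"
  using V S finite_subset by blast

lemma inner_edges_subset: "X \<in> set_pmf inner_edges \<Longrightarrow> X \<subseteq> pairs V - pairs K"
  using pairs_mono[OF S] by (auto dest: set_random_subset)

text \<open>Two vertices of \<open>S\<close> share the pair between them. Counting only edges from
  \<open>B\<close> to \<open>S - B\<close> removes all shared pairs, so the stars become
  independent; the price is an error of at most \<open>card B\<close> in each degree.\<close>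

lemma prb_block_outside:
  assumes "B \<subseteq> S - K"
  shows "prb inner_edges {X. \<forall>v\<in>B. Q (card (X \<inter> star v (S - B)))} =
    prb (binomial_pmf (card S - card B) (1/2)) {j. Q j} ^ card B"
proof -
  have B: "finite B" "B \<subseteq> S" using assms finS finite_subset by auto
  have "prb inner_edges {X. \<forall>v\<in>B. Q (card (X \<inter> star v (S - B)))} =
      prb (binomial_pmf (card (S - B)) (1/2)) {j. Q j} ^ card B"
    using assms finS B by (intro prb_stars star_subset) auto
  then show ?thesis using B by (simp add: card_Diff_subset)
qed

lemma deg_block:
  assumes "X \<subseteq> pairs V" "B \<subseteq> S" "v \<in> S - K"
  shows "card (X \<inter> star v (S - B)) \<le> deg_into (clique_graph K V X) S v"
    "deg_into (clique_graph K V X) S v \<le> card (X \<inter> star v (S - B)) + card B"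
proof -
  have eq: "deg_into (clique_graph K V X) S v = card {u \<in> S. {u, v} \<in> X}"
    using assms by (simp add: deg_into_outside card_star_Int)
  have star: "card (X \<inter> star v (S - B)) = card {u \<in> S - B. {u, v} \<in> X}"
    using assms by (simp add: card_star_Int)
  show "card (X \<inter> star v (S - B)) \<le> deg_into (clique_graph K V X) S v"
    unfolding eq star using finS by (intro card_mono) auto
  have "card {u \<in> S. {u, v} \<in> X} \<le> card ({u \<in> S - B. {u, v} \<in> X} \<union> B)"
    using finS assms finite_subset by (intro card_mono) auto
  also have "\<dots> \<le> card {u \<in> S - B. {u, v} \<in> X} + card B"
    by (rule card_Un_le)
  finally show "deg_into (clique_graph K V X) S v \<le> card (X \<inter> star v (S - B)) + card B"
    unfolding eq star .
qed

text \<open>That a whole block lies in the core is relaxed to independent conditions, with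
  \<open>b\<close> added to each degree into \<open>S - B\<close>. Their joint probability is the
  \<open>b\<close>-th power that the counting bound asks for.\<close>

lemma core_outside_ge:
  fixes \<zeta> :: real
  assumes p: "prb (binomial_pmf (card S - b) (1/2)) {j. real j + b \<ge> thr} \<le> p" "p \<le> 2" and \<zeta>: "0 < \<zeta>"
    and b: "b \<le> \<zeta> / 2 * card (S - K)"
  shows "prb inner_edges {X. (p + \<zeta>) * card (S - K) \<le> card (core \<eta> (clique_graph K V X) S - K)}
    \<le> (4 / (4 + \<zeta>)) ^ b"
proof -
  have p0: "0 \<le> p" using p(1) measure_nonneg order_trans by blast
  have "prb inner_edges {X. (p + \<zeta>) * card (S - K) \<le> card (core \<eta> (clique_graph K V X) S \<inter> (S - K))}
    \<le> (4 / (4 + \<zeta>)) ^ b"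
  proof (rule prb_card_ge_fraction[OF _ _ p0 p(2) \<zeta> b])
    fix B assume B: "B \<subseteq> S - K" "card B = b"
    have "prb inner_edges {X. B \<subseteq> core \<eta> (clique_graph K V X) S} \<le>
        prb inner_edges {X. \<forall>v\<in>B. real (card (X \<inter> star v (S - B))) + b \<ge> thr}"
    proof (rule prb_mono)
      fix X assume X: "X \<in> set_pmf inner_edges" "X \<in> {X. B \<subseteq> core \<eta> (clique_graph K V X) S}"
      have X': "X \<subseteq> pairs V" using inner_edges_subset[OF X(1)] by auto
      have "thr \<le> real (card (X \<inter> star v (S - B))) + b" if "v \<in> B" for v
      proof -
        have "thr \<le> deg_into (clique_graph K V X) S v"
          using X(2) that by (auto simp: core_def)
        then show ?thesis
          using deg_block(2)[OF X', of B v] B that by force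
      qed
      then show "X \<in> {X. \<forall>v\<in>B. real (card (X \<inter> star v (S - B))) + b \<ge> thr}" by auto
    qed
    also have "\<dots> = prb (binomial_pmf (card S - b) (1/2)) {j. real j + b \<ge> thr} ^ b"
      using prb_block_outside[OF B(1), of "\<lambda>j. real j + b \<ge> thr"] B(2) by simp
    also have "\<dots> \<le> p ^ b"
      by (intro power_mono p) auto
    finally show "prb inner_edges {X. B \<subseteq> core \<eta> (clique_graph K V X) S} \<le> p ^ b" .
  qed (use finS in auto)
  moreover have "core \<eta> G S \<inter> (S - K) = core \<eta> G S - K" for G :: "'a ugraph"
    by (auto simp: core_def)
  ultimately show ?thesis by simp
qed

text \<open>A vertex that misses the core has a degree into \<open>S - B\<close> that is smaller
  still, so no correction enters the event; the block only shortens the binomial to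
  \<open>card S - b\<close> trials.\<close>

lemma core_outside_le:
  fixes \<zeta> :: real
  assumes p: "p \<le> prb (binomial_pmf (card S - b) (1/2)) {j. real j \<ge> thr}" "- 1 \<le> p" and \<zeta>: "0 < \<zeta>"
    and b: "b \<le> \<zeta> / 2 * card (S - K)"
  shows "prb inner_edges {X. card (core \<eta> (clique_graph K V X) S - K) \<le> (p - \<zeta>) * card (S - K)}
    \<le> (4 / (4 + \<zeta>)) ^ b"
proof -
  have p1: "p \<le> 1" using p(1) measure_pmf.prob_le_1 order_trans by blast
  have "prb inner_edges {X. card (core \<eta> (clique_graph K V X) S \<inter> (S - K)) \<le> (p - \<zeta>) * card (S - K)}
    \<le> (4 / (4 + \<zeta>)) ^ b"
  proof (rule prb_card_le_fraction[OF _ _ p(2) p1 \<zeta> b])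
    fix B assume B: "B \<subseteq> S - K" "card B = b"
    have "prb inner_edges {X. B \<inter> core \<eta> (clique_graph K V X) S = {}} \<le>
        prb inner_edges {X. \<forall>v\<in>B. \<not> real (card (X \<inter> star v (S - B))) \<ge> thr}"
    proof (rule prb_mono)
      fix X assume X: "X \<in> set_pmf inner_edges" "X \<in> {X. B \<inter> core \<eta> (clique_graph K V X) S = {}}"
      have X': "X \<subseteq> pairs V" using inner_edges_subset[OF X(1)] by auto
      have "\<not> thr \<le> real (card (X \<inter> star v (S - B)))" if "v \<in> B" for v
      proof -
        have "\<not> thr \<le> deg_into (clique_graph K V X) S v"
          using X(2) that B by (auto simp: core_def)
        then show ?thesis
          using deg_block(1)[OF X', of B v] B that by force
      qed
      then show "X \<in> {X. \<forall>v\<in>B. \<not> real (card (X \<inter> star v (S - B))) \<ge> thr}" by auto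
    qed
    also have "\<dots> = prb (binomial_pmf (card S - b) (1/2)) {j. \<not> real j \<ge> thr} ^ b"
      using prb_block_outside[OF B(1), of "\<lambda>j. \<not> real j \<ge> thr"] B(2) by simp
    also have "\<dots> \<le> (1 - p) ^ b"
      using p(1) unfolding prb_Collect_not by (intro power_mono) auto
    finally show "prb inner_edges {X. B \<inter> core \<eta> (clique_graph K V X) S = {}} \<le> (1 - p) ^ b" .
  qed (use finS in auto)
  moreover have "core \<eta> G S \<inter> (S - K) = core \<eta> G S - K" for G :: "'a ugraph"
    by (auto simp: core_def)
  ultimately show ?thesis by simp
qed

text \<open>Pairs shared by clique vertices are clique edges and hence not random, so the stars into
  \<open>S - K\<close> are disjoint as they stand. The \<open>- 1\<close> is there because
  \<open>v\<close> is not its own neighbour.\<close>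

lemma core_inside_le:
  fixes \<zeta> :: real
  assumes p: "p \<le> prb (binomial_pmf (card (S - K)) (1/2)) {j. real j + real (card (S \<inter> K)) - 1 \<ge> thr}" "- 1 \<le> p" and \<zeta>: "0 < \<zeta>"
    and b: "b \<le> \<zeta> / 2 * card (S \<inter> K)"
  shows "prb inner_edges {X. card (core \<eta> (clique_graph K V X) S \<inter> K) \<le> (p - \<zeta>) * card (S \<inter> K)}
    \<le> (4 / (4 + \<zeta>)) ^ b"
proof -
  have p1: "p \<le> 1" using p(1) measure_pmf.prob_le_1 order_trans by blast
  define Q where "Q j \<longleftrightarrow> real j + real (card (S \<inter> K)) - 1 \<ge> thr" for j
  have "prb inner_edges {X. card (core \<eta> (clique_graph K V X) S \<inter> (S \<inter> K)) \<le> (p - \<zeta>) * card (S \<inter> K)}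
    \<le> (4 / (4 + \<zeta>)) ^ b"
  proof (rule prb_card_le_fraction[OF _ _ p(2) p1 \<zeta> b])
    fix B assume B: "B \<subseteq> S \<inter> K" "card B = b"
    have "prb inner_edges {X. B \<inter> core \<eta> (clique_graph K V X) S = {}} \<le>
        prb inner_edges {X. \<forall>v\<in>B. \<not> Q (card (X \<inter> star v (S - K)))}"
    proof (rule prb_mono)
      fix X assume X: "X \<in> set_pmf inner_edges" "X \<in> {X. B \<inter> core \<eta> (clique_graph K V X) S = {}}"
      have "\<not> Q (card (X \<inter> star v (S - K)))" if "v \<in> B" for v
      proof -
        have v: "v \<in> S" "v \<in> K" "v \<in> V" using that B S by auto
        have "\<not> thr \<le> deg_into (clique_graph K V X) S v"
          using X(2) that B by (auto simp: core_def)
        moreover have "deg_into (clique_graph K V X) S v = card (S \<inter> K - {v}) + card (X \<inter> star v (S - K))"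
          using inner_edges_subset[OF X(1)] v finS S by (intro deg_into_inside) auto
        moreover have "real (card (S \<inter> K - {v})) = real (card (S \<inter> K)) - 1"
          using v finS card_Suc_Diff1[of "S \<inter> K" v] by simp
        ultimately show ?thesis by (simp add: Q_def)
      qed
      then show "X \<in> {X. \<forall>v\<in>B. \<not> Q (card (X \<inter> star v (S - K)))}" by auto
    qed
    also have "\<dots> = prb (binomial_pmf (card (S - K)) (1/2)) {j. \<not> Q j} ^ card B"
      using B finS by (intro prb_stars star_subset) (auto intro: finite_subset)
    also have "\<dots> \<le> (1 - p) ^ b"
      using p(1) unfolding prb_Collect_not B(2) by (intro power_mono) (auto simp: Q_def)
    finally show "prb inner_edges {X. B \<inter> core \<eta> (clique_graph K V X) S = {}} \<le> (1 - p) ^ b" .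
  qed (use finS in auto)
  moreover have "core \<eta> G S \<inter> (S \<inter> K) = core \<eta> G S \<inter> K" for G :: "'a ugraph"
    by (auto simp: core_def)
  ultimately show ?thesis by simp
qed

section \<open>Survivors, once the edges inside the sample and with them the core are known\<close>

context
  fixes X T
  assumes X: "X \<subseteq> pairs S - pairs K" and T: "T = core \<eta> (clique_graph K V X) S"
begin

abbreviation "thr' \<equiv> 1/2 * card T + \<beta> * (sqrt (card T) / 2)"

lemma T_subset: "T \<subseteq> S"
  unfolding T by (rule core_subset)

lemma finT: "finite T"
  using T_subset finS finite_subset by blast

lemma survivors_iff:
  assumes "Y \<subseteq> pairs V - pairs K - pairs S"
  shows "v \<in> survivors \<beta> \<eta> (clique_graph K V (X \<union> Y)) S \<longleftrightarrow>
    v \<in> V - S \<and> deg_into (clique_graph K V (X \<union> Y)) T v \<ge> thr'"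
proof -
  have "core \<eta> (clique_graph K V (X \<union> Y)) S = T"
    unfolding T using assms by (intro core_cong) (auto simp: edges_clique_graph pair_mem_pairs)
  then show ?thesis by (simp add: survivors_def)
qed

lemma star_Un:
  assumes "v \<notin> S"
  shows "(X \<union> Y) \<inter> star v T' = Y \<inter> star v T'"
  using star_disjoint_pairs[OF assms, of T'] X by auto

lemma deg_survivor_outside:
  assumes "Y \<subseteq> pairs V - pairs K - pairs S" "v \<in> V - S - K"
  shows "deg_into (clique_graph K V (X \<union> Y)) T v = card (Y \<inter> star v T)"
  using assms X pairs_mono[OF S] by (subst deg_into_outside) (auto simp: star_Un)

lemma deg_survivor_inside:
  assumes "Y \<subseteq> pairs V - pairs K - pairs S" "v \<in> (V - S) \<inter> K"
  shows "deg_into (clique_graph K V (X \<union> Y)) T v = card (T \<inter> K) + card (Y \<inter> star v (T - K))"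
proof -
  have "v \<notin> T" using assms T_subset by auto
  then have "T \<inter> K - {v} = T \<inter> K" by auto
  moreover have "X \<union> Y \<subseteq> pairs V - pairs K"
    using assms X pairs_mono[OF S] by auto
  ultimately show ?thesis
    using assms T_subset S finT by (subst deg_into_inside) (auto simp: star_Un)
qed

text \<open>Centres lie outside \<open>S\<close> and the target inside, so the stars are disjoint
  and the degrees exactly independent, without loss for blocks. The disjunction keeps clique pairs,
  which are not random, out of the stars.\<close>

lemma prb_outer_stars:
  assumes "B \<subseteq> V - S" "T' \<subseteq> S" "B \<inter> K = {} \<or> T' \<inter> K = {}"
  shows "prb outer_edges {Y. \<forall>v\<in>B. Q (card (Y \<inter> star v T'))} =
    prb (binomial_pmf (card T') (1/2)) {j. Q j} ^ card B"
proof (rule prb_stars)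
  fix v assume v: "v \<in> B"
  have "star v T' \<subseteq> pairs V - pairs K"
    using v assms S by (intro star_subset) auto
  moreover have "star v T' \<inter> pairs S = {}"
    using v assms by (intro star_disjoint_pairs) auto
  ultimately show "star v T' \<subseteq> pairs V - pairs K - pairs S" by auto
qed (use assms V finS in \<open>auto intro: finite_subset\<close>)

lemma survivors_outside_ge:
  fixes \<zeta> :: real
  assumes p: "prb (binomial_pmf (card T) (1/2)) {j. real j \<ge> thr'} \<le> p" "p \<le> 2" and \<zeta>: "0 < \<zeta>"
    and b: "b \<le> \<zeta> / 2 * card (V - S - K)"
  shows "prb outer_edges {Y. (p + \<zeta>) * card (V - S - K) \<le> card (survivors \<beta> \<eta> (clique_graph K V (X \<union> Y)) S - K)}
    \<le> (4 / (4 + \<zeta>)) ^ b"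
proof -
  have p0: "0 \<le> p" using p(1) measure_nonneg order_trans by blast
  have "prb outer_edges {Y. (p + \<zeta>) * card (V - S - K) \<le> card (survivors \<beta> \<eta> (clique_graph K V (X \<union> Y)) S \<inter> (V - S - K))}
    \<le> (4 / (4 + \<zeta>)) ^ b"
  proof (rule prb_card_ge_fraction[OF _ _ p0 p(2) \<zeta> b])
    fix B assume B: "B \<subseteq> V - S - K" "card B = b"
    have "prb outer_edges {Y. B \<subseteq> survivors \<beta> \<eta> (clique_graph K V (X \<union> Y)) S} \<le>
        prb outer_edges {Y. \<forall>v\<in>B. real (card (Y \<inter> star v T)) \<ge> thr'}"
    proof (rule prb_mono)
      fix Y assume Y: "Y \<in> set_pmf outer_edges" "Y \<in> {Y. B \<subseteq> survivors \<beta> \<eta> (clique_graph K V (X \<union> Y)) S}"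
      note Y' = set_random_subset[OF Y(1)]
      show "Y \<in> {Y. \<forall>v\<in>B. real (card (Y \<inter> star v T)) \<ge> thr'}"
        using Y(2) B(1) by (auto simp: survivors_iff[OF Y'] deg_survivor_outside[OF Y', symmetric] subset_iff)
    qed
    also have "\<dots> = prb (binomial_pmf (card T) (1/2)) {j. real j \<ge> thr'} ^ b"
      using B T_subset by (subst prb_outer_stars[where Q = "\<lambda>j. real j \<ge> thr'"]) auto
    also have "\<dots> \<le> p ^ b"
      by (intro power_mono p) auto
    finally show "prb outer_edges {Y. B \<subseteq> survivors \<beta> \<eta> (clique_graph K V (X \<union> Y)) S} \<le> p ^ b" .
  qed (use V in auto)
  moreover have "survivors \<beta> \<eta> (clique_graph K V E) S \<inter> (V - S - K) = survivors \<beta> \<eta> (clique_graph K V E) S - K" for E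
    using survivors_subset[of \<beta> \<eta> "clique_graph K V E" S] by auto
  ultimately show ?thesis by simp
qed

lemma survivors_outside_le:
  fixes \<zeta> :: real
  assumes p: "p \<le> prb (binomial_pmf (card T) (1/2)) {j. real j \<ge> thr'}" "- 1 \<le> p" and \<zeta>: "0 < \<zeta>"
    and b: "b \<le> \<zeta> / 2 * card (V - S - K)"
  shows "prb outer_edges {Y. card (survivors \<beta> \<eta> (clique_graph K V (X \<union> Y)) S - K) \<le> (p - \<zeta>) * card (V - S - K)}
    \<le> (4 / (4 + \<zeta>)) ^ b"
proof -
  have p1: "p \<le> 1" using p(1) measure_pmf.prob_le_1 order_trans by blast
  have "prb outer_edges {Y. card (survivors \<beta> \<eta> (clique_graph K V (X \<union> Y)) S \<inter> (V - S - K)) \<le> (p - \<zeta>) * card (V - S - K)}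
    \<le> (4 / (4 + \<zeta>)) ^ b"
  proof (rule prb_card_le_fraction[OF _ _ p(2) p1 \<zeta> b])
    fix B assume B: "B \<subseteq> V - S - K" "card B = b"
    have "prb outer_edges {Y. B \<inter> survivors \<beta> \<eta> (clique_graph K V (X \<union> Y)) S = {}} \<le>
        prb outer_edges {Y. \<forall>v\<in>B. \<not> real (card (Y \<inter> star v T)) \<ge> thr'}"
    proof (rule prb_mono)
      fix Y assume Y: "Y \<in> set_pmf outer_edges" "Y \<in> {Y. B \<inter> survivors \<beta> \<eta> (clique_graph K V (X \<union> Y)) S = {}}"
      note Y' = set_random_subset[OF Y(1)]
      have "\<not> real (card (Y \<inter> star v T)) \<ge> thr'" if "v \<in> B" for v
      proof -
        have "v \<notin> survivors \<beta> \<eta> (clique_graph K V (X \<union> Y)) S"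
          using Y(2) that by auto
        then show ?thesis
          using B(1) that deg_survivor_outside[OF Y', of v] by (auto simp: survivors_iff[OF Y'])
      qed
      then show "Y \<in> {Y. \<forall>v\<in>B. \<not> real (card (Y \<inter> star v T)) \<ge> thr'}" by auto
    qed
    also have "\<dots> = prb (binomial_pmf (card T) (1/2)) {j. \<not> real j \<ge> thr'} ^ b"
      using B T_subset by (subst prb_outer_stars[where Q = "\<lambda>j. \<not> real j \<ge> thr'"]) auto
    also have "\<dots> \<le> (1 - p) ^ b"
      using p(1) unfolding prb_Collect_not by (intro power_mono) auto
    finally show "prb outer_edges {Y. B \<inter> survivors \<beta> \<eta> (clique_graph K V (X \<union> Y)) S = {}} \<le> (1 - p) ^ b" .
  qed (use V in auto)
  moreover have "survivors \<beta> \<eta> (clique_graph K V E) S \<inter> (V - S - K) = survivors \<beta> \<eta> (clique_graph K V E) S - K" for E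
    using survivors_subset[of \<beta> \<eta> "clique_graph K V E" S] by auto
  ultimately show ?thesis by simp
qed

text \<open>All of \<open>T \<inter> K\<close> counts as neighbours here, without a
  \<open>- 1\<close>, since the candidate lies outside the core.\<close>

lemma survivors_inside_le:
  fixes \<zeta> :: real
  assumes p: "p \<le> prb (binomial_pmf (card (T - K)) (1/2)) {j. real j + real (card (T \<inter> K)) \<ge> thr'}" "- 1 \<le> p" and \<zeta>: "0 < \<zeta>"
    and b: "b \<le> \<zeta> / 2 * card ((V - S) \<inter> K)"
  shows "prb outer_edges {Y. card (survivors \<beta> \<eta> (clique_graph K V (X \<union> Y)) S \<inter> K) \<le> (p - \<zeta>) * card ((V - S) \<inter> K)}
    \<le> (4 / (4 + \<zeta>)) ^ b"
proof -
  have p1: "p \<le> 1" using p(1) measure_pmf.prob_le_1 order_trans by blast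
  define Q where "Q j \<longleftrightarrow> real j + real (card (T \<inter> K)) \<ge> thr'" for j
  have "prb outer_edges {Y. card (survivors \<beta> \<eta> (clique_graph K V (X \<union> Y)) S \<inter> ((V - S) \<inter> K)) \<le> (p - \<zeta>) * card ((V - S) \<inter> K)}
    \<le> (4 / (4 + \<zeta>)) ^ b"
  proof (rule prb_card_le_fraction[OF _ _ p(2) p1 \<zeta> b])
    fix B assume B: "B \<subseteq> (V - S) \<inter> K" "card B = b"
    have "prb outer_edges {Y. B \<inter> survivors \<beta> \<eta> (clique_graph K V (X \<union> Y)) S = {}} \<le>
        prb outer_edges {Y. \<forall>v\<in>B. \<not> Q (card (Y \<inter> star v (T - K)))}"
    proof (rule prb_mono)
      fix Y assume Y: "Y \<in> set_pmf outer_edges" "Y \<in> {Y. B \<inter> survivors \<beta> \<eta> (clique_graph K V (X \<union> Y)) S = {}}"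
      note Y' = set_random_subset[OF Y(1)]
      have "\<not> Q (card (Y \<inter> star v (T - K)))" if "v \<in> B" for v
      proof -
        have "v \<notin> survivors \<beta> \<eta> (clique_graph K V (X \<union> Y)) S"
          using Y(2) that by auto
        moreover have v: "v \<in> (V - S) \<inter> K" using B that by auto
        ultimately show ?thesis
          using deg_survivor_inside[OF Y' v]
          by (auto simp: survivors_iff[OF Y'] Q_def)
      qed
      then show "Y \<in> {Y. \<forall>v\<in>B. \<not> Q (card (Y \<inter> star v (T - K)))}" by auto
    qed
    also have "\<dots> = prb (binomial_pmf (card (T - K)) (1/2)) {j. \<not> Q j} ^ b"
      using B T_subset by (subst prb_outer_stars[where Q = "\<lambda>j. \<not> Q j"]) auto
    also have "\<dots> \<le> (1 - p) ^ b"
      using p(1) unfolding prb_Collect_not by (intro power_mono) (auto simp: Q_def)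
    finally show "prb outer_edges {Y. B \<inter> survivors \<beta> \<eta> (clique_graph K V (X \<union> Y)) S = {}} \<le> (1 - p) ^ b" .
  qed (use V in auto)
  moreover have "survivors \<beta> \<eta> (clique_graph K V E) S \<inter> ((V - S) \<inter> K) = survivors \<beta> \<eta> (clique_graph K V E) S \<inter> K" for E
    using survivors_subset[of \<beta> \<eta> "clique_graph K V E" S] by auto
  ultimately show ?thesis by simp
qed

end

end

section \<open>One iteration of phase 1\<close>

lemma upper_tail_le_prb:
  assumes "\<And>j. z * sqrt m \<le> 2 * real j - real m \<Longrightarrow> P j"
  shows "upper_tail m z \<le> prb (binomial_pmf m (1/2)) {j. P j}"
proof -
  have "P j" if "m / 2 + z * sqrt m / 2 \<le> real j" for j
    using that by (intro assms) (simp add: field_simps)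
  then show ?thesis unfolding upper_tail_def by (intro prb_mono) auto
qed

lemma prb_le_upper_tail:
  assumes "\<And>j. P j \<Longrightarrow> z * sqrt m \<le> 2 * real j - real m"
  shows "prb (binomial_pmf m (1/2)) {j. P j} \<le> upper_tail m z"
proof -
  have "m / 2 + z * sqrt m / 2 \<le> real j" if "P j" for j
    using assms[OF that] by (simp add: field_simps)
  then show ?thesis unfolding upper_tail_def by (intro prb_mono) auto
qed

text \<open>A clique vertex has \<open>x\<close> certain neighbours where half of them would be
  expected. The surplus \<open>x / 2\<close> is at least about \<open>w\<close> standard deviations,
  each \<open>sqrt m / 2\<close>, which lowers the standardised threshold from \<open>h\<close> to
  \<open>h - w\<close>. The bound \<open>x \<le> \<epsilon> * m\<close> keeps
  \<open>sqrt (m + x)\<close> close to \<open>sqrt m\<close>.\<close>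

lemma binomial_clique_shift_ge:
  assumes "p < Phi_bar (h - w)" "h > 0"
  shows "\<exists>\<epsilon>>0. \<exists>M. \<forall>m\<ge>M. \<forall>x::nat. real x \<le> \<epsilon> * m \<longrightarrow> (w - \<epsilon>) * sqrt m \<le> x \<longrightarrow>
    p \<le> prb (binomial_pmf m (1/2))
      {j. real j + real x - 1 \<ge> 1/2 * real (m + x) + h * (sqrt (real (m + x)) / 2)}"
proof -
  obtain \<zeta> M0 where \<zeta>: "\<zeta> > 0" and M0: "\<And>m z. m \<ge> M0 \<Longrightarrow> z \<le> h - w + \<zeta> \<Longrightarrow> p \<le> upper_tail m z"
    using upper_tail_ge[OF assms(1)] by blast
  \<comment> \<open>The total error is \<open>(h + 3) * \<epsilon>\<close>:
    \<open>h * \<epsilon>\<close> from the square root, \<epsilon> from the lower bound on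
    \<open>x\<close>, and \<open>2 * \<epsilon>\<close> from the constant 2, which is at most
    \<open>2 * \<epsilon> * sqrt m\<close>.\<close>
  define \<epsilon> where "\<epsilon> = \<zeta> / (h + 4)"
  have \<epsilon>: "\<epsilon> > 0" "(h + 3) * \<epsilon> \<le> \<zeta>"
    using \<zeta> assms(2) by (auto simp: \<epsilon>_def field_simps)
  define M where "M = max M0 (nat \<lceil>1 / \<epsilon>\<^sup>2\<rceil> + 1)"
  have "p \<le> prb (binomial_pmf m (1/2)) {j. real j + real x - 1 \<ge> 1/2 * real (m + x) + h * (sqrt (real (m + x)) / 2)}"
    if m: "m \<ge> M" and x: "real x \<le> \<epsilon> * m" "(w - \<epsilon>) * sqrt m \<le> x" for m x
  proof -
    have "1 / \<epsilon>\<^sup>2 \<le> real m" "m > 0"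
      using m unfolding M_def by linarith+
    then have "1 \<le> \<epsilon>\<^sup>2 * real m"
      using \<epsilon> by (simp add: field_simps)
    then have one: "1 \<le> \<epsilon> * sqrt m"
      using \<epsilon> real_sqrt_le_mono[of 1 "\<epsilon>\<^sup>2 * m"] by (simp add: real_sqrt_mult)
    have sq: "sqrt (m + x) \<le> (1 + \<epsilon>) * sqrt m"
    proof (rule real_le_lsqrt)
      have "real (m + x) \<le> (1 + \<epsilon>) * m"
        using x by (simp add: algebra_simps)
      also have "\<dots> \<le> (1 + \<epsilon>)\<^sup>2 * m"
        using \<epsilon> by (intro mult_right_mono) (auto simp: power2_eq_square algebra_simps)
      finally show "real (m + x) \<le> ((1 + \<epsilon>) * sqrt m)\<^sup>2"
        by (simp add: power_mult_distrib)
    qed (use \<epsilon> in auto)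
    have "h * sqrt (m + x) \<le> h * ((1 + \<epsilon>) * sqrt m)"
      using sq assms(2) by (intro mult_left_mono) auto
    then have "h * sqrt (m + x) - x + 2 \<le> (h - w + (h + 3) * \<epsilon>) * sqrt m"
      using x one by (simp add: algebra_simps)
    also have "\<dots> \<le> (h - w + \<zeta>) * sqrt m"
      using \<epsilon> by (intro mult_right_mono) auto
    finally have z: "h * sqrt (m + x) - x + 2 \<le> (h - w + \<zeta>) * sqrt m" .
    have "p \<le> upper_tail m (h - w + \<zeta>)"
      using m by (intro M0) (auto simp: M_def)
    also have "\<dots> \<le> prb (binomial_pmf m (1/2)) {j. real j + real x - 1 \<ge> 1/2 * real (m + x) + h * (sqrt (real (m + x)) / 2)}"
      by (intro upper_tail_le_prb) (drule order_trans[OF z], simp add: field_simps)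
    finally show ?thesis .
  qed
  then show ?thesis using \<epsilon> by blast
qed

text \<open>After doubling and centring at \<open>s - b\<close> trials, the block lowers the
  threshold by \<open>b\<close>, a small fraction of the square root of the number of
  trials.\<close>

lemma binomial_block_le:
  assumes "Phi_bar h < p" "h > 0"
  shows "\<exists>\<epsilon>>0. \<exists>M. \<forall>s b. b \<le> s \<longrightarrow> s - b \<ge> M \<longrightarrow> real b \<le> \<epsilon> * sqrt (real (s - b)) \<longrightarrow>
    prb (binomial_pmf (s - b) (1/2)) {j. real j + b \<ge> 1/2 * s + h * (sqrt s / 2)} \<le> p"
proof -
  obtain \<zeta> M0 where \<zeta>: "\<zeta> > 0" and M0: "\<And>m z. m \<ge> M0 \<Longrightarrow> z \<ge> h - \<zeta> \<Longrightarrow> upper_tail m z \<le> p"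
    using upper_tail_le[OF assms(1)] by blast
  have "prb (binomial_pmf (s - b) (1/2)) {j. real j + b \<ge> 1/2 * s + h * (sqrt s / 2)} \<le> p"
    if sb: "b \<le> s" "s - b \<ge> M0" "real b \<le> \<zeta> * sqrt (real (s - b))" for s b
  proof -
    define m where "m = s - b"
    have s: "real s = real m + real b" using sb by (simp add: m_def)
    have "h * sqrt m \<le> h * sqrt s"
      using assms(2) s by (intro mult_left_mono) auto
    then have "(h - \<zeta>) * sqrt m \<le> h * sqrt s - b"
      using sb(3) by (simp add: m_def algebra_simps)
    then have "prb (binomial_pmf m (1/2)) {j. real j + b \<ge> 1/2 * s + h * (sqrt s / 2)} \<le> upper_tail m (h - \<zeta>)"
      by (intro prb_le_upper_tail) (simp add: s field_simps)
    also have "\<dots> \<le> p"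
      using sb by (intro M0) (auto simp: m_def)
    finally show ?thesis by (simp add: m_def)
  qed
  then show ?thesis using \<zeta> by blast
qed

lemma binomial_block_ge:
  assumes "p < Phi_bar h" "h > 0"
  shows "\<exists>\<epsilon>>0. \<exists>M. \<forall>s b. b \<le> s \<longrightarrow> s - b \<ge> M \<longrightarrow> real b \<le> \<epsilon> * sqrt (real (s - b)) \<longrightarrow>
    p \<le> prb (binomial_pmf (s - b) (1/2)) {j. real j \<ge> 1/2 * s + h * (sqrt s / 2)}"
proof -
  obtain \<zeta> M0 where \<zeta>: "\<zeta> > 0" and M0: "\<And>m z. m \<ge> M0 \<Longrightarrow> z \<le> h + \<zeta> \<Longrightarrow> p \<le> upper_tail m z"
    using upper_tail_ge[OF assms(1)] by blast
  define \<epsilon> where "\<epsilon> = \<zeta> / (h + 1)"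
  have \<epsilon>: "\<epsilon> > 0" "(h + 1) * \<epsilon> = \<zeta>"
    using \<zeta> assms(2) by (auto simp: \<epsilon>_def field_simps)
  have "p \<le> prb (binomial_pmf (s - b) (1/2)) {j. real j \<ge> 1/2 * s + h * (sqrt s / 2)}"
    if sb: "b \<le> s" "s - b \<ge> M0" "real b \<le> \<epsilon> * sqrt (real (s - b))" for s b
  proof -
    define m where "m = s - b"
    have s: "real s = real m + real b" using sb by (simp add: m_def)
    \<comment> \<open>The threshold is set by the larger number \<open>s\<close> and has to be
      compared with \<open>sqrt m\<close>; by \<open>sqrt b \<le> b\<close> the whole loss is a
      multiple of \<open>b\<close>.\<close>
    have "sqrt s \<le> sqrt m + sqrt b"
      unfolding s by (rule sqrt_add_le_add_sqrt) auto
    also have "sqrt b \<le> real b"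
    proof (cases "b = 0")
      case False
      then have "real b \<le> (real b)\<^sup>2" by (simp add: power2_eq_square)
      then show ?thesis by (intro real_le_lsqrt) auto
    qed simp
    finally have "h * sqrt s \<le> h * (sqrt m + real b)"
      using assms(2) by (intro mult_left_mono) auto
    then have "h * sqrt s + b \<le> h * sqrt m + (h + 1) * b"
      by (simp add: algebra_simps)
    also have "(h + 1) * b \<le> (h + 1) * (\<epsilon> * sqrt m)"
      using sb(3) assms(2) by (intro mult_left_mono) (auto simp: m_def)
    also have "\<dots> = \<zeta> * sqrt m"
      using \<epsilon>(2) by (simp flip: mult.assoc)
    finally have z: "h * sqrt s + b \<le> (h + \<zeta>) * sqrt m"
      by (simp add: algebra_simps)
    have "p \<le> upper_tail m (h + \<zeta>)"
      using sb by (intro M0) (auto simp: m_def)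
    also have "\<dots> \<le> prb (binomial_pmf m (1/2)) {j. real j \<ge> 1/2 * s + h * (sqrt s / 2)}"
      using z by (intro upper_tail_le_prb) (simp add: s field_simps)
    finally show ?thesis by (simp add: m_def)
  qed
  then show ?thesis using \<epsilon> by blast
qed

lemma card_Diff_plus_Int: "finite A \<Longrightarrow> card A = card (A - B) + card (A \<inter> B)"
  by (metis add.commute card_Diff_subset_Int card_mono finite_Int inf_le1 le_add_diff_inverse2)

lemma prb_union3_le:
  assumes "\<And>x. \<not> A x \<Longrightarrow> \<not> B x \<Longrightarrow> \<not> C x \<Longrightarrow> G x"
    and "prb M {x. A x} \<le> e" "prb M {x. B x} \<le> e" "prb M {x. C x} \<le> e"
  shows "prb M {x. \<not> G x} \<le> 3 * e"
proof -
  have "prb M {x. \<not> G x} \<le> prb M ({x. A x} \<union> {x. B x} \<union> {x. C x})"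
    using assms(1) by (intro prb_mono) auto
  also have "\<dots> \<le> prb M {x. A x} + prb M {x. B x} + prb M {x. C x}"
    by (intro order_trans[OF prb_union_le] add_right_mono prb_union_le)
  finally show ?thesis using assms(2-4) by linarith
qed

text \<open>\<open>a\<close> is the fraction of vertices taking part, known up to \<epsilon>, and
  \<open>P\<close> the limiting probability for one of them. The two copies of \<open>z\<close> are
  the error of the limit theorem and the slack of the counting bound;
  \<open>8 * z \<le> \<zeta>\<close> leaves room for all products of errors.\<close>

lemma window_upper:
  fixes P a z \<epsilon> \<zeta> x A :: real
  assumes "0 < P" "P < 1" "0 < a" "a < 1" "0 < z" "8 * z \<le> \<zeta>" "8 * z \<le> 1" "0 < \<epsilon>" "\<epsilon> < z"
    and "0 \<le> A" "x \<le> (a + \<epsilon>) * A"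
  shows "(P + z + z) * x \<le> (P * a + \<zeta>) * A"
proof -
  have "z * a \<le> z * 1" using assms by (intro mult_left_mono) auto
  moreover have "(P + z + z) * \<epsilon> \<le> 2 * \<epsilon>" using assms by (intro mult_right_mono) auto
  moreover have "(P + z + z) * (a + \<epsilon>) = P * a + 2 * (z * a) + (P + z + z) * \<epsilon>"
    by (simp add: algebra_simps)
  ultimately have "(P + z + z) * (a + \<epsilon>) \<le> P * a + \<zeta>" using assms by linarith
  then have "(P + z + z) * (a + \<epsilon>) * A \<le> (P * a + \<zeta>) * A"
    using assms by (intro mult_right_mono) auto
  moreover have "(P + z + z) * x \<le> (P + z + z) * ((a + \<epsilon>) * A)"
    using assms by (intro mult_left_mono) auto
  ultimately show ?thesis by (simp add: mult.assoc)
qed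

lemma window_lower:
  fixes Q a z \<epsilon> \<zeta> x A :: real
  assumes "0 < Q" "Q < 1" "0 < a" "a < 1" "0 < z" "8 * z \<le> \<zeta>" "8 * z \<le> 1" "0 < \<epsilon>" "\<epsilon> < z"
    and "0 \<le> A" "x \<le> (a + \<epsilon>) * A" "(a - \<epsilon>) * A \<le> x"
  shows "(Q * a - \<zeta>) * A \<le> (Q - z - z) * x"
proof -
  have "Q * ((a - \<epsilon>) * A) \<le> Q * x"
    using assms by (intro mult_left_mono) auto
  moreover have "2 * z * x \<le> 2 * z * ((a + \<epsilon>) * A)"
    using assms by (intro mult_left_mono) auto
  moreover have "(Q * \<epsilon> + 2 * z * (a + \<epsilon>)) * A \<le> \<zeta> * A"
  proof (rule mult_right_mono)
    have "Q * \<epsilon> \<le> 1 * \<epsilon>" using assms by (intro mult_right_mono) auto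
    moreover have "z * (a + \<epsilon>) \<le> z * 2" using assms by (intro mult_left_mono) auto
    ultimately show "Q * \<epsilon> + 2 * z * (a + \<epsilon>) \<le> \<zeta>" using assms by linarith
  qed (use assms in auto)
  ultimately show ?thesis by (simp add: algebra_simps)
qed

text \<open>The states in which an iteration can be analysed, \<open>w\<close> being the ratio of
  clique size to square root. The exponent 0.6 lies above 1/2, which admits cliques somewhat larger
  than the square root, and below 1, so that the clique does not disturb the square roots in the
  thresholds.\<close>

definition admissible :: "real \<Rightarrow> real \<Rightarrow> 'a set \<Rightarrow> 'a set \<Rightarrow> bool" where
  "admissible w M V K \<longleftrightarrow> finite V \<and> M \<le> real (card (V - K)) \<and>
     w * sqrt (card (V - K)) \<le> card (V \<inter> K) \<and> real (card (V \<inter> K)) \<le> real (card (V - K)) powr 0.6"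

definition sampled :: "real \<Rightarrow> real \<Rightarrow> 'a set \<Rightarrow> 'a set \<Rightarrow> 'a set \<Rightarrow> bool" where
  "sampled \<epsilon> \<alpha> S V K \<longleftrightarrow> \<bar>real (card (S - K)) - \<alpha> * real (card (V - K))\<bar> \<le> \<epsilon> * real (card (V - K)) \<and>
     \<bar>real (card (S \<inter> K)) - \<alpha> * real (card (V \<inter> K))\<bar> \<le> \<epsilon> * real (card (V \<inter> K))"

text \<open>Two-sided for the non-clique vertices: the upper bound controls the square root against
  which the clique is measured, the lower bound keeps the graph large. One-sided for the clique,
  where more is better.\<close>

definition proportional :: "real \<Rightarrow> real \<Rightarrow> real \<Rightarrow> 'a set \<Rightarrow> 'a set \<Rightarrow> 'a set \<Rightarrow> bool" where
  "proportional \<epsilon> a d W V K \<longleftrightarrow> \<bar>real (card (W - K)) - a * real (card (V - K))\<bar> \<le> \<epsilon> * real (card (V - K)) \<and>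
     (d - \<epsilon>) * card (V \<inter> K) \<le> card (W \<inter> K)"

text \<open>Sampling scales the clique by \<alpha> but the square root only by
  \<open>sqrt \<alpha>\<close>, so a sampled clique vertex has an advantage of about
  \<open>w * sqrt \<alpha>\<close> standard deviations. This is the shift inside
  \<open>del\<close>.\<close>

lemma core_step:
  fixes \<alpha> \<eta> w \<zeta> :: real
  assumes \<alpha>: "0 < \<alpha>" "\<alpha> < 1" and \<eta>: "\<eta> > 0" and w: "w > 0" and \<zeta>: "0 < \<zeta>"
  obtains \<epsilon> \<theta> N0 :: real where "\<epsilon> > 0" "0 < \<theta>" "\<theta> < 1"
    "\<And>(V::'a set) S K b. admissible w N0 V K \<Longrightarrow> S \<subseteq> V \<Longrightarrow> sampled \<epsilon> \<alpha> S V K \<Longrightarrow>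
      real b \<le> 2 * real (card (V - K)) powr (1/8) \<Longrightarrow>
      prb (random_subset (1/2) (pairs S - pairs K))
        {X. \<not> proportional \<zeta> (gam \<alpha> \<eta>) (del w \<alpha> \<eta>) (core \<eta> (clique_graph K V X) S) V K} \<le> 3 * \<theta> ^ b"
proof -
  define P where "P = Phi_bar \<eta>"
  define D where "D = Phi_bar (\<eta> - w * sqrt \<alpha>)"
  have P: "0 < P" "P < 1" and D: "0 < D" "D < 1" by (auto simp: P_def D_def)
  define z where "z = min \<zeta> 1 / 8"
  have z: "0 < z" "8 * z \<le> \<zeta>" "8 * z \<le> 1" using \<zeta> by (auto simp: z_def)
  obtain \<epsilon>1 M1 where \<epsilon>1: "\<epsilon>1 > 0" and M1: "\<And>s b. b \<le> s \<Longrightarrow> s - b \<ge> M1 \<Longrightarrow> real b \<le> \<epsilon>1 * sqrt (real (s - b)) \<Longrightarrow>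
      prb (binomial_pmf (s - b) (1/2)) {j. real j + b \<ge> 1/2 * s + \<eta> * (sqrt s / 2)} \<le> P + z"
    using binomial_block_le[of \<eta> "P + z"] z \<eta> unfolding P_def by (metis less_add_same_cancel1)
  obtain \<epsilon>2 M2 where \<epsilon>2: "\<epsilon>2 > 0" and M2: "\<And>s b. b \<le> s \<Longrightarrow> s - b \<ge> M2 \<Longrightarrow> real b \<le> \<epsilon>2 * sqrt (real (s - b)) \<Longrightarrow>
      P - z \<le> prb (binomial_pmf (s - b) (1/2)) {j. real j \<ge> 1/2 * s + \<eta> * (sqrt s / 2)}"
    using binomial_block_ge[of "P - z" \<eta>] z \<eta> unfolding P_def by (metis diff_less_eq less_add_same_cancel1)
  obtain \<epsilon>3 M3 where \<epsilon>3: "\<epsilon>3 > 0" and M3: "\<And>m x. m \<ge> M3 \<Longrightarrow> real x \<le> \<epsilon>3 * m \<Longrightarrow> (w * sqrt \<alpha> - \<epsilon>3) * sqrt m \<le> x \<Longrightarrow>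
      D - z \<le> prb (binomial_pmf m (1/2)) {j. real j + real x - 1 \<ge> 1/2 * real (m + x) + \<eta> * (sqrt (real (m + x)) / 2)}"
    using binomial_clique_shift_ge[of "D - z" \<eta> "w * sqrt \<alpha>"] z \<eta> unfolding D_def by (metis diff_less_eq less_add_same_cancel1)
  \<comment> \<open>For relative sampling errors \<open>e\<close> this is the smallest possible
    ratio of sampled clique to square root; being continuous at 0, it exceeds what \<open>M3\<close>
    asks for once \<open>e\<close> is small.\<close>
  have "((\<lambda>e. (\<alpha> - e) * w / sqrt (\<alpha> + e)) \<longlongrightarrow> (\<alpha> - 0) * w / sqrt (\<alpha> + 0)) (at_right 0)"
    using \<alpha> by (intro tendsto_intros) auto
  moreover have "(\<alpha> - 0) * w / sqrt (\<alpha> + 0) = w * sqrt \<alpha>"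
    using \<alpha> by (simp add: real_div_sqrt mult.commute[of \<alpha>] flip: times_divide_eq_right)
  ultimately have "\<forall>\<^sub>F e in at_right 0. w * sqrt \<alpha> - \<epsilon>3 < (\<alpha> - e) * w / sqrt (\<alpha> + e)"
    using \<epsilon>3 by (intro order_tendstoD(1)[of _ "w * sqrt \<alpha>"]) auto
  moreover have "\<forall>\<^sub>F e in at_right 0. e < min z (\<alpha> / 2)"
    using z \<alpha> by (intro order_tendstoD(2)[of "\<lambda>x. x" 0]) (auto intro: tendsto_ident_at)
  moreover have "\<forall>\<^sub>F e in at_right (0::real). 0 < e"
    by (simp add: eventually_at_right_less)
  ultimately have "\<forall>\<^sub>F e in at_right 0. 0 < e \<and> e < min z (\<alpha> / 2) \<and> w * sqrt \<alpha> - \<epsilon>3 < (\<alpha> - e) * w / sqrt (\<alpha> + e)"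
    by eventually_elim auto
  then obtain \<epsilon> where \<epsilon>: "0 < \<epsilon>" "\<epsilon> < z" "\<epsilon> < \<alpha> / 2" "w * sqrt \<alpha> - \<epsilon>3 < (\<alpha> - \<epsilon>) * w / sqrt (\<alpha> + \<epsilon>)"
    using eventually_happens'[OF trivial_limit_at_right_real] by auto
  \<comment> \<open>Blocks of size at most \<open>2 * N powr (1/8)\<close> are negligible against
    \<open>sqrt N\<close>, the order of the degree fluctuations and of the smallest admissible
    clique.\<close>
  have "\<forall>\<^sub>F N in at_top. real (M1 + M2 + M3) \<le> \<alpha> / 2 * N - 2 * N powr (1/8)"
    using \<alpha> by real_asymp
  moreover have "\<forall>\<^sub>F N in at_top. 2 * N powr (1/8) \<le> min \<epsilon>1 \<epsilon>2 * sqrt (\<alpha> / 2 * N - 2 * N powr (1/8))"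
  proof -
    have "min \<epsilon>1 \<epsilon>2 > 0" using \<epsilon>1 \<epsilon>2 by simp
    then show ?thesis using \<alpha> by real_asymp
  qed
  moreover have "\<forall>\<^sub>F N in at_top. 2 * N powr (1/8) \<le> z / 2 * (\<alpha> / 2 * N)"
    using \<alpha> z by real_asymp
  moreover have "\<forall>\<^sub>F N in at_top. 2 * N powr (1/8) \<le> z / 2 * (\<alpha> / 2 * (w * sqrt N))"
    using \<alpha> z w by real_asymp
  moreover have "\<forall>\<^sub>F N in at_top. N powr 0.6 \<le> \<epsilon>3 * (\<alpha> / 2 * N)"
    using \<alpha> \<epsilon>3 by real_asymp
  moreover have "\<forall>\<^sub>F N in at_top. N > (0::real)"
    by (rule eventually_gt_at_top)
  ultimately have "\<forall>\<^sub>F N in at_top. N > 0 \<and> real (M1 + M2 + M3) \<le> \<alpha> / 2 * N - 2 * N powr (1/8) \<and>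
      2 * N powr (1/8) \<le> min \<epsilon>1 \<epsilon>2 * sqrt (\<alpha> / 2 * N - 2 * N powr (1/8)) \<and>
      2 * N powr (1/8) \<le> z / 2 * (\<alpha> / 2 * N) \<and>
      2 * N powr (1/8) \<le> z / 2 * (\<alpha> / 2 * (w * sqrt N)) \<and> N powr 0.6 \<le> \<epsilon>3 * (\<alpha> / 2 * N)"
    by eventually_elim auto
  then obtain N0 where N0: "\<And>N. N \<ge> N0 \<Longrightarrow> N > 0 \<and> real (M1 + M2 + M3) \<le> \<alpha> / 2 * N - 2 * N powr (1/8) \<and>
      2 * N powr (1/8) \<le> min \<epsilon>1 \<epsilon>2 * sqrt (\<alpha> / 2 * N - 2 * N powr (1/8)) \<and>
      2 * N powr (1/8) \<le> z / 2 * (\<alpha> / 2 * N) \<and>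
      2 * N powr (1/8) \<le> z / 2 * (\<alpha> / 2 * (w * sqrt N)) \<and> N powr 0.6 \<le> \<epsilon>3 * (\<alpha> / 2 * N)"
    by (auto simp: eventually_at_top_linorder)
  show ?thesis
  proof (rule that[of \<epsilon> "4 / (4 + z)" N0, OF \<epsilon>(1)])
    fix V S K :: "'a set" and b :: nat
    assume adm: "admissible w N0 V K" and S: "S \<subseteq> V" and samp: "sampled \<epsilon> \<alpha> S V K"
      and b': "real b \<le> 2 * real (card (V - K)) powr (1/8)"
    define N \<kappa> where N: "N = real (card (V - K))" and \<kappa>: "\<kappa> = real (card (V \<inter> K))"
    have V: "finite V" and N': "N \<ge> N0" and wN: "w * sqrt N \<le> \<kappa>" and \<kappa>N: "\<kappa> \<le> N powr 0.6"
      using adm by (auto simp: admissible_def N \<kappa>)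
    have s1: "\<bar>card (S - K) - \<alpha> * N\<bar> \<le> \<epsilon> * N" and s2: "\<bar>card (S \<inter> K) - \<alpha> * \<kappa>\<bar> \<le> \<epsilon> * \<kappa>"
      using samp by (auto simp: sampled_def N \<kappa>)
    note b = b'[folded N]
    let ?M = "random_subset (1/2) (pairs S - pairs K)"
    let ?C = "\<lambda>X. core \<eta> (clique_graph K V X) S"
    note N0 = N0[OF N']
    have finS: "finite S" using V S finite_subset by blast
    have s: "card S = card (S - K) + card (S \<inter> K)"
      using finS by (rule card_Diff_plus_Int)
    have Npos: "N > 0" using N0 by simp
    have \<kappa>0: "\<kappa> \<ge> 0" by (simp add: \<kappa>)
    have s1l: "(\<alpha> - \<epsilon>) * N \<le> card (S - K)" and s1u: "card (S - K) \<le> (\<alpha> + \<epsilon>) * N"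
      using s1 by (auto simp: algebra_simps)
    have s2l: "(\<alpha> - \<epsilon>) * \<kappa> \<le> card (S \<inter> K)"
      using s2 by (auto simp: algebra_simps)
    have "\<alpha> / 2 \<le> \<alpha> - \<epsilon>" using \<epsilon> by simp
    then have "\<alpha> / 2 * N \<le> (\<alpha> - \<epsilon>) * N" "\<alpha> / 2 * \<kappa> \<le> (\<alpha> - \<epsilon>) * \<kappa>"
      using Npos \<kappa>0 by (intro mult_right_mono; simp)+
    then have half: "\<alpha> / 2 * N \<le> card (S - K)" "\<alpha> / 2 * \<kappa> \<le> card (S \<inter> K)"
      using s1l s2l by linarith+
    have bs: "real b \<le> card S" using half(1) N0 b s by linarith
    have sb: "\<alpha> / 2 * N - 2 * N powr (1/8) \<le> real (card S - b)"
      using bs b half(1) s by (simp add: of_nat_diff)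
    have M: "M1 \<le> card S - b" "M2 \<le> card S - b" "M3 \<le> card (S - K)"
    proof -
      have N0': "real M1 + real M2 + real M3 \<le> \<alpha> / 2 * N - 2 * N powr (1/8)"
        using N0 by simp
      have "0 \<le> N powr (1/8)" by simp
      then have "real M1 \<le> real (card S - b)" "real M2 \<le> real (card S - b)" "real M3 \<le> real (card (S - K))"
        using sb N0' half(1) by linarith+
      then show "M1 \<le> card S - b" "M2 \<le> card S - b" "M3 \<le> card (S - K)"
        by (simp_all only: of_nat_le_iff)
    qed
    have sqrt_le: "sqrt (\<alpha> / 2 * N - 2 * N powr (1/8)) \<le> sqrt (real (card S - b))"
      using sb by simp
    have b1: "real b \<le> \<epsilon>1 * sqrt (real (card S - b))"
    proof -
      have "min \<epsilon>1 \<epsilon>2 * sqrt (\<alpha> / 2 * N - 2 * N powr (1/8)) \<le> \<epsilon>1 * sqrt (real (card S - b))"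
        using sqrt_le \<epsilon>1 \<epsilon>2 N0 by (intro mult_mono) auto
      then show ?thesis using b N0 by linarith
    qed
    have b2: "real b \<le> \<epsilon>2 * sqrt (real (card S - b))"
    proof -
      have "min \<epsilon>1 \<epsilon>2 * sqrt (\<alpha> / 2 * N - 2 * N powr (1/8)) \<le> \<epsilon>2 * sqrt (real (card S - b))"
        using sqrt_le \<epsilon>1 \<epsilon>2 N0 by (intro mult_mono) auto
      then show ?thesis using b N0 by linarith
    qed
    have b3: "real b \<le> z / 2 * card (S - K)"
    proof -
      have "z / 2 * (\<alpha> / 2 * N) \<le> z / 2 * card (S - K)"
        using half z by (intro mult_left_mono) auto
      then show ?thesis using b N0 by linarith
    qed
    have b4: "real b \<le> z / 2 * card (S \<inter> K)"
    proof -
      have "z / 2 * (\<alpha> / 2 * (w * sqrt N)) \<le> z / 2 * (\<alpha> / 2 * \<kappa>)"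
        using wN z \<alpha> by (intro mult_left_mono) auto
      also have "\<dots> \<le> z / 2 * card (S \<inter> K)"
        using half z by (intro mult_left_mono) auto
      finally show ?thesis using b N0 by linarith
    qed
    have x1: "real (card (S \<inter> K)) \<le> \<epsilon>3 * card (S - K)"
    proof -
      have "card (S \<inter> K) \<le> card (V \<inter> K)"
        using S V by (intro card_mono) auto
      then have "real (card (S \<inter> K)) \<le> N powr 0.6" using \<kappa>N \<kappa> by linarith
      also have "\<dots> \<le> \<epsilon>3 * (\<alpha> / 2 * N)" using N0 by simp
      also have "\<dots> \<le> \<epsilon>3 * card (S - K)"
        using half \<epsilon>3 by (intro mult_left_mono) auto
      finally show ?thesis .
    qed
    have x2: "(w * sqrt \<alpha> - \<epsilon>3) * sqrt (card (S - K)) \<le> card (S \<inter> K)"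
    proof -
      have "(w * sqrt \<alpha> - \<epsilon>3) * sqrt (card (S - K)) \<le> (\<alpha> - \<epsilon>) * w / sqrt (\<alpha> + \<epsilon>) * sqrt (card (S - K))"
        using \<epsilon> by (intro mult_right_mono) auto
      also have "\<dots> \<le> (\<alpha> - \<epsilon>) * w / sqrt (\<alpha> + \<epsilon>) * sqrt ((\<alpha> + \<epsilon>) * N)"
        using s1u \<epsilon> \<alpha> w by (intro mult_left_mono) auto
      also have "\<dots> = (\<alpha> - \<epsilon>) * (w * sqrt N)"
        using \<epsilon> \<alpha> by (simp add: real_sqrt_mult)
      also have "\<dots> \<le> (\<alpha> - \<epsilon>) * \<kappa>"
        using wN \<epsilon> \<alpha> by (intro mult_left_mono) auto
      finally show ?thesis using s2l by linarith
    qed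
    \<comment> \<open>One \<open>z\<close> is the distance between binomial and normal tail, the
      other the slack of the counting bound.\<close>
    have 1: "prb ?M {X. (P + z + z) * card (S - K) \<le> card (?C X - K)} \<le> (4 / (4 + z)) ^ b"
      using M1[OF _ M(1) b1] bs z b3 P by (intro core_outside_ge[OF V S]) auto
    have 2: "prb ?M {X. card (?C X - K) \<le> (P - z - z) * card (S - K)} \<le> (4 / (4 + z)) ^ b"
      using M2[OF _ M(2) b2] bs z b3 P by (intro core_outside_le[OF V S]) auto
    have 3: "prb ?M {X. card (?C X \<inter> K) \<le> (D - z - z) * card (S \<inter> K)} \<le> (4 / (4 + z)) ^ b"
      using M3[OF M(3) x1 x2] s z b4 D by (intro core_inside_le[OF V S]) auto
    have s2u: "card (S \<inter> K) \<le> (\<alpha> + \<epsilon>) * \<kappa>"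
      using s2 by (auto simp: algebra_simps)
    have up: "(P + z + z) * card (S - K) \<le> (gam \<alpha> \<eta> + \<zeta>) * N"
      using window_upper[OF P \<alpha> z \<epsilon>(1,2) _ s1u] Npos by (simp add: gam_def P_def mult.commute[of \<alpha>])
    have low1: "(gam \<alpha> \<eta> - \<zeta>) * N \<le> (P - z - z) * card (S - K)"
      using window_lower[OF P \<alpha> z \<epsilon>(1,2) _ s1u s1l] Npos by (simp add: gam_def P_def mult.commute[of \<alpha>])
    have low2: "(del w \<alpha> \<eta> - \<zeta>) * \<kappa> \<le> (D - z - z) * card (S \<inter> K)"
      using window_lower[OF D \<alpha> z \<epsilon>(1,2) \<kappa>0 s2u s2l] by (simp add: del_def D_def mult.commute[of \<alpha>])
    have "proportional \<zeta> (gam \<alpha> \<eta>) (del w \<alpha> \<eta>) (?C X) V K"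
      if "\<not> (P + z + z) * card (S - K) \<le> card (?C X - K)" "\<not> card (?C X - K) \<le> (P - z - z) * card (S - K)"
        "\<not> card (?C X \<inter> K) \<le> (D - z - z) * card (S \<inter> K)" for X
    proof -
      have "card (?C X - K) \<le> (gam \<alpha> \<eta> + \<zeta>) * N" "(gam \<alpha> \<eta> - \<zeta>) * N \<le> card (?C X - K)"
        "(del w \<alpha> \<eta> - \<zeta>) * \<kappa> \<le> card (?C X \<inter> K)"
        using that up low1 low2 by linarith+
      then show ?thesis by (simp add: proportional_def N \<kappa> abs_le_iff algebra_simps)
    qed
    then show "prb ?M {X. \<not> proportional \<zeta> (gam \<alpha> \<eta>) (del w \<alpha> \<eta>) (?C X) V K} \<le> 3 * (4 / (4 + z)) ^ b"
      by (rule prb_union3_le[OF _ 1 2 3])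
  qed (use z in auto)
qed

text \<open>Up to \<epsilon>, the core has \<open>\<gamma> * N\<close> non-clique members and at
  least \<open>\<delta> * w * sqrt N\<close> clique members. Their ratio of clique to square root,
  \<open>w * \<delta> / sqrt \<gamma>\<close>, is the shift that appears in \<rho>.\<close>

lemma survivor_step:
  fixes \<alpha> \<beta> \<eta> w \<zeta> \<gamma> \<delta> :: real
  assumes \<alpha>: "0 < \<alpha>" "\<alpha> < 1" and \<beta>: "\<beta> > 0" and w: "w > 0" and \<gamma>: "0 < \<gamma>" and \<delta>: "0 < \<delta>" and \<zeta>: "0 < \<zeta>"
  obtains \<epsilon> \<theta> N0 :: real where "\<epsilon> > 0" "0 < \<theta>" "\<theta> < 1"
    "\<And>(V::'a set) S K X b. admissible w N0 V K \<Longrightarrow> S \<subseteq> V \<Longrightarrow> sampled \<epsilon> \<alpha> S V K \<Longrightarrow>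
      X \<subseteq> pairs S - pairs K \<Longrightarrow> proportional \<epsilon> \<gamma> \<delta> (core \<eta> (clique_graph K V X) S) V K \<Longrightarrow>
      real b \<le> 2 * real (card (V - K)) powr (1/8) \<Longrightarrow>
      prb (random_subset (1/2) (pairs V - pairs K - pairs S))
        {Y. \<not> proportional \<zeta> (tau \<alpha> \<beta>) ((1 - \<alpha>) * Phi_bar (\<beta> - w * \<delta> / sqrt \<gamma>))
          (survivors \<beta> \<eta> (clique_graph K V (X \<union> Y)) S) V K} \<le> 3 * \<theta> ^ b"
proof -
  define P where "P = Phi_bar \<beta>"
  define D where "D = Phi_bar (\<beta> - w * \<delta> / sqrt \<gamma>)"
  define a where "a = 1 - \<alpha>"
  have a: "0 < a" "a < 1" using \<alpha> by (auto simp: a_def)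
  have P: "0 < P" "P < 1" and D: "0 < D" "D < 1" by (auto simp: P_def D_def)
  define z where "z = min \<zeta> 1 / 8"
  have z: "0 < z" "8 * z \<le> \<zeta>" "8 * z \<le> 1" using \<zeta> by (auto simp: z_def)
  obtain \<epsilon>1 M1 where \<epsilon>1: "\<epsilon>1 > 0" and M1: "\<And>s b. b \<le> s \<Longrightarrow> s - b \<ge> M1 \<Longrightarrow> real b \<le> \<epsilon>1 * sqrt (real (s - b)) \<Longrightarrow>
      prb (binomial_pmf (s - b) (1/2)) {j. real j + b \<ge> 1/2 * s + \<beta> * (sqrt s / 2)} \<le> P + z"
    using binomial_block_le[of \<beta> "P + z"] z \<beta> unfolding P_def by (metis less_add_same_cancel1)
  obtain \<epsilon>2 M2 where \<epsilon>2: "\<epsilon>2 > 0" and M2: "\<And>s b. b \<le> s \<Longrightarrow> s - b \<ge> M2 \<Longrightarrow> real b \<le> \<epsilon>2 * sqrt (real (s - b)) \<Longrightarrow>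
      P - z \<le> prb (binomial_pmf (s - b) (1/2)) {j. real j \<ge> 1/2 * s + \<beta> * (sqrt s / 2)}"
    using binomial_block_ge[of "P - z" \<beta>] z \<beta> unfolding P_def by (metis diff_less_eq less_add_same_cancel1)
  obtain \<epsilon>3 M3 where \<epsilon>3: "\<epsilon>3 > 0" and M3: "\<And>m x. m \<ge> M3 \<Longrightarrow> real x \<le> \<epsilon>3 * m \<Longrightarrow> (w * \<delta> / sqrt \<gamma> - \<epsilon>3) * sqrt m \<le> x \<Longrightarrow>
      D - z \<le> prb (binomial_pmf m (1/2)) {j. real j + real x - 1 \<ge> 1/2 * real (m + x) + \<beta> * (sqrt (real (m + x)) / 2)}"
    using binomial_clique_shift_ge[of "D - z" \<beta> "w * \<delta> / sqrt \<gamma>"] z \<beta> unfolding D_def by (metis diff_less_eq less_add_same_cancel1)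
  have "((\<lambda>e. (\<delta> - e) * w / sqrt (\<gamma> + e)) \<longlongrightarrow> (\<delta> - 0) * w / sqrt (\<gamma> + 0)) (at_right 0)"
    using \<gamma> by (intro tendsto_intros) auto
  moreover have "(\<delta> - 0) * w / sqrt (\<gamma> + 0) = w * \<delta> / sqrt \<gamma>"
    by (simp add: mult.commute)
  ultimately have "((\<lambda>e. (\<delta> - e) * w / sqrt (\<gamma> + e)) \<longlongrightarrow> w * \<delta> / sqrt \<gamma>) (at_right 0)"
    by (simp add: mult.commute)
  then have "\<forall>\<^sub>F e in at_right 0. w * \<delta> / sqrt \<gamma> - \<epsilon>3 < (\<delta> - e) * w / sqrt (\<gamma> + e)"
    using \<epsilon>3 by (elim order_tendstoD(1)) auto
  moreover have "\<forall>\<^sub>F e in at_right 0. e < min (min z (a / 2)) (min (\<gamma> / 2) \<delta>)"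
    using z a \<gamma> \<delta> by (intro order_tendstoD(2)[of "\<lambda>x. x" 0]) (auto intro: tendsto_ident_at)
  moreover have "\<forall>\<^sub>F e in at_right (0::real). 0 < e"
    by (simp add: eventually_at_right_less)
  ultimately have "\<forall>\<^sub>F e in at_right 0. 0 < e \<and> e < min (min z (a / 2)) (min (\<gamma> / 2) \<delta>) \<and> w * \<delta> / sqrt \<gamma> - \<epsilon>3 < (\<delta> - e) * w / sqrt (\<gamma> + e)"
    by eventually_elim auto
  then obtain \<epsilon> where \<epsilon>: "0 < \<epsilon>" "\<epsilon> < z" "\<epsilon> < a / 2" "\<epsilon> < \<gamma> / 2" "\<epsilon> < \<delta>"
      "w * \<delta> / sqrt \<gamma> - \<epsilon>3 < (\<delta> - \<epsilon>) * w / sqrt (\<gamma> + \<epsilon>)"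
    using eventually_happens'[OF trivial_limit_at_right_real] by auto
  have "\<forall>\<^sub>F N in at_top. real (M1 + M2 + M3) \<le> \<gamma> / 2 * N"
    using \<gamma> by real_asymp
  moreover have "\<forall>\<^sub>F N in at_top. 2 * N powr (1/8) \<le> z / 2 * (a / 2 * N)"
    using a z by real_asymp
  moreover have "\<forall>\<^sub>F N in at_top. 2 * N powr (1/8) \<le> z / 2 * (a / 2 * (w * sqrt N))"
    using a z w by real_asymp
  moreover have "\<forall>\<^sub>F N in at_top. N powr 0.6 \<le> \<epsilon>3 * (\<gamma> / 2 * N)"
    using \<gamma> \<epsilon>3 by real_asymp
  moreover have "\<forall>\<^sub>F N in at_top. N > (0::real)"
    by (rule eventually_gt_at_top)
  ultimately have "\<forall>\<^sub>F N in at_top. N > 0 \<and> real (M1 + M2 + M3) \<le> \<gamma> / 2 * N \<and>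
      2 * N powr (1/8) \<le> z / 2 * (a / 2 * N) \<and>
      2 * N powr (1/8) \<le> z / 2 * (a / 2 * (w * sqrt N)) \<and> N powr 0.6 \<le> \<epsilon>3 * (\<gamma> / 2 * N)"
    by eventually_elim auto
  then obtain N0 where N0: "\<And>N. N \<ge> N0 \<Longrightarrow> N > 0 \<and> real (M1 + M2 + M3) \<le> \<gamma> / 2 * N \<and>
      2 * N powr (1/8) \<le> z / 2 * (a / 2 * N) \<and>
      2 * N powr (1/8) \<le> z / 2 * (a / 2 * (w * sqrt N)) \<and> N powr 0.6 \<le> \<epsilon>3 * (\<gamma> / 2 * N)"
    by (auto simp: eventually_at_top_linorder)
  show ?thesis
  proof (rule that[of \<epsilon> "4 / (4 + z)" N0, OF \<epsilon>(1)])
    fix V S K :: "'a set" and X :: "'a set set" and b :: nat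
    assume adm: "admissible w N0 V K" and S: "S \<subseteq> V" and samp: "sampled \<epsilon> \<alpha> S V K"
      and X: "X \<subseteq> pairs S - pairs K" and core_prop: "proportional \<epsilon> \<gamma> \<delta> (core \<eta> (clique_graph K V X) S) V K"
      and b': "real b \<le> 2 * real (card (V - K)) powr (1/8)"
    define N \<kappa> where N: "N = real (card (V - K))" and \<kappa>: "\<kappa> = real (card (V \<inter> K))"
    define T where T: "T = core \<eta> (clique_graph K V X) S"
    have V: "finite V" and N': "N \<ge> N0" and wN: "w * sqrt N \<le> \<kappa>" and \<kappa>N: "\<kappa> \<le> N powr 0.6"
      using adm by (auto simp: admissible_def N \<kappa>)
    have s1: "\<bar>card (S - K) - \<alpha> * N\<bar> \<le> \<epsilon> * N" and s2: "\<bar>card (S \<inter> K) - \<alpha> * \<kappa>\<bar> \<le> \<epsilon> * \<kappa>"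
      using samp by (auto simp: sampled_def N \<kappa>)
    have t1: "\<bar>card (T - K) - \<gamma> * N\<bar> \<le> \<epsilon> * N" and t2: "(\<delta> - \<epsilon>) * \<kappa> \<le> card (T \<inter> K)"
      using core_prop by (auto simp: proportional_def N \<kappa> T)
    note b = b'[folded N]
    let ?M = "random_subset (1/2) (pairs V - pairs K - pairs S)"
    let ?C = "\<lambda>Y. survivors \<beta> \<eta> (clique_graph K V (X \<union> Y)) S"
    note N0 = N0[OF N']
    have finS: "finite S" using V S finite_subset by blast
    have TS: "T \<subseteq> S" unfolding T by (rule core_subset)
    then have finT: "finite T" using finS finite_subset by blast
    have t: "card T = card (T - K) + card (T \<inter> K)"
      using finT by (rule card_Diff_plus_Int)
    have Npos: "N > 0" using N0 by simp
    have \<kappa>0: "\<kappa> \<ge> 0" by (simp add: \<kappa>)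
    define r1 where "r1 = real (card (V - S - K))"
    define r2 where "r2 = real (card ((V - S) \<inter> K))"
    have r1_eq: "r1 = N - card (S - K)"
    proof -
      have "V - S - K = (V - K) - (S - K)" by auto
      then show ?thesis
        using V S finS unfolding r1_def N by (auto simp: card_Diff_subset of_nat_diff card_mono Diff_mono)
    qed
    have r2_eq: "r2 = \<kappa> - card (S \<inter> K)"
    proof -
      have "(V - S) \<inter> K = (V \<inter> K) - (S \<inter> K)" "S \<inter> K \<subseteq> V \<inter> K" using S by auto
      then show ?thesis
        using V finS unfolding r2_def \<kappa> by (auto simp: card_Diff_subset of_nat_diff card_mono)
    qed
    have r1l: "(a - \<epsilon>) * N \<le> r1" and r1u: "r1 \<le> (a + \<epsilon>) * N"
      using s1 unfolding r1_eq a_def by (auto simp: algebra_simps)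
    have r2l: "(a - \<epsilon>) * \<kappa> \<le> r2" and r2u: "r2 \<le> (a + \<epsilon>) * \<kappa>"
      using s2 unfolding r2_eq a_def by (auto simp: algebra_simps)
    have "a / 2 \<le> a - \<epsilon>" using \<epsilon> by simp
    then have "a / 2 * N \<le> (a - \<epsilon>) * N" "a / 2 * \<kappa> \<le> (a - \<epsilon>) * \<kappa>"
      using Npos \<kappa>0 by (intro mult_right_mono; simp)+
    then have half: "a / 2 * N \<le> r1" "a / 2 * \<kappa> \<le> r2"
      using r1l r2l by linarith+
    have t1l: "(\<gamma> - \<epsilon>) * N \<le> card (T - K)" and t1u: "card (T - K) \<le> (\<gamma> + \<epsilon>) * N"
      using t1 by (auto simp: algebra_simps)
    have "\<gamma> / 2 * N \<le> (\<gamma> - \<epsilon>) * N"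
      using \<epsilon> Npos by (intro mult_right_mono) auto
    then have thalf: "\<gamma> / 2 * N \<le> card (T - K)"
      using t1l by linarith
    \<comment> \<open>Blocks lie outside the core, so the block estimates are taken at block size
      0.\<close>
    have M: "M1 \<le> card T - 0" "M2 \<le> card T - 0" "M3 \<le> card (T - K)"
    proof -
      have N0': "real M1 + real M2 + real M3 \<le> \<gamma> / 2 * N"
        using N0 by simp
      have "real M1 \<le> real (card T)" "real M2 \<le> real (card T)" "real M3 \<le> real (card (T - K))"
        using N0' thalf t by linarith+
      then show "M1 \<le> card T - 0" "M2 \<le> card T - 0" "M3 \<le> card (T - K)"
        by simp_all
    qed
    have b3: "real b \<le> z / 2 * card (V - S - K)"
    proof -
      have "z / 2 * (a / 2 * N) \<le> z / 2 * r1"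
        using half z by (intro mult_left_mono) auto
      then show ?thesis using b N0 unfolding r1_def by linarith
    qed
    have b4: "real b \<le> z / 2 * card ((V - S) \<inter> K)"
    proof -
      have "z / 2 * (a / 2 * (w * sqrt N)) \<le> z / 2 * (a / 2 * \<kappa>)"
        using wN z a by (intro mult_left_mono) auto
      also have "\<dots> \<le> z / 2 * r2"
        using half z by (intro mult_left_mono) auto
      finally show ?thesis using b N0 unfolding r2_def by linarith
    qed
    have x1: "real (card (T \<inter> K)) \<le> \<epsilon>3 * card (T - K)"
    proof -
      have "card (T \<inter> K) \<le> card (V \<inter> K)"
        using S V TS by (intro card_mono) auto
      then have "real (card (T \<inter> K)) \<le> N powr 0.6" using \<kappa>N \<kappa> by linarith
      also have "\<dots> \<le> \<epsilon>3 * (\<gamma> / 2 * N)" using N0 by simp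
      also have "\<dots> \<le> \<epsilon>3 * card (T - K)"
        using thalf \<epsilon>3 by (intro mult_left_mono) auto
      finally show ?thesis .
    qed
    have x2: "(w * \<delta> / sqrt \<gamma> - \<epsilon>3) * sqrt (card (T - K)) \<le> card (T \<inter> K)"
    proof -
      have "(w * \<delta> / sqrt \<gamma> - \<epsilon>3) * sqrt (card (T - K)) \<le> (\<delta> - \<epsilon>) * w / sqrt (\<gamma> + \<epsilon>) * sqrt (card (T - K))"
        using \<epsilon> by (intro mult_right_mono) auto
      also have "\<dots> \<le> (\<delta> - \<epsilon>) * w / sqrt (\<gamma> + \<epsilon>) * sqrt ((\<gamma> + \<epsilon>) * N)"
        using t1u \<epsilon> \<gamma> w by (intro mult_left_mono) auto
      also have "\<dots> = (\<delta> - \<epsilon>) * (w * sqrt N)"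
        using \<epsilon> \<gamma> by (simp add: real_sqrt_mult)
      also have "\<dots> \<le> (\<delta> - \<epsilon>) * \<kappa>"
        using wN \<epsilon> by (intro mult_left_mono) auto
      finally show ?thesis using t2 by linarith
    qed
    have 1: "prb ?M {Y. (P + z + z) * card (V - S - K) \<le> card (?C Y - K)} \<le> (4 / (4 + z)) ^ b"
      using M1[OF _ M(1)] z b3 \<epsilon>1 P by (intro survivors_outside_ge[OF V S X T]) auto
    have 2: "prb ?M {Y. card (?C Y - K) \<le> (P - z - z) * card (V - S - K)} \<le> (4 / (4 + z)) ^ b"
      using M2[OF _ M(2)] z b3 \<epsilon>2 P by (intro survivors_outside_le[OF V S X T]) auto
    \<comment> \<open>The shift estimate subtracts one for the vertex itself; here the vertex lies
      outside the core, so the event is only larger.\<close>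
    have "D - z \<le> prb (binomial_pmf (card (T - K)) (1/2)) {j. real j + real (card (T \<inter> K)) \<ge> 1/2 * card T + \<beta> * (sqrt (card T) / 2)}"
      by (rule order_trans[OF M3[OF M(3) x1 x2]], intro prb_mono) (auto simp: t)
    then have 3: "prb ?M {Y. card (?C Y \<inter> K) \<le> (D - z - z) * card ((V - S) \<inter> K)} \<le> (4 / (4 + z)) ^ b"
      using z b4 D by (intro survivors_inside_le[OF V S X T]) auto
    have up: "(P + z + z) * r1 \<le> (tau \<alpha> \<beta> + \<zeta>) * N"
      using window_upper[OF P a z \<epsilon>(1,2) _ r1u] Npos by (simp add: tau_def P_def mult.commute[of a] flip: a_def)
    have low1: "(tau \<alpha> \<beta> - \<zeta>) * N \<le> (P - z - z) * r1"
      using window_lower[OF P a z \<epsilon>(1,2) _ r1u r1l] Npos by (simp add: tau_def P_def mult.commute[of a] flip: a_def)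
    have low2: "((1 - \<alpha>) * D - \<zeta>) * \<kappa> \<le> (D - z - z) * r2"
      using window_lower[OF D a z \<epsilon>(1,2) \<kappa>0 r2u r2l] by (simp add: mult.commute[of a] flip: a_def)
    have "proportional \<zeta> (tau \<alpha> \<beta>) ((1 - \<alpha>) * D) (?C Y) V K"
      if "\<not> (P + z + z) * card (V - S - K) \<le> card (?C Y - K)" "\<not> card (?C Y - K) \<le> (P - z - z) * card (V - S - K)"
        "\<not> card (?C Y \<inter> K) \<le> (D - z - z) * card ((V - S) \<inter> K)" for Y
    proof -
      have "card (?C Y - K) \<le> (tau \<alpha> \<beta> + \<zeta>) * N" "(tau \<alpha> \<beta> - \<zeta>) * N \<le> card (?C Y - K)"
        "((1 - \<alpha>) * D - \<zeta>) * \<kappa> \<le> card (?C Y \<inter> K)"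
        using that up low1 low2 unfolding r1_def r2_def by linarith+
      then show ?thesis by (simp add: proportional_def N \<kappa> abs_le_iff algebra_simps)
    qed
    then show "prb ?M {Y. \<not> proportional \<zeta> (tau \<alpha> \<beta>) ((1 - \<alpha>) * Phi_bar (\<beta> - w * \<delta> / sqrt \<gamma>)) (?C Y) V K}
        \<le> 3 * (4 / (4 + z)) ^ b"
      unfolding D_def[symmetric] by (rule prb_union3_le[OF _ 1 2 3])
  qed (use z in auto)
qed

text \<open>Tolerances are chosen backwards: \<xi> for the survivors fixes
  \<open>\<epsilon>1\<close> for the core, and both steps then restrict the sample. The exposures
  run forwards, from sample to inner edges to outer edges, each conditional on the success of the
  previous one.\<close>

lemma one_step:
  fixes \<alpha> \<beta> \<eta> w \<xi> :: real
  assumes \<alpha>: "0 < \<alpha>" "\<alpha> < 1" and \<beta>: "\<beta> > 0" and \<eta>: "\<eta> > 0" and w: "w > 0" and \<xi>: "0 < \<xi>"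
  obtains N0 where "\<And>(V::'a set) K. admissible w N0 V K \<Longrightarrow>
    prb (step \<alpha> \<beta> \<eta> K V) {W. \<not> proportional \<xi> (tau \<alpha> \<beta>) (rho w \<alpha> \<beta> \<eta>) W V K}
      \<le> exp (- (real (card (V - K)) powr (1/10)))"
proof -
  have pos: "gam \<alpha> \<eta> > 0" "del w \<alpha> \<eta> > 0"
    using \<alpha> by (auto simp: gam_def del_def)
  define \<gamma> \<delta> where "\<gamma> = gam \<alpha> \<eta>" and "\<delta> = del w \<alpha> \<eta>"
  obtain \<epsilon>1 \<theta>1 N1 where e1: "\<epsilon>1 > 0" "0 < \<theta>1" "\<theta>1 < 1" and surv:
    "\<And>(V::'a set) S K X b. admissible w N1 V K \<Longrightarrow> S \<subseteq> V \<Longrightarrow> sampled \<epsilon>1 \<alpha> S V K \<Longrightarrow>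
      X \<subseteq> pairs S - pairs K \<Longrightarrow> proportional \<epsilon>1 \<gamma> \<delta> (core \<eta> (clique_graph K V X) S) V K \<Longrightarrow>
      real b \<le> 2 * real (card (V - K)) powr (1/8) \<Longrightarrow>
      prb (random_subset (1/2) (pairs V - pairs K - pairs S))
        {Y. \<not> proportional \<xi> (tau \<alpha> \<beta>) (rho w \<alpha> \<beta> \<eta>) (survivors \<beta> \<eta> (clique_graph K V (X \<union> Y)) S) V K} \<le> 3 * \<theta>1 ^ b"
    by (rule survivor_step[where 'a='a, OF \<alpha> \<beta> w pos \<xi>, of \<eta>, folded rho_def, folded \<gamma>_def \<delta>_def])
      (rule that, assumption+)
  obtain \<epsilon>2 \<theta>2 N2 where e2: "\<epsilon>2 > 0" "0 < \<theta>2" "\<theta>2 < 1" and core: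
    "\<And>(V::'a set) S K b. admissible w N2 V K \<Longrightarrow> S \<subseteq> V \<Longrightarrow> sampled \<epsilon>2 \<alpha> S V K \<Longrightarrow>
      real b \<le> 2 * real (card (V - K)) powr (1/8) \<Longrightarrow>
      prb (random_subset (1/2) (pairs S - pairs K))
        {X. \<not> proportional \<epsilon>1 \<gamma> \<delta> (core \<eta> (clique_graph K V X) S) V K} \<le> 3 * \<theta>2 ^ b"
    by (rule core_step[where 'a='a, OF \<alpha> \<eta> w e1(1), folded \<gamma>_def \<delta>_def])
      (rule that, assumption+)
  define \<epsilon> where "\<epsilon> = min \<epsilon>1 \<epsilon>2"
  have \<epsilon>: "\<epsilon> > 0" "\<epsilon> \<le> \<epsilon>1" "\<epsilon> \<le> \<epsilon>2" using e1 e2 by (auto simp: \<epsilon>_def)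
  define \<theta> where "\<theta> = max (4 / (4 + \<epsilon>)) (max \<theta>1 \<theta>2)"
  have \<theta>: "0 < \<theta>" "\<theta> < 1" "4 / (4 + \<epsilon>) \<le> \<theta>" "\<theta>1 \<le> \<theta>" "\<theta>2 \<le> \<theta>"
    using e1 e2 \<epsilon> by (auto simp: \<theta>_def less_max_iff_disj)
  define c where "c = - ln \<theta>"
  have c: "c > 0" "\<theta> = exp (- c)" using \<theta> by (auto simp: c_def)
  \<comment> \<open>The 10 consists of 4 for the sample, 3 for the core and 3 for the survivors. The
    exponent 1/10 is below 1/8 in order to absorb this factor and the constant
    \<open>c\<close>.\<close>
  have "\<forall>\<^sub>F N in at_top. 10 * exp (- c * N powr (1/8)) \<le> exp (- (N powr (1/10)))"
    using c by real_asymp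
  moreover have "\<forall>\<^sub>F N in at_top. 2 * N powr (1/8) \<le> \<epsilon> / 2 * N"
    using \<epsilon> by real_asymp
  moreover have "\<forall>\<^sub>F N in at_top. 2 * N powr (1/8) \<le> \<epsilon> / 2 * (w * sqrt N)"
    using \<epsilon> w by real_asymp
  ultimately have "\<forall>\<^sub>F N in at_top. N \<ge> max (max N1 N2) 1 \<and> 10 * exp (- c * N powr (1/8)) \<le> exp (- (N powr (1/10))) \<and>
      2 * N powr (1/8) \<le> \<epsilon> / 2 * N \<and> 2 * N powr (1/8) \<le> \<epsilon> / 2 * (w * sqrt N)"
    using eventually_ge_at_top[of "max (max N1 N2) 1"] by eventually_elim auto
  then obtain N0 where N0: "\<And>N. N \<ge> N0 \<Longrightarrow> N \<ge> max (max N1 N2) 1 \<and> 10 * exp (- c * N powr (1/8)) \<le> exp (- (N powr (1/10))) \<and>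
      2 * N powr (1/8) \<le> \<epsilon> / 2 * N \<and> 2 * N powr (1/8) \<le> \<epsilon> / 2 * (w * sqrt N)"
    by (auto simp: eventually_at_top_linorder)
  show ?thesis
  proof (rule that[of N0])
    fix V K :: "'a set"
    assume adm: "admissible w N0 V K"
    define N \<kappa> where "N = real (card (V - K))" and "\<kappa> = real (card (V \<inter> K))"
    have V: "finite V" and NN: "N0 \<le> N" and wN: "w * sqrt N \<le> \<kappa>"
      using adm by (auto simp: admissible_def N_def \<kappa>_def)
    note N0 = N0[OF NN]
    have adm12: "admissible w N1 V K" "admissible w N2 V K"
      using adm N0 by (auto simp: admissible_def N_def)
    define b where "b = nat \<lceil>N powr (1/8)\<rceil>"
    have "1 \<le> N powr (1/8)" using N0 by (simp add: ge_one_powr_ge_zero)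
    then have b: "N powr (1/8) \<le> real b" "real b \<le> 2 * N powr (1/8)"
      unfolding b_def by linarith+
    let ?good = "\<lambda>W. proportional \<xi> (tau \<alpha> \<beta>) (rho w \<alpha> \<beta> \<eta>) W V K"
    let ?S1 = "{S. \<not> \<bar>card (S \<inter> (V - K)) - \<alpha> * card (V - K)\<bar> \<le> \<epsilon> * card (V - K)}"
    let ?S2 = "{S. \<not> \<bar>card (S \<inter> (V \<inter> K)) - \<alpha> * card (V \<inter> K)\<bar> \<le> \<epsilon> * card (V \<inter> K)}"
    have p1: "(4 / (4 + \<epsilon>)) ^ b \<le> \<theta> ^ b" "\<theta>1 ^ b \<le> \<theta> ^ b" "\<theta>2 ^ b \<le> \<theta> ^ b"
      using \<theta> \<epsilon> e1 e2 by (auto intro!: power_mono)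
    have "real b \<le> \<epsilon> / 2 * card (V - K)"
      using b N0 by (simp flip: N_def)
    then have "prb (random_subset \<alpha> V) ?S1 \<le> 2 * (4 / (4 + \<epsilon>)) ^ b"
      using V \<alpha> \<epsilon> by (intro sample_step) auto
    moreover have "real b \<le> \<epsilon> / 2 * card (V \<inter> K)"
    proof -
      have "\<epsilon> / 2 * (w * sqrt N) \<le> \<epsilon> / 2 * \<kappa>"
        using wN \<epsilon> by (intro mult_left_mono) auto
      then show ?thesis using b N0 by (simp flip: \<kappa>_def)
    qed
    then have "prb (random_subset \<alpha> V) ?S2 \<le> 2 * (4 / (4 + \<epsilon>)) ^ b"
      using V \<alpha> \<epsilon> by (intro sample_step) auto
    ultimately have sample: "prb (random_subset \<alpha> V) (?S1 \<union> ?S2) \<le> 4 * \<theta> ^ b"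
      using prb_union_le[of "random_subset \<alpha> V" ?S1 ?S2] p1 by linarith
    have "prb (step \<alpha> \<beta> \<eta> K V) {W. \<not> ?good W} \<le> prb (random_subset \<alpha> V) (?S1 \<union> ?S2) + 6 * \<theta> ^ b"
      unfolding step_def
    proof (rule prb_bind_le)
      fix S assume "S \<in> set_pmf (random_subset \<alpha> V)" and S_good: "S \<notin> ?S1 \<union> ?S2"
      then have S: "S \<subseteq> V" by (auto dest: set_random_subset)
      then have "S \<inter> (V - K) = S - K" "S \<inter> (V \<inter> K) = S \<inter> K" by auto
      then have "sampled \<epsilon> \<alpha> S V K" using S_good by (simp add: sampled_def)
      moreover have "\<epsilon> * card A \<le> \<epsilon>1 * card A" "\<epsilon> * card A \<le> \<epsilon>2 * card A" for A :: "'a set"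
        using \<epsilon> by (auto intro!: mult_right_mono)
      ultimately have samp: "sampled \<epsilon>1 \<alpha> S V K" "sampled \<epsilon>2 \<alpha> S V K"
        unfolding sampled_def by (meson order_trans)+
      note b' = b(2)[unfolded N_def]
      let ?B = "{X. \<not> proportional \<epsilon>1 \<gamma> \<delta> (core \<eta> (clique_graph K V X) S) V K}"
      have "prb (map_pmf (\<lambda>G. survivors \<beta> \<eta> G S) (planted K V)) {W. \<not> ?good W} \<le>
          prb (random_subset (1/2) (pairs S - pairs K)) ?B + 3 * \<theta>1 ^ b"
        unfolding planted_split[OF V S] map_bind_pmf map_pmf_comp
      proof (rule prb_bind_le)
        fix X assume X: "X \<in> set_pmf (random_subset (1/2) (pairs S - pairs K))" and "X \<notin> ?B"
        then show "prb (map_pmf (\<lambda>Y. survivors \<beta> \<eta> (clique_graph K V (X \<union> Y)) S)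
            (random_subset (1/2) (pairs V - pairs K - pairs S))) {W. \<not> ?good W} \<le> 3 * \<theta>1 ^ b"
          using surv[OF adm12(1) S samp(1) set_random_subset[OF X] _ b'] by (simp add: prb_map)
      qed (use e1 in auto)
      then show "prb (map_pmf (\<lambda>G. survivors \<beta> \<eta> G S) (planted K V)) {W. \<not> ?good W} \<le> 6 * \<theta> ^ b"
        using core[OF adm12(2) S samp(2) b'] p1 by linarith
    qed (use \<theta> in auto)
    also have "\<dots> \<le> 10 * \<theta> ^ b"
      using sample by simp
    also have "\<theta> ^ b = exp (- c * real b)"
      unfolding c(2) by (simp add: exp_of_nat_mult[symmetric] mult.commute)
    also have "\<dots> \<le> exp (- c * N powr (1/8))"
      using b c by simp
    finally show "prb (step \<alpha> \<beta> \<eta> K V) {W. \<not> ?good W} \<le> exp (- (real (card (V - K)) powr (1/10)))"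
      using N0 by (simp add: N_def)
  qed
qed

section \<open>Phases 2 and 3\<close>

text \<open>Greedy choice of the next vertex. Existence is what makes the set of outputs equal to
  \<open>{K}\<close> rather than merely contained in it.\<close>

lemma ex_largest_degree:
  assumes "finite (verts G)"
  shows "\<exists>A. largest_degree m G A"
proof (induction m)
  case 0
  have "largest_degree 0 G {}" by (simp add: largest_degree_def)
  then show ?case by blast
next
  case (Suc m)
  then obtain A where A: "largest_degree m G A" by blast
  have finA: "finite A" using A assms finite_subset by (auto simp: largest_degree_def)
  show ?case
  proof (cases "A = verts G")
    case True
    then have "largest_degree (Suc m) G A" using A by (auto simp: largest_degree_def)
    then show ?thesis by blast
  next
    case False
    then have ne: "verts G - A \<noteq> {}" using A by (auto simp: largest_degree_def)
    define M where "M = Max (deg_into G (verts G) ` (verts G - A))"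
    have "M \<in> deg_into G (verts G) ` (verts G - A)"
      unfolding M_def using ne assms by (intro Max_in) auto
    then obtain u where u: "u \<in> verts G - A" "M = deg_into G (verts G) u" by auto
    have Max: "deg_into G (verts G) v \<le> deg_into G (verts G) u" if "v \<in> verts G - A" for v
      unfolding u(2)[symmetric] M_def using that assms by (intro Max_ge) auto
    have "card A < card (verts G)"
      using u A assms by (intro psubset_card_mono) (auto simp: largest_degree_def)
    then have "card (insert u A) = min (Suc m) (card (verts G))"
      using A u finA by (auto simp: largest_degree_def)
    then have "largest_degree (Suc m) G (insert u A)"
      using A u Max by (auto simp: largest_degree_def)
    then show ?thesis by blast
  qed
qed

text \<open>With the quantifier over \<open>T\<close> this is a property of the input graph alone,
  whatever its correlation with the result of phase 1. The equivalence covers every way of breaking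
  ties and also the existence of an output.\<close>

definition phase3_good :: "nat \<Rightarrow> 'a set \<Rightarrow> 'a ugraph \<Rightarrow> bool" where
  "phase3_good s K G \<longleftrightarrow> (\<forall>T. T \<subseteq> K \<longrightarrow> s \<le> card T \<longrightarrow>
     (\<forall>A. largest_degree (card K) (phase3_graph G T) A \<longleftrightarrow> A = K))"

text \<open>\<open>m\<close> stands for the rounded \<rho>^t k. Phase 2 is asked only for a large
  piece of the clique, since phase 3 completes any such piece.\<close>

definition phase2_good :: "nat \<Rightarrow> 'a set \<Rightarrow> 'a ugraph \<Rightarrow> bool" where
  "phase2_good m K H \<longleftrightarrow> (\<forall>K'. largest_degree m H K' \<longrightarrow>
     phase2 m H K' \<subseteq> K \<and> m \<le> card (phase2 m H K'))"

lemma outputs_eq: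
  assumes "phase2_good m K H" "phase3_good s K G" "s \<le> m" "finite (verts H)"
  shows "outputs (card K) m G H = {K}"
proof -
  obtain K' where K': "largest_degree m H K'"
    using ex_largest_degree[OF assms(4)] by blast
  have "largest_degree (card K) (phase3_graph G (phase2 m H L)) A \<longleftrightarrow> A = K" if "largest_degree m H L" for L A
  proof -
    have "phase2 m H L \<subseteq> K" "s \<le> card (phase2 m H L)"
      using assms(1,3) that by (auto simp: phase2_good_def)
    then show ?thesis using assms(2) by (simp add: phase3_good_def)
  qed
  then show ?thesis unfolding outputs_def using K' by auto
qed

text \<open>Fewer than \<open>s\<close> outsiders are adjacent to all of \<open>T\<close>, since
  \<open>s\<close> of them would form with \<open>s\<close> members of \<open>T\<close> a complete
  bipartite graph excluded by \<open>common\<close>. With k for \<open>card K\<close>, an outsider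
  in the final graph thus has degree below 3k/4 + s \<le> k - 1, and a clique vertex at least k -
  1.\<close>

lemma phase3_goodI:
  assumes V: "finite V" and K: "K \<subseteq> V" and E: "E \<subseteq> pairs V - pairs K"
    and deg: "\<And>v. v \<in> V - K \<Longrightarrow> card (E \<inter> star v K) < 3 * real (card K) / 4"
    and common: "\<And>T L. T \<subseteq> K \<Longrightarrow> L \<subseteq> V - K \<Longrightarrow> card T = s \<Longrightarrow> card L = s \<Longrightarrow> \<not> (\<Union>v\<in>L. star v T) \<subseteq> E"
    and s: "real s \<le> real (card K) / 4 - 1"
  shows "phase3_good s K (clique_graph K V E)"
  unfolding phase3_good_def
proof (intro allI impI)
  fix T A assume T: "T \<subseteq> K" "s \<le> card T"
  let ?G = "clique_graph K V E"
  let ?G' = "phase3_graph ?G T"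
  define C where "C = {v \<in> V - K. \<forall>u\<in>T. {u, v} \<in> E}"
  have finK: "finite K" using K V finite_subset by blast
  have KV: "K \<inter> V = K" using K by auto
  have finC: "finite C" using V by (auto simp: C_def)
  have C: "card C < s"
  proof (rule ccontr)
    assume "\<not> card C < s"
    then obtain L where L: "L \<subseteq> C" "card L = s" using finC by (metis not_less obtain_subset_with_card_n)
    obtain T' where T': "T' \<subseteq> T" "card T' = s" using T(2) obtain_subset_with_card_n by metis
    have "(\<Union>v\<in>L. star v T') \<subseteq> E"
      using L T' by (auto simp: star_def C_def)
    moreover have "\<not> (\<Union>v\<in>L. star v T') \<subseteq> E"
      using L T' T by (intro common) (auto simp: C_def)
    ultimately show False by simp
  qed
  have edge: "{u, v} \<in> pairs K \<union> E \<longleftrightarrow> {u, v} \<in> E" if "v \<notin> K" for u v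
    using that by (auto simp: pair_mem_pairs)
  have vG': "verts ?G' = K \<union> C"
  proof -
    have "v \<in> T \<or> (\<forall>u\<in>T. {u, v} \<in> pairs K)" if "v \<in> K" for v
      using that T by (auto simp: pair_mem_pairs)
    then show ?thesis
      using T K by (auto simp: phase3_graph_def induced_def edges_clique_graph KV C_def pair_mem_pairs)
  qed
  have eG': "edges ?G' = {e \<in> pairs K \<union> E. e \<subseteq> K \<union> C}"
  proof -
    have "edges ?G' = {e \<in> edges ?G. e \<subseteq> T \<union> {v \<in> V. \<forall>u\<in>T. {u, v} \<in> edges ?G}}"
      by (simp add: phase3_graph_def induced_def)
    also have "\<dots> = {e \<in> edges ?G. e \<subseteq> V \<inter> (T \<union> {v \<in> V. \<forall>u\<in>T. {u, v} \<in> edges ?G})}"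
      using T K by auto
    also have "V \<inter> (T \<union> {v \<in> V. \<forall>u\<in>T. {u, v} \<in> edges ?G}) = verts ?G'"
      by (simp add: phase3_graph_def induced_def)
    finally show ?thesis unfolding vG' by (simp add: edges_clique_graph KV)
  qed
  have degK: "card K - 1 \<le> deg_into ?G' (verts ?G') u" if "u \<in> K" for u
  proof -
    have "card (K - {u}) \<le> deg_into ?G' (verts ?G') u"
      unfolding deg_into_def vG' eG' using that finK finC by (intro card_mono) (auto simp: pair_mem_pairs)
    then show ?thesis using that finK by simp
  qed
  have degC: "real (deg_into ?G' (verts ?G') v) < real (card K) - 1" if v: "v \<in> C" for v
  proof -
    have vK: "v \<in> V - K" using v by (simp add: C_def)
    have "deg_into ?G' (verts ?G') v \<le> card ({u \<in> K. {u, v} \<in> E} \<union> C)"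
      unfolding deg_into_def vG' eG' using finK finC vK edge by (intro card_mono) auto
    also have "\<dots> \<le> card {u \<in> K. {u, v} \<in> E} + card C" by (rule card_Un_le)
    also have "card {u \<in> K. {u, v} \<in> E} = card (E \<inter> star v K)"
      using E by (subst card_star_Int[of _ V]) auto
    finally have "real (deg_into ?G' (verts ?G') v) \<le> card (E \<inter> star v K) + real (card C)"
      by simp
    then show ?thesis using deg[OF vK] C s by linarith
  qed
  have CK: "C \<inter> K = {}" by (auto simp: C_def)
  show "largest_degree (card K) ?G' A \<longleftrightarrow> A = K"
  proof
    assume A: "largest_degree (card K) ?G' A"
    have cA: "A \<subseteq> K \<union> C" "card A = card K"
      using A finK finC CK by (auto simp: largest_degree_def vG' card_Un_disjoint Int_commute)
    have finA: "finite A" using cA finK finC finite_subset by blast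
    show "A = K"
    proof (rule ccontr)
      assume "A \<noteq> K"
      then have "\<not> A \<subseteq> K" "\<not> K \<subseteq> A"
        using cA(2) finK finA by (metis card_subset_eq)+
      then obtain u v where uv: "v \<in> A" "v \<in> C" "u \<in> K" "u \<notin> A"
        using cA(1) by auto
      have "deg_into ?G' (verts ?G') u \<le> deg_into ?G' (verts ?G') v"
        using A uv by (auto simp: largest_degree_def vG')
      then show False
        using degK[OF uv(3)] degC[OF uv(2)] by linarith
    qed
  next
    assume "A = K"
    moreover have "deg_into ?G' (verts ?G') v \<le> deg_into ?G' (verts ?G') u" if "u \<in> K" "v \<in> verts ?G' - K" for u v
    proof -
      have "v \<in> C" using that vG' by auto
      then show ?thesis using degK[OF that(1)] degC[of v] by linarith
    qed
    ultimately show "largest_degree (card K) ?G' A"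
      using finK finC CK by (auto simp: largest_degree_def vG' card_Un_disjoint Int_commute)
  qed
qed

lemma prb_binomial_pmf_card_star:
  assumes "finite V" "finite T" "star v T \<subseteq> pairs V - pairs K" "v \<notin> T"
  shows "prb (random_subset (1/2) (pairs V - pairs K)) {E. Q (card (E \<inter> star v T))} =
    prb (binomial_pmf (card T) (1/2)) {j. Q j}"
  using prb_random_subset_card[of "pairs V - pairs K" "star v T" Q] assms by (simp add: card_star)

text \<open>Two \<open>s\<close>-sets span \<open>s * s\<close> random pairs, and at most
  \<open>card V ^ (2 * s)\<close> choices of them exist, so the union bound wins once
  \<open>s\<close> is large against log (\<open>card V\<close>). The other summand is Hoeffding's
  bound for a deviation of k/4 among k trials, where 2 (k/4)^2 / k = k/8.\<close>

lemma phase3_prb: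
  assumes V: "finite V" and K: "K \<subseteq> V" and s: "real s \<le> real (card K) / 4 - 1"
  shows "prb (planted K V) {G. \<not> phase3_good s K G} \<le>
    real (card V) * exp (- real (card K) / 8) + real (card V) ^ (2 * s) * (1/2) ^ (s * s)"
proof -
  let ?R = "random_subset (1/2) (pairs V - pairs K)"
  have finK: "finite K" using K V finite_subset by blast
  define B1 where "B1 = (\<Union>v\<in>V - K. {E. card (E \<inter> star v K) \<ge> 3 * real (card K) / 4})"
  define I where "I = {T. T \<subseteq> K \<and> card T = s} \<times> {L. L \<subseteq> V - K \<and> card L = s}"
  define B2 where "B2 = (\<Union>(T, L)\<in>I. {E. (\<Union>v\<in>L. star v T) \<subseteq> E})"
  have finI: "finite I" unfolding I_def using finK V by auto
  have "prb ?R B1 \<le> card (V - K) * exp (- real (card K) / 8)"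
    unfolding B1_def
  proof (rule prb_UN_le)
    fix v assume v: "v \<in> V - K"
    have "star v K \<subseteq> pairs V - pairs K"
      using v K by (intro star_subset) auto
    then have "prb ?R {E. card (E \<inter> star v K) \<ge> 3 * real (card K) / 4} =
        prb (binomial_pmf (card K) (1/2)) {j. real j \<ge> card K / 2 + card K / 4}"
      using v K V finK by (subst prb_binomial_pmf_card_star[where Q = "\<lambda>j. 3 * real (card K) / 4 \<le> real j"])
        auto
    also have "\<dots> \<le> exp (- 2 * (card K / 4)\<^sup>2 / card K)"
      by (rule binomial_half_ge_le) simp
    also have "\<dots> \<le> exp (- real (card K) / 8)"
      by (simp add: power2_eq_square)
    finally show "prb ?R {E. card (E \<inter> star v K) \<ge> 3 * real (card K) / 4} \<le> exp (- real (card K) / 8)" .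
  qed (use V in auto)
  also have "\<dots> \<le> card V * exp (- real (card K) / 8)"
    using V by (intro mult_right_mono) (auto intro: card_mono)
  finally have 1: "prb ?R B1 \<le> card V * exp (- real (card K) / 8)" .
  have "prb ?R B2 \<le> card I * (1/2) ^ (s * s)"
    unfolding B2_def
  proof (rule prb_UN_le[OF finI])
    fix i assume i: "i \<in> I"
    obtain T L where i': "i = (T, L)" by (cases i)
    have TL: "T \<subseteq> K" "card T = s" "L \<subseteq> V - K" "card L = s" using i unfolding i' I_def by auto
    have fin: "finite T" "finite L" using TL finK V finite_subset by blast+
    have "card (\<Union>v\<in>L. star v T) = (\<Sum>v\<in>L. card (star v T))"
    proof (rule card_UN_disjoint)
      show "\<forall>v\<in>L. \<forall>w\<in>L. v \<noteq> w \<longrightarrow> star v T \<inter> star w T = {}"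
        using TL by (intro ballI impI star_disjoint) auto
    qed (use fin in auto)
    also have "\<dots> = (\<Sum>v\<in>L. s)"
      using TL by (intro sum.cong refl) (subst card_star, auto)
    finally have c: "card (\<Union>v\<in>L. star v T) = s * s" using TL by simp
    have "(\<Union>v\<in>L. star v T) \<subseteq> pairs V - pairs K"
    proof (rule UN_least)
      show "star v T \<subseteq> pairs V - pairs K" if "v \<in> L" for v
        using that TL K by (intro star_subset) auto
    qed
    then have "prb ?R {E. (\<Union>v\<in>L. star v T) \<subseteq> E} = (1/2) ^ (s * s)"
      using V by (subst prb_random_subset_superset) (auto simp: c)
    then show "prb ?R (case i of (T, L) \<Rightarrow> {E. (\<Union>v\<in>L. star v T) \<subseteq> E}) \<le> (1/2) ^ (s * s)"
      unfolding i' by simp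
  qed
  also have "card I \<le> card V ^ (2 * s)"
  proof -
    have pow: "card {T. T \<subseteq> A \<and> card T = s} \<le> card V ^ s" if "A \<subseteq> V" for A
    proof -
      have "finite A" using that V finite_subset by blast
      then have "card {T. T \<subseteq> A \<and> card T = s} = card A choose s" by (rule n_subsets)
      also have "\<dots> \<le> card V choose s" using that V by (intro binomial_right_mono card_mono)
      also have "\<dots> \<le> (card V choose s) * fact s" by simp
      also have "\<dots> \<le> card V ^ s" by (rule binomial_fact_pow)
      finally show ?thesis .
    qed
    have "card I = card {T. T \<subseteq> K \<and> card T = s} * card {L. L \<subseteq> V - K \<and> card L = s}"
      unfolding I_def by (rule card_cartesian_product)
    also have "\<dots> \<le> card V ^ s * card V ^ s"
      using K by (intro mult_le_mono pow) auto
    finally show ?thesis by (simp add: mult_2 power_add)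
  qed
  finally have 2: "prb ?R B2 \<le> real (card V) ^ (2 * s) * (1/2) ^ (s * s)"
    by (simp add: mult_right_mono)
  have "prb (planted K V) {G. \<not> phase3_good s K G} = prb ?R {E. \<not> phase3_good s K (clique_graph K V E)}"
    by (simp add: planted_def prb_map)
  also have "\<dots> \<le> prb ?R (B1 \<union> B2)"
  proof (rule prb_mono)
    fix E assume E: "E \<in> set_pmf ?R" "E \<in> {E. \<not> phase3_good s K (clique_graph K V E)}"
    show "E \<in> B1 \<union> B2"
    proof (rule ccontr)
      assume "E \<notin> B1 \<union> B2"
      then have "phase3_good s K (clique_graph K V E)"
        by (intro phase3_goodI[OF V K set_random_subset[OF E(1)] _ _ s])
          (auto simp: B1_def B2_def I_def not_le)
      then show False using E by simp
    qed
  qed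
  finally show ?thesis using prb_union_le[of ?R B1 B2] 1 2 by linarith
qed

text \<open>The budget is counted in sixteenths of \<open>m\<close>: fewer than 9 for the neighbours
  of \<open>v\<close> in an upper level set chosen without the edges at \<open>v\<close>, and fewer
  than 1 for each of two degree levels. The total stays below 11, under the 12 of the threshold
  3/4.\<close>

lemma phase2_goodI:
  assumes V: "finite V" and E: "E \<subseteq> pairs V - pairs K" and m: "m \<le> card (V \<inter> K)" "4 \<le> m"
    and sep: "\<And>u v. u \<in> V \<inter> K \<Longrightarrow> v \<in> V - K \<Longrightarrow>
      deg_into (clique_graph K V E) V v < deg_into (clique_graph K V E) V u"
    and spread: "\<And>v x. v \<in> V - K \<Longrightarrow> card {u \<in> V \<inter> K. card (E \<inter> star u (V - K - {v})) = x} < real m / 16"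
    and half: "\<And>v x. v \<in> V - K \<Longrightarrow> card {u \<in> V \<inter> K. x < card (E \<inter> star u (V - K - {v}))} \<le> m \<Longrightarrow>
      card (E \<inter> star v {u \<in> V \<inter> K. x < card (E \<inter> star u (V - K - {v}))}) < 9 * real m / 16"
  shows "phase2_good m K (clique_graph K V E)"
  unfolding phase2_good_def
proof (intro allI impI)
  let ?H = "clique_graph K V E"
  fix K' assume K': "largest_degree m ?H K'"
  have "card (V \<inter> K) \<le> card V" using V by (intro card_mono) auto
  then have K'V: "K' \<subseteq> V" and cK': "card K' = m"
    and top: "\<And>u v. u \<in> K' \<Longrightarrow> v \<in> V - K' \<Longrightarrow> deg_into ?H V v \<le> deg_into ?H V u"
    using K' m by (auto simp: largest_degree_def)
  have finK': "finite K'" using K'V V finite_subset by blast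
  have K'K: "K' \<subseteq> K"
  proof
    fix v assume v: "v \<in> K'"
    show "v \<in> K"
    proof (rule ccontr)
      assume vK: "v \<notin> K"
      \<comment> \<open>By \<open>sep\<close>, an outsider among the top \<open>m\<close> would
        bring the whole current clique along, which alone has at least \<open>m\<close>
        vertices.\<close>
      have "V \<inter> K \<subseteq> K'"
      proof
        fix u assume u: "u \<in> V \<inter> K"
        show "u \<in> K'"
          using top[OF v, of u] sep[OF u, of v] u v vK K'V by force
      qed
      then have "insert v (V \<inter> K) \<subseteq> K'" using v by auto
      then have "card (insert v (V \<inter> K)) \<le> m" using finK' cK' card_mono by metis
      then show False using vK V m by simp
    qed
  qed
  \<comment> \<open>A member of the clique \<open>K'\<close> has \<open>m - 1\<close> neighbours in
    it, and this is at least 3m/4 for m \<ge> 4.\<close>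
  have "K' \<subseteq> phase2 m ?H K'"
  proof
    fix u assume u: "u \<in> K'"
    have "card (K' - {u}) \<le> deg_into ?H K' u"
      unfolding deg_into_def using u K'K K'V finK'
      by (intro card_mono) (auto simp: edges_clique_graph pair_mem_pairs)
    then have "real m - 1 \<le> deg_into ?H K' u" using u finK' cK' m by simp
    then show "u \<in> phase2 m ?H K'"
      using u K'V m by (auto simp: phase2_def)
  qed
  moreover have "finite (phase2 m ?H K')" using V by (auto simp: phase2_def)
  ultimately have "m \<le> card (phase2 m ?H K')"
    using card_mono cK' by metis
  moreover have "phase2 m ?H K' \<subseteq> K"
  proof
    fix v assume v: "v \<in> phase2 m ?H K'"
    show "v \<in> K"
    proof (rule ccontr)
      assume "v \<notin> K"
      then have vVK: "v \<in> V - K" using v by (auto simp: phase2_def)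
      define g where "g u = card (E \<inter> star u (V - K))" for u
      define d where "d u = card (E \<inter> star u (V - K - {v}))" for u
      have gd: "d u \<le> g u" "g u \<le> Suc (d u)" for u
      proof -
        have gc: "g u = card {w \<in> V - K. {w, u} \<in> E}" and dc: "d u = card {w \<in> V - K - {v}. {w, u} \<in> E}"
          unfolding g_def d_def using E by (intro card_star_Int[of _ V]; blast)+
        show "d u \<le> g u" unfolding gc dc using V by (intro card_mono) auto
        have "g u \<le> card (insert v {w \<in> V - K - {v}. {w, u} \<in> E})"
          unfolding gc using V by (intro card_mono) auto
        also have "\<dots> \<le> Suc (d u)" unfolding dc using V by (simp add: card_insert_if)
        finally show "g u \<le> Suc (d u)" .
      qed
      have deg: "deg_into ?H V u = card (V \<inter> K) - 1 + g u" if "u \<in> V \<inter> K" for u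
        unfolding g_def using that V E by (subst deg_into_inside) auto
      have "K' \<noteq> {}" using cK' m by auto
      define x where "x = Min (g ` K')"
      have "x \<in> g ` K'" unfolding x_def using finK' \<open>K' \<noteq> {}\<close> by (intro Min_in) auto
      then obtain u0 where u0: "u0 \<in> K'" "g u0 = x" by auto
      have x_le: "x \<le> g u" if "u \<in> K'" for u
        unfolding x_def using finK' that by (intro Min_le) auto
      \<comment> \<open>\<open>x\<close> is the smallest outside degree \<open>g\<close> in
        \<open>K'\<close>, and \<open>d\<close> ignores \<open>v\<close>. As \<open>d\<close> and
        \<open>g\<close> differ by at most 1, \<open>K'\<close> lies between \<open>A\<close> and
        \<open>A\<close> enlarged by the levels \<open>x\<close> and \<open>x - 1\<close> of
        \<open>d\<close>.\<close>
      define A where "A = {u \<in> V \<inter> K. x < d u}"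
      have "A \<subseteq> K'"
      proof
        fix u assume u: "u \<in> A"
        show "u \<in> K'"
        proof (rule ccontr)
          assume "u \<notin> K'"
          then have "deg_into ?H V u \<le> deg_into ?H V u0"
            using u u0 by (intro top) (auto simp: A_def)
          moreover have "u0 \<in> V \<inter> K" using u0 K'K K'V by auto
          ultimately have "g u \<le> g u0"
            using deg[of u] deg[of u0] u by (auto simp: A_def)
          then show False using gd(1)[of u] u u0 by (auto simp: A_def)
        qed
      qed
      then have "card A \<le> m" using finK' cK' card_mono by metis
      then have A: "card (E \<inter> star v A) < 9 * real m / 16"
        using half[OF vVK, of x] by (simp add: A_def d_def)
      have sub: "{u \<in> K'. {u, v} \<in> E} \<subseteq> {u \<in> A. {u, v} \<in> E} \<union> {u \<in> V \<inter> K. d u = x} \<union> {u \<in> V \<inter> K. d u = x - 1}"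
      proof
        fix u assume u: "u \<in> {u \<in> K'. {u, v} \<in> E}"
        then have "x \<le> Suc (d u)" "u \<in> V \<inter> K"
          using x_le[of u] gd(2)[of u] K'K K'V by auto
        then show "u \<in> {u \<in> A. {u, v} \<in> E} \<union> {u \<in> V \<inter> K. d u = x} \<union> {u \<in> V \<inter> K. d u = x - 1}"
          using u by (auto simp: A_def)
      qed
      have finA: "finite A" using V by (simp add: A_def)
      have "deg_into ?H K' v = card {u \<in> K'. {u, v} \<in> E}"
        unfolding deg_into_def edges_clique_graph using \<open>v \<notin> K\<close> by (simp add: pair_mem_pairs)
      also have "\<dots> \<le> card ({u \<in> A. {u, v} \<in> E} \<union> {u \<in> V \<inter> K. d u = x} \<union> {u \<in> V \<inter> K. d u = x - 1})"
        using sub V finA by (intro card_mono) auto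
      also have "\<dots> \<le> card {u \<in> A. {u, v} \<in> E} + card {u \<in> V \<inter> K. d u = x} + card {u \<in> V \<inter> K. d u = x - 1}"
        by (intro order_trans[OF card_Un_le] add_right_mono card_Un_le)
      also have "card {u \<in> A. {u, v} \<in> E} = card (E \<inter> star v A)"
        using E by (subst card_star_Int[of _ V]) auto
      finally have "real (deg_into ?H K' v) \<le> card (E \<inter> star v A) + real (card {u \<in> V \<inter> K. d u = x}) + real (card {u \<in> V \<inter> K. d u = x - 1})"
        by simp
      also have "\<dots> < 9 * real m / 16 + real m / 16 + real m / 16"
        unfolding d_def by (intro add_strict_mono A spread vVK)
      also have "\<dots> \<le> 3 * m / 4" by simp
      finally show False using v by (simp add: phase2_def)
    qed
  qed
  ultimately show "phase2 m ?H K' \<subseteq> K \<and> m \<le> card (phase2 m ?H K')" by simp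
qed


lemma star_Diff_self: "star v (T - {v}) = star v T"
  by (simp add: star_def)

text \<open>In expectation clique vertices lead by about \<kappa>/2, so errors below \<kappa>/8 on
  either side (\<open>A1\<close>, \<open>A2\<close>) do not close the gap. \<open>A3\<close> limits
  the size of degree levels through binomial point masses, and \<open>A4\<close> the edges from
  \<open>v\<close> into an upper level set. Outside degrees never exceed
  \<open>card (V - K)\<close>, which makes the union over levels finite.\<close>

lemma phase2_prb:
  fixes m b :: nat
  assumes V: "finite V" and m: "m \<le> card (V \<inter> K)" "32 \<le> m" and N2: "2 \<le> card (V - K)" and b: "real b \<le> m / 32"
  defines "N \<equiv> real (card (V - K))" and "\<kappa> \<equiv> real (card (V \<inter> K))"
  shows "prb (planted K V) {H. \<not> phase2_good m K H} \<le>
    (N + \<kappa>) * exp (- \<kappa>\<^sup>2 / (32 * (N + \<kappa>))) +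
    N * (N + 1) * ((64 * \<kappa> / (m * sqrt (N - 1))) ^ b + exp (- real m / 128))"
proof -
  define P where "P = pairs V - pairs K"
  let ?R = "random_subset (1/2) P"
  have finP: "finite P" using V by (simp add: P_def)
  have \<kappa>: "\<kappa> \<ge> 32" and N: "N \<ge> 2" using m N2 by (auto simp: \<kappa>_def N_def)
  have cV: "real (card V) = N + \<kappa>"
    using card_Diff_plus_Int[OF V, of K] by (simp add: N_def \<kappa>_def)
  \<comment> \<open>Hoeffding's exponent for a deviation of \<kappa>/8: twice its square is
    \<open>\<kappa>\<^sup>2 / 32\<close>, and all stars involved have at most
    \<open>N + \<kappa>\<close> pairs.\<close>
  define e where "e = exp (- \<kappa>\<^sup>2 / (32 * (N + \<kappa>)))"
  define A1 where "A1 = (\<Union>v\<in>V - K. {E. card (E \<inter> star v V) \<ge> (N + \<kappa> - 1) / 2 + \<kappa> / 8})"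
  define A2 where "A2 = (\<Union>u\<in>V \<inter> K. {E. card (E \<inter> star u (V - K)) \<le> N / 2 - \<kappa> / 8})"
  define D where "D E v x = {u \<in> V \<inter> K. card (E \<inter> star u (V - K - {v})) = x}" for E and v :: 'a and x :: nat
  define U where "U E v x = {u \<in> V \<inter> K. x < card (E \<inter> star u (V - K - {v}))}" for E and v :: 'a and x :: nat
  define I where "I = (V - K) \<times> {..card (V - K)}"
  define A3 where "A3 = (\<Union>(v, x)\<in>I. {E. real m / 16 \<le> card (D E v x)})"
  define A4 where "A4 = (\<Union>(v, x)\<in>I. {E. card (U E v x) \<le> m \<and> 9 * real m / 16 \<le> card (E \<inter> star v (U E v x))})"
  have finI: "finite I" using V by (simp add: I_def)
  have cI: "real (card I) = N * (N + 1)"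
    by (simp add: I_def card_cartesian_product N_def algebra_simps)
  have e_ge: "exp (- 2 * (\<kappa> / 8)\<^sup>2 / n) \<le> e" if "0 < n" "n \<le> N + \<kappa>" for n
  proof -
    have "\<kappa>\<^sup>2 / (32 * (N + \<kappa>)) \<le> \<kappa>\<^sup>2 / (32 * n)"
      using that by (intro divide_left_mono) auto
    then show ?thesis by (simp add: e_def power_divide)
  qed
  have "prb ?R A1 \<le> card (V - K) * e"
    unfolding A1_def
  proof (rule prb_UN_le)
    fix v assume v: "v \<in> V - K"
    have "prb ?R {E. card (E \<inter> star v (V - {v})) \<ge> (N + \<kappa> - 1) / 2 + \<kappa> / 8} =
        prb (binomial_pmf (card (V - {v})) (1/2)) {j. real j \<ge> (N + \<kappa> - 1) / 2 + \<kappa> / 8}"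
      unfolding P_def using v V
      by (intro prb_binomial_pmf_card_star[where Q = "\<lambda>j. (N + \<kappa> - 1) / 2 + \<kappa> / 8 \<le> real j"] star_subset) auto
    also have c: "real (card (V - {v})) = N + \<kappa> - 1"
      using v V cV card_Suc_Diff1[of V v] by simp
    have "prb (binomial_pmf (card (V - {v})) (1/2)) {j. real j \<ge> (N + \<kappa> - 1) / 2 + \<kappa> / 8} \<le>
        exp (- 2 * (\<kappa> / 8)\<^sup>2 / card (V - {v}))"
      using binomial_half_ge_le[of "\<kappa> / 8" "card (V - {v})"] \<kappa> unfolding c by simp
    also have "\<dots> \<le> e"
      unfolding c using N \<kappa> by (intro e_ge) auto
    finally show "prb ?R {E. card (E \<inter> star v V) \<ge> (N + \<kappa> - 1) / 2 + \<kappa> / 8} \<le> e"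
      by (simp add: star_Diff_self)
  qed (use V in auto)
  moreover have "prb ?R A2 \<le> card (V \<inter> K) * e"
    unfolding A2_def
  proof (rule prb_UN_le)
    fix u assume u: "u \<in> V \<inter> K"
    have "prb ?R {E. card (E \<inter> star u (V - K)) \<le> N / 2 - \<kappa> / 8} =
        prb (binomial_pmf (card (V - K)) (1/2)) {j. real j \<le> N / 2 - \<kappa> / 8}"
      unfolding P_def using u V
      by (intro prb_binomial_pmf_card_star[where Q = "\<lambda>j. real j \<le> N / 2 - \<kappa> / 8"] star_subset) auto
    also have "\<dots> \<le> exp (- 2 * (\<kappa> / 8)\<^sup>2 / N)"
      unfolding N_def using \<kappa> by (intro binomial_half_le_le) auto
    also have "\<dots> \<le> e"
      using N \<kappa> by (intro e_ge) auto
    finally show "prb ?R {E. card (E \<inter> star u (V - K)) \<le> N / 2 - \<kappa> / 8} \<le> e" .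
  qed (use V in auto)
  ultimately have 12: "prb ?R A1 + prb ?R A2 \<le> (N + \<kappa>) * e"
    unfolding N_def \<kappa>_def by (simp add: algebra_simps)
  have "prb ?R A3 \<le> card I * (64 * \<kappa> / (m * sqrt (N - 1))) ^ b"
    unfolding A3_def
  proof (rule prb_UN_le[OF finI])
    fix i assume i: "i \<in> I"
    obtain v x where i': "i = (v, x)" by (cases i)
    have v: "v \<in> V - K" using i by (simp add: i' I_def)
    define q where "q = 2 / sqrt (N - 1)"
    have q: "0 < q" using N by (simp add: q_def)
    have c: "real (card (V - K - {v})) = N - 1"
      using v V card_Suc_Diff1[of "V - K" v] by (simp add: N_def)
    \<comment> \<open>At least m/16 vertices share a level in the bad event, and a block of b \<le>
      m/32 is subtracted. The remaining m/32, together with the 2 in \<open>q\<close>, produces the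
      64 of the bound.\<close>
    define m' where "m' = nat \<lceil>real m / 16\<rceil>"
    have m': "real m / 32 \<le> real m' - real b" and bm': "b < m'"
      using b m(2) unfolding m'_def by linarith+
    have "prb ?R {E. m' \<le> card (D E v x \<inter> (V \<inter> K))} \<le> (card (V \<inter> K) * q / (real m' - real b)) ^ b"
    proof (rule prb_card_ge_le_power[OF _ _ bm'])
      fix B assume B: "B \<subseteq> V \<inter> K" "card B = b"
      have "prb ?R {E. B \<subseteq> D E v x} = prb ?R {E. \<forall>u\<in>B. card (E \<inter> star u (V - K - {v})) = x}"
        using B by (intro arg_cong2[of _ _ _ _ prb] refl) (auto simp: D_def)
      also have "\<dots> = prb (binomial_pmf (card (V - K - {v})) (1/2)) {j. j = x} ^ card B"
      proof (rule prb_stars[OF finP])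
        show "star u (V - K - {v}) \<subseteq> P" if "u \<in> B" for u
          unfolding P_def using B that by (intro star_subset) auto
      qed (use B V in \<open>auto intro: finite_subset\<close>)
      also have "\<dots> \<le> q ^ card B"
      proof (rule power_mono)
        have "card (V - K - {v}) > 0" using c N by (metis diff_gt_0_iff_gt less_le_trans of_nat_0_less_iff one_less_numeral_iff semiring_norm(76))
        then show "prb (binomial_pmf (card (V - K - {v})) (1/2)) {j. j = x} \<le> q"
          using binomial_half_point_le[of "card (V - K - {v})" x] unfolding q_def c by simp
      qed auto
      finally show "prb ?R {E. B \<subseteq> D E v x} \<le> q ^ b" using B by simp
    qed (use V q in auto)
    also have "\<dots> \<le> (64 * \<kappa> / (m * sqrt (N - 1))) ^ b"
    proof (rule power_mono)
      have "card (V \<inter> K) * q / (real m' - real b) \<le> \<kappa> * q / (real m / 32)"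
        unfolding \<kappa>_def[symmetric] using m' m q \<kappa> by (intro divide_left_mono mult_pos_pos) auto
      then show "card (V \<inter> K) * q / (real m' - real b) \<le> 64 * \<kappa> / (m * sqrt (N - 1))"
        by (simp add: q_def mult_ac)
    qed (use m' bm' q in auto)
    finally have "prb ?R {E. m' \<le> card (D E v x \<inter> (V \<inter> K))} \<le> (64 * \<kappa> / (m * sqrt (N - 1))) ^ b" .
    moreover have "D E v x \<inter> (V \<inter> K) = D E v x" for E by (auto simp: D_def)
    moreover have "m' \<le> n \<longleftrightarrow> real m / 16 \<le> real n" for n
      unfolding m'_def by (simp add: nat_le_iff ceiling_le_iff)
    ultimately show "prb ?R (case i of (v, x) \<Rightarrow> {E. real m / 16 \<le> card (D E v x)}) \<le> (64 * \<kappa> / (m * sqrt (N - 1))) ^ b"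
      by (simp add: i')
  qed
  moreover have "prb ?R A4 \<le> card I * exp (- real m / 128)"
    unfolding A4_def
  proof (rule prb_UN_le[OF finI])
    fix i assume i: "i \<in> I"
    obtain v x where i': "i = (v, x)" by (cases i)
    have v: "v \<in> V - K" using i by (simp add: i' I_def)
    \<comment> \<open>The pairs from \<open>v\<close> to the clique are drawn last. \<open>U\<close>
      reads only stars of clique vertices into \<open>V - K - {v}\<close>, so it is already fixed
      and the pairs from \<open>v\<close> into it are fresh.\<close>
    define S where "S = star v (V \<inter> K)"
    have SP: "S \<subseteq> P" unfolding S_def P_def using v by (intro star_subset) auto
    have PS: "P - (P - S) = S" using SP by auto
    have "prb ?R {E. card (U E v x) \<le> m \<and> 9 * real m / 16 \<le> card (E \<inter> star v (U E v x))} \<le> exp (- real m / 128)"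
      unfolding random_subset_split[of P "P - S", OF finP Diff_subset] PS
    proof (rule prb_bind_le')
      fix X assume "X \<in> set_pmf (random_subset (1/2) (P - S))"
      then have X: "X \<subseteq> P - S" by (rule set_random_subset)
      define T where "T = U X v x"
      have T: "T \<subseteq> V \<inter> K" by (auto simp: T_def U_def)
      have finT: "finite T" using T V finite_subset by blast
      have TS: "star v T \<subseteq> S" using T by (auto simp: S_def star_def)
      have UT: "U (X \<union> Y) v x = T" if Y: "Y \<subseteq> S" for Y
      proof -
        have "(X \<union> Y) \<inter> star u (V - K - {v}) = X \<inter> star u (V - K - {v})" if "u \<in> V \<inter> K" for u
          using Y that v by (auto simp: S_def star_def doubleton_eq_iff subset_iff)
        then show ?thesis by (auto simp: T_def U_def)
      qed
      have XYT: "(X \<union> Y) \<inter> star v T = Y \<inter> star v T" for Y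
        using X TS by auto
      have "prb (map_pmf ((\<union>) X) (random_subset (1/2) S))
          {E. card (U E v x) \<le> m \<and> 9 * real m / 16 \<le> card (E \<inter> star v (U E v x))} \<le>
        prb (random_subset (1/2) S) {Y. card T \<le> m \<and> 9 * real m / 16 \<le> card (Y \<inter> star v T)}"
        unfolding prb_map by (intro prb_mono) (auto dest!: set_random_subset simp: UT XYT)
      also have "\<dots> \<le> exp (- real m / 128)"
      proof (cases "card T \<le> m \<and> card T > 0")
        case True
        have cs: "card (star v T) = card T" using T v by (intro card_star) auto
        have "prb (random_subset (1/2) S) {Y. card T \<le> m \<and> 9 * real m / 16 \<le> card (Y \<inter> star v T)} =
            prb (binomial_pmf (card T) (1/2)) {j. 9 * real m / 16 \<le> real j}"
          using True prb_random_subset_card[of S "star v T" "\<lambda>j. 9 * real m / 16 \<le> real j"] TS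
            finite_subset[OF SP finP]
          by (simp add: cs)
        also have "\<dots> \<le> prb (binomial_pmf (card T) (1/2)) {j. real j \<ge> card T / 2 + m / 16}"
          using True by (intro prb_mono) auto
        also have "\<dots> \<le> exp (- 2 * (m / 16)\<^sup>2 / card T)"
          by (rule binomial_half_ge_le) simp
        also have "\<dots> \<le> exp (- real m / 128)"
        proof -
          have "real m * card T \<le> real m * m"
            using True by (intro mult_left_mono) auto
          then show ?thesis using True by (simp add: power2_eq_square field_simps)
        qed
        finally show ?thesis .
      next
        case False
        have "\<not> (card T \<le> m \<and> 9 * real m / 16 \<le> card (Y \<inter> star v T))" for Y
          using False finT m by (auto simp: star_def)
        then have eq: "{Y. card T \<le> m \<and> 9 * real m / 16 \<le> card (Y \<inter> star v T)} = {}" by blast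
        show ?thesis unfolding eq by simp
      qed
      finally show "prb (map_pmf ((\<union>) X) (random_subset (1/2) S))
          {E. card (U E v x) \<le> m \<and> 9 * real m / 16 \<le> card (E \<inter> star v (U E v x))} \<le> exp (- real m / 128)" .
    qed simp
    then show "prb ?R (case i of (v, x) \<Rightarrow> {E. card (U E v x) \<le> m \<and> 9 * real m / 16 \<le> card (E \<inter> star v (U E v x))})
        \<le> exp (- real m / 128)"
      by (simp add: i')
  qed
  ultimately have 34: "prb ?R A3 + prb ?R A4 \<le> N * (N + 1) * ((64 * \<kappa> / (m * sqrt (N - 1))) ^ b + exp (- real m / 128))"
    unfolding cI by (simp add: distrib_left)
  have "prb (planted K V) {H. \<not> phase2_good m K H} = prb ?R {E. \<not> phase2_good m K (clique_graph K V E)}"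
    by (simp add: planted_def prb_map P_def)
  also have "\<dots> \<le> prb ?R ((A1 \<union> A2) \<union> (A3 \<union> A4))"
  proof (rule prb_mono)
    fix E assume E: "E \<in> set_pmf ?R" "E \<in> {E. \<not> phase2_good m K (clique_graph K V E)}"
    have EP: "E \<subseteq> pairs V - pairs K" using set_random_subset[OF E(1)] by (simp add: P_def)
    show "E \<in> (A1 \<union> A2) \<union> (A3 \<union> A4)"
    proof (rule ccontr)
      assume n: "E \<notin> (A1 \<union> A2) \<union> (A3 \<union> A4)"
      have d_le: "card (E \<inter> star u (V - K - {v})) \<le> card (V - K)" for u v
      proof -
        have "card (E \<inter> star u (V - K - {v})) \<le> card {w \<in> V - K - {v}. {w, u} \<in> E}"
          using EP by (subst card_star_Int[of _ V]) auto
        also have "\<dots> \<le> card (V - K)" using V by (intro card_mono) auto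
        finally show ?thesis .
      qed
      have "phase2_good m K (clique_graph K V E)"
      proof (rule phase2_goodI[OF V EP m(1)])
        fix u v assume u: "u \<in> V \<inter> K" and v: "v \<in> V - K"
        have "deg_into (clique_graph K V E) V v = card (E \<inter> star v V)"
          using EP v by (intro deg_into_outside) auto
        moreover have "card (E \<inter> star v V) < (N + \<kappa> - 1) / 2 + \<kappa> / 8"
          using n v by (auto simp: A1_def not_le)
        moreover have "deg_into (clique_graph K V E) V u = card (V \<inter> K - {u}) + card (E \<inter> star u (V - K))"
          using EP u V by (intro deg_into_inside) auto
        moreover have "real (card (V \<inter> K - {u})) = \<kappa> - 1"
          using u V card_Suc_Diff1[of "V \<inter> K" u] by (simp add: \<kappa>_def)
        moreover have "card (E \<inter> star u (V - K)) > N / 2 - \<kappa> / 8"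
          using n u by (auto simp: A2_def not_le)
        ultimately have "real (deg_into (clique_graph K V E) V v) < real (deg_into (clique_graph K V E) V u)"
          using \<kappa> by (simp add: field_simps)
        then show "deg_into (clique_graph K V E) V v < deg_into (clique_graph K V E) V u" by simp
      next
        fix v x assume v: "v \<in> V - K"
        show "card {u \<in> V \<inter> K. card (E \<inter> star u (V - K - {v})) = x} < real m / 16"
        proof (cases "x \<le> card (V - K)")
          case True
          then have "\<not> real m / 16 \<le> card (D E v x)" using n v by (auto simp: A3_def I_def)
          then show ?thesis by (simp add: D_def)
        next
          case False
          then have "card (E \<inter> star u (V - K - {v})) \<noteq> x" for u using d_le[of u v] by linarith
          then show ?thesis using m by simp
        qed
      next
        fix v x assume v: "v \<in> V - K"
          and c: "card {u \<in> V \<inter> K. x < card (E \<inter> star u (V - K - {v}))} \<le> m"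
        show "card (E \<inter> star v {u \<in> V \<inter> K. x < card (E \<inter> star u (V - K - {v}))}) < 9 * real m / 16"
        proof (cases "x \<le> card (V - K)")
          case True
          then have "\<not> (card (U E v x) \<le> m \<and> 9 * real m / 16 \<le> card (E \<inter> star v (U E v x)))"
            using n v by (auto simp: A4_def I_def)
          then show ?thesis using c by (simp add: U_def)
        next
          case False
          then have "\<not> x < card (E \<inter> star u (V - K - {v}))" for u using d_le[of u v] by linarith
          then show ?thesis using m by (simp add: star_def)
        qed
      qed (use m in auto)
      then show False using E by simp
    qed
  qed
  also have "\<dots> \<le> (prb ?R A1 + prb ?R A2) + (prb ?R A3 + prb ?R A4)"
    by (intro order_trans[OF prb_union_le] add_mono prb_union_le)
  finally show ?thesis using 12 34 unfolding e_def by linarith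
qed

section \<open>All iterations of phase 1\<close>

text \<open>Input graph and result of phase 1 are dependent, but each bad event concerns only one of
  them. Hence the two marginals of the joint law \<open>J\<close> suffice.\<close>

lemma fail_le:
  assumes "finite V" "K \<subseteq> V" "s \<le> m"
  shows "prb (bind_pmf (planted K V) (\<lambda>G. map_pmf (\<lambda>H. (K, outputs (card K) m G H)) (phase1 \<alpha> \<beta> \<eta> t G)))
      {(K', Out). Out \<noteq> {K'}} \<le>
    prb (planted K V) {G. \<not> phase3_good s K G} +
    prb (bind_pmf (planted K V) (phase1 \<alpha> \<beta> \<eta> t)) {H. \<not> (phase2_good m K H \<and> finite (verts H))}"
proof -
  define J where "J = bind_pmf (planted K V) (\<lambda>G. map_pmf (Pair G) (phase1 \<alpha> \<beta> \<eta> t G))"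
  have "bind_pmf (planted K V) (\<lambda>G. map_pmf (\<lambda>H. (K, outputs (card K) m G H)) (phase1 \<alpha> \<beta> \<eta> t G)) =
      map_pmf (\<lambda>(G, H). (K, outputs (card K) m G H)) J"
    by (simp add: J_def map_bind_pmf map_pmf_comp)
  then have "prb (bind_pmf (planted K V) (\<lambda>G. map_pmf (\<lambda>H. (K, outputs (card K) m G H)) (phase1 \<alpha> \<beta> \<eta> t G)))
      {(K', Out). Out \<noteq> {K'}} = prb J {(G, H). outputs (card K) m G H \<noteq> {K}}"
    by (simp add: prb_map case_prod_unfold)
  also have "\<dots> \<le> prb J ({x. \<not> phase3_good s K (fst x)} \<union> {x. \<not> (phase2_good m K (snd x) \<and> finite (verts (snd x)))})"
  proof (rule prb_mono, rule ccontr)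
    fix x assume x: "x \<in> {(G, H). outputs (card K) m G H \<noteq> {K}}"
      "x \<notin> {x. \<not> phase3_good s K (fst x)} \<union> {x. \<not> (phase2_good m K (snd x) \<and> finite (verts (snd x)))}"
    then have "outputs (card K) m (fst x) (snd x) = {K}"
      by (intro outputs_eq[OF _ _ assms(3)]) auto
    then show False using x(1) by (simp add: case_prod_unfold)
  qed
  also have "\<dots> \<le> prb J {x. \<not> phase3_good s K (fst x)} + prb J {x. \<not> (phase2_good m K (snd x) \<and> finite (verts (snd x)))}"
    by (rule prb_union_le)
  also have "prb J {x. \<not> phase3_good s K (fst x)} = prb (map_pmf fst J) {G. \<not> phase3_good s K G}"
    by (simp add: prb_map)
  also have "map_pmf fst J = planted K V"
    by (simp add: J_def map_bind_pmf map_pmf_comp bind_return_pmf')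
  also have "prb J {x. \<not> (phase2_good m K (snd x) \<and> finite (verts (snd x)))} =
      prb (map_pmf snd J) {H. \<not> (phase2_good m K H \<and> finite (verts H))}"
    by (simp add: prb_map)
  also have "map_pmf snd J = bind_pmf (planted K V) (phase1 \<alpha> \<beta> \<eta> t)"
    by (simp add: J_def map_bind_pmf map_pmf_comp)
  finally show ?thesis .
qed

text \<open>The ratio of clique size to the square root of the graph size starts near \<open>c\<close>, exceeds \<open>c\<^sub>2 > c\<close>
  after one step and then grows geometrically. The surplus over \<open>c\<close> more than compensates for the
  constant relative error \<open>\<xi>\<close> of every step, so the clique ends up larger than \<open>\<rho>\<^sup>t k\<close>.\<close>
lemma phase1_prb:
  fixes \<alpha> \<beta> \<eta> c c2 \<xi> :: real
  defines "\<tau> \<equiv> tau \<alpha> \<beta>" and "r \<equiv> rho c \<alpha> \<beta> \<eta>" and "r1 \<equiv> rho (c - \<xi>) \<alpha> \<beta> \<eta> - \<xi>"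
  assumes \<alpha>: "0 < \<alpha>" "\<alpha> < 1" and \<beta>: "\<beta> > 0" and \<eta>: "\<eta> > 0" and \<xi>: "0 < \<xi>" "\<xi> < c" and c2: "0 < c2" and r1: "0 < r1"
    and h1: "c2 * sqrt (\<tau> + \<xi>) \<le> (c - \<xi>) * r1" and h2: "(1 + \<xi>) * r \<le> rho c2 \<alpha> \<beta> \<eta> - \<xi>"
    and h3: "sqrt (\<tau> + \<xi>) \<le> r" and h4: "\<xi> \<le> \<tau> / 2"
  obtains M :: real where
    "\<And>(V :: 'a set) K t (L :: real) Bad e'. finite V \<Longrightarrow> (c - \<xi>) * sqrt (card (V - K)) \<le> card (V \<inter> K) \<Longrightarrow>
      L = (\<tau> / 2) ^ t * card (V - K) \<Longrightarrow> M \<le> L \<Longrightarrow> card (V \<inter> K) \<le> L powr 0.6 \<Longrightarrow> 1 \<le> t \<Longrightarrow> 0 \<le> e' \<Longrightarrow>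
      (\<And>W. W \<subseteq> V \<Longrightarrow> L \<le> card (W - K) \<Longrightarrow> c2 * (1 + \<xi>) ^ (t - 1) * sqrt (card (W - K)) \<le> card (W \<inter> K) \<Longrightarrow>
        r1 * ((1 + \<xi>) * r) ^ (t - 1) * card (V \<inter> K) \<le> card (W \<inter> K) \<Longrightarrow> prb (planted K W) Bad \<le> e') \<Longrightarrow>
      prb (bind_pmf (planted K V) (phase1 \<alpha> \<beta> \<eta> t)) Bad \<le> t * exp (- (L powr (1/10))) + e'"
proof -
  have \<tau>: "0 < \<tau>" "\<tau> < 1"
  proof -
    have "(1 - \<alpha>) * Phi_bar \<beta> < (1 - \<alpha>) * 1" using \<alpha> by (intro mult_strict_left_mono) auto
    also have "(1 - \<alpha>) * 1 < 1" using \<alpha> by simp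
    finally show "\<tau> < 1" by (simp add: \<tau>_def tau_def)
    show "0 < \<tau>" using \<alpha> by (simp add: \<tau>_def tau_def)
  qed
  have r0: "0 < r" using h3 \<tau> \<xi> by (meson add_pos_pos less_le_trans real_sqrt_gt_zero)
  have "0 < c - \<xi>" using \<xi> by simp
  \<comment> \<open>Only the first iteration starts from the ratio \<open>c - \<xi>\<close>, where
    \<xi> makes room for rounding the clique size down; all later ones use
    \<open>c2\<close>.\<close>
  obtain M1 where M1: "\<And>(V::'a set) K. admissible (c - \<xi>) M1 V K \<Longrightarrow>
     prb (step \<alpha> \<beta> \<eta> K V) {W. \<not> proportional \<xi> \<tau> (rho (c - \<xi>) \<alpha> \<beta> \<eta>) W V K} \<le> exp (- (real (card (V - K)) powr (1/10)))"
    using one_step[OF \<alpha> \<beta> \<eta> \<open>0 < c - \<xi>\<close> \<xi>(1), where 'a='a, folded \<tau>_def] by blast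
  obtain M2 where M2: "\<And>(V::'a set) K. admissible c2 M2 V K \<Longrightarrow>
     prb (step \<alpha> \<beta> \<eta> K V) {W. \<not> proportional \<xi> \<tau> (rho c2 \<alpha> \<beta> \<eta>) W V K} \<le> exp (- (real (card (V - K)) powr (1/10)))"
    using one_step[OF \<alpha> \<beta> \<eta> c2 \<xi>(1), where 'a='a, folded \<tau>_def] by blast
  show ?thesis
  proof (rule that[of "max (max M1 M2) 0"])
    fix V K :: "'a set" and t :: nat and L e' :: real and Bad
    assume V: "finite V" and start: "(c - \<xi>) * sqrt (card (V - K)) \<le> card (V \<inter> K)"
      and L: "L = (\<tau> / 2) ^ t * card (V - K)" and LM: "max (max M1 M2) 0 \<le> L"
      and kL: "card (V \<inter> K) \<le> L powr 0.6" and t: "1 \<le> t" and e': "0 \<le> e'"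
      and final: "\<And>W. W \<subseteq> V \<Longrightarrow> L \<le> card (W - K) \<Longrightarrow> c2 * (1 + \<xi>) ^ (t - 1) * sqrt (card (W - K)) \<le> card (W \<inter> K) \<Longrightarrow>
        r1 * ((1 + \<xi>) * r) ^ (t - 1) * card (V \<inter> K) \<le> card (W \<inter> K) \<Longrightarrow> prb (planted K W) Bad \<le> e'"
    \<comment> \<open>Time 0 is singled out because the surplus exists only after one iteration;
      hence the exponents \<open>i - 1\<close>. The size bound \<open>(\<tau> / 2) ^ i\<close> is
      crude, but it costs only a small power of n over so few iterations.\<close>
    define J where "J i W \<longleftrightarrow> W \<subseteq> V \<and> (\<tau> / 2) ^ i * card (V - K) \<le> card (W - K) \<and> (i = 0 \<longrightarrow> W = V) \<and>
      (0 < i \<longrightarrow> c2 * (1 + \<xi>) ^ (i - 1) * sqrt (card (W - K)) \<le> card (W \<inter> K) \<and>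
        r1 * ((1 + \<xi>) * r) ^ (i - 1) * card (V \<inter> K) \<le> card (W \<inter> K))" for i W
    show "prb (bind_pmf (planted K V) (phase1 \<alpha> \<beta> \<eta> t)) Bad \<le> t * exp (- (L powr (1/10))) + e'"
    proof (rule phase1_chain[of V J])
      show "J 0 V" by (simp add: J_def)
      show "prb (planted K W) Bad \<le> e'" if "J t W" for W
        using that t by (intro final) (auto simp: J_def L)
      fix i W assume i: "i < t" and W: "finite W" and J: "J i W"
      have WV: "W \<subseteq> V" and Ni: "(\<tau> / 2) ^ i * card (V - K) \<le> card (W - K)" using J by (auto simp: J_def)
      have LW: "L \<le> card (W - K)"
      proof -
        have "(\<tau> / 2) ^ t \<le> (\<tau> / 2) ^ i" using \<tau> i by (intro power_decreasing) auto
        then have "L \<le> (\<tau> / 2) ^ i * card (V - K)" unfolding L by (intro mult_right_mono) auto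
        then show ?thesis using Ni by linarith
      qed
      have \<kappa>: "real (card (W \<inter> K)) \<le> real (card (W - K)) powr 0.6"
      proof -
        have "card (W \<inter> K) \<le> card (V \<inter> K)" using WV V by (intro card_mono) auto
        moreover have "L powr 0.6 \<le> real (card (W - K)) powr 0.6"
          using LW LM by (intro powr_mono2) auto
        ultimately show ?thesis using kL by linarith
      qed
      have e: "exp (- (real (card (W - K)) powr (1/10))) \<le> exp (- (L powr (1/10)))"
        using LW LM by (auto intro!: powr_mono2)
      have lower: "(\<tau> / 2) ^ Suc i * card (V - K) \<le> card (W' - K)"
        and upper: "sqrt (card (W' - K)) \<le> sqrt (\<tau> + \<xi>) * sqrt (card (W - K))"
        if "\<bar>card (W' - K) - \<tau> * card (W - K)\<bar> \<le> \<xi> * card (W - K)" for W'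
      proof -
        have "(\<tau> / 2) ^ Suc i * card (V - K) \<le> \<tau> / 2 * card (W - K)"
          using mult_left_mono[OF Ni, of "\<tau> / 2"] \<tau> by (simp add: mult_ac)
        also have "\<dots> \<le> (\<tau> - \<xi>) * card (W - K)"
          using h4 by (intro mult_right_mono) auto
        finally show "(\<tau> / 2) ^ Suc i * card (V - K) \<le> card (W' - K)"
          using that by (simp add: abs_le_iff algebra_simps)
        have "card (W' - K) \<le> (\<tau> + \<xi>) * card (W - K)"
          using that by (simp add: abs_le_iff algebra_simps)
        then show "sqrt (card (W' - K)) \<le> sqrt (\<tau> + \<xi>) * sqrt (card (W - K))"
          unfolding real_sqrt_mult[symmetric] by (rule real_sqrt_le_mono)
      qed
      show "prb (step \<alpha> \<beta> \<eta> K W) {W'. \<not> J (Suc i) W'} \<le> exp (- (L powr (1/10)))"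
      proof (cases "i = 0")
        case True
        then have WeqV: "W = V" using J by (simp add: J_def)
        have "prb (step \<alpha> \<beta> \<eta> K W) {W'. \<not> J (Suc i) W'} \<le>
          prb (step \<alpha> \<beta> \<eta> K W) {W'. \<not> proportional \<xi> \<tau> (rho (c - \<xi>) \<alpha> \<beta> \<eta>) W' W K}"
        proof (rule prb_mono, rule ccontr)
          fix W' assume W': "W' \<in> set_pmf (step \<alpha> \<beta> \<eta> K W)" "W' \<in> {W'. \<not> J (Suc i) W'}"
            and "W' \<notin> {W'. \<not> proportional \<xi> \<tau> (rho (c - \<xi>) \<alpha> \<beta> \<eta>) W' W K}"
          then have good: "\<bar>card (W' - K) - \<tau> * card (W - K)\<bar> \<le> \<xi> * card (W - K)" "r1 * card (W \<inter> K) \<le> card (W' \<inter> K)"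
            by (auto simp: proportional_def r1_def)
          have "c2 * sqrt (card (W' - K)) \<le> c2 * (sqrt (\<tau> + \<xi>) * sqrt (card (W - K)))"
            using upper[OF good(1)] c2 by (intro mult_left_mono) auto
          also have "\<dots> \<le> (c - \<xi>) * r1 * sqrt (card (W - K))"
            using h1 mult_right_mono[OF h1, of "sqrt (card (W - K))"] by (simp add: mult_ac)
          also have "\<dots> \<le> r1 * card (W \<inter> K)"
            using mult_left_mono[OF start, of r1] r1 by (simp add: WeqV mult_ac)
          finally have "c2 * sqrt (card (W' - K)) \<le> card (W' \<inter> K)" using good(2) by linarith
          then have "J (Suc i) W'"
            using lower[OF good(1)] good(2) set_step[OF W'(1)] WV True by (auto simp: J_def WeqV)
          then show False using W'(2) by simp
        qed
        also have "\<dots> \<le> exp (- (real (card (W - K)) powr (1/10)))"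
          using LW LM start \<kappa> W by (intro M1) (auto simp: admissible_def WeqV)
        finally show ?thesis using e by linarith
      next
        case False
        then have i0: "0 < i" by simp
        have Ji: "c2 * (1 + \<xi>) ^ (i - 1) * sqrt (card (W - K)) \<le> card (W \<inter> K)"
          "r1 * ((1 + \<xi>) * r) ^ (i - 1) * card (V \<inter> K) \<le> card (W \<inter> K)"
          using J i0 by (auto simp: J_def)
        have pow: "(1 + \<xi>) * (1 + \<xi>) ^ (i - 1) = (1 + \<xi>) ^ i" "(1 + \<xi>) * r * ((1 + \<xi>) * r) ^ (i - 1) = ((1 + \<xi>) * r) ^ i"
          using i0 by (simp_all flip: power_Suc)
        have "prb (step \<alpha> \<beta> \<eta> K W) {W'. \<not> J (Suc i) W'} \<le>
          prb (step \<alpha> \<beta> \<eta> K W) {W'. \<not> proportional \<xi> \<tau> (rho c2 \<alpha> \<beta> \<eta>) W' W K}"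
        proof (rule prb_mono, rule ccontr)
          fix W' assume W': "W' \<in> set_pmf (step \<alpha> \<beta> \<eta> K W)" "W' \<in> {W'. \<not> J (Suc i) W'}"
            and "W' \<notin> {W'. \<not> proportional \<xi> \<tau> (rho c2 \<alpha> \<beta> \<eta>) W' W K}"
          then have good: "\<bar>card (W' - K) - \<tau> * card (W - K)\<bar> \<le> \<xi> * card (W - K)"
            "(rho c2 \<alpha> \<beta> \<eta> - \<xi>) * card (W \<inter> K) \<le> card (W' \<inter> K)"
            by (auto simp: proportional_def)
          have "(1 + \<xi>) * r * card (W \<inter> K) \<le> (rho c2 \<alpha> \<beta> \<eta> - \<xi>) * card (W \<inter> K)"
            using h2 by (intro mult_right_mono) auto
          then have grow: "(1 + \<xi>) * r * card (W \<inter> K) \<le> card (W' \<inter> K)" using good(2) by linarith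
          have g0: "0 \<le> (1 + \<xi>) * r" using \<xi> r0 by simp
          have "c2 * (1 + \<xi>) ^ i * sqrt (card (W' - K)) \<le> c2 * (1 + \<xi>) ^ i * (sqrt (\<tau> + \<xi>) * sqrt (card (W - K)))"
            using upper[OF good(1)] c2 \<xi> by (intro mult_left_mono) auto
          \<comment> \<open>By \<open>h3\<close> the square root is multiplied by at most
            \<open>r\<close>, while the clique keeps at least \<open>(1 + \<xi>) * r\<close> of its
            size, so the ratio gains a factor \<open>1 + \<xi>\<close>.\<close>
          also have "\<dots> \<le> c2 * (1 + \<xi>) ^ i * (r * sqrt (card (W - K)))"
            using h3 c2 \<xi> by (intro mult_left_mono mult_right_mono) auto
          also have "\<dots> = (1 + \<xi>) * r * (c2 * (1 + \<xi>) ^ (i - 1) * sqrt (card (W - K)))"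
            unfolding pow(1)[symmetric] by (simp add: mult_ac)
          also have "\<dots> \<le> (1 + \<xi>) * r * card (W \<inter> K)"
            using Ji(1) g0 by (rule mult_left_mono)
          finally have 1: "c2 * (1 + \<xi>) ^ i * sqrt (card (W' - K)) \<le> card (W' \<inter> K)" using grow by linarith
          have "r1 * ((1 + \<xi>) * r) ^ i * card (V \<inter> K) = (1 + \<xi>) * r * (r1 * ((1 + \<xi>) * r) ^ (i - 1) * card (V \<inter> K))"
            unfolding pow(2)[symmetric] by (simp add: mult_ac)
          also have "\<dots> \<le> (1 + \<xi>) * r * card (W \<inter> K)"
            using Ji(2) g0 by (rule mult_left_mono)
          finally have 2: "r1 * ((1 + \<xi>) * r) ^ i * card (V \<inter> K) \<le> card (W' \<inter> K)" using grow by linarith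
          have "J (Suc i) W'"
            using lower[OF good(1)] 1 2 set_step[OF W'(1)] WV by (auto simp: J_def)
          then show False using W'(2) by simp
        qed
        also have "\<dots> \<le> exp (- (real (card (W - K)) powr (1/10)))"
        proof (rule M2)
          have "1 \<le> (1 + \<xi>) ^ (i - 1)" using \<xi> by (intro one_le_power) auto
          then have "c2 * 1 * sqrt (card (W - K)) \<le> c2 * (1 + \<xi>) ^ (i - 1) * sqrt (card (W - K))"
            using c2 by (intro mult_right_mono mult_left_mono) auto
          then show "admissible c2 M2 W K" using Ji(1) LW LM \<kappa> W by (simp add: admissible_def)
        qed
        finally show ?thesis using e by linarith
      qed
    qed (use V e' in auto)
  qed
qed

text \<open>A larger ratio \<open>w\<close> helps twice, inside \<open>del\<close> when the core is
  chosen and again as the factor in front of it; both lower the last threshold. Strictness is what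
  turns \<open>c2 > c\<close> into a surplus over \<rho>.\<close>

lemma rho_strict_mono:
  assumes "0 < \<alpha>" "\<alpha> < 1" "0 < w" "w < w'"
  shows "rho w \<alpha> \<beta> \<eta> < rho w' \<alpha> \<beta> \<eta>"
proof -
  have g: "0 < gam \<alpha> \<eta>" using assms by (simp add: gam_def)
  have "w * sqrt \<alpha> < w' * sqrt \<alpha>"
    using assms by (intro mult_strict_right_mono) auto
  then have "Phi_bar (\<eta> - w * sqrt \<alpha>) < Phi_bar (\<eta> - w' * sqrt \<alpha>)"
    by (intro Phi_bar_strict_antimono) auto
  then have "del w \<alpha> \<eta> < del w' \<alpha> \<eta>"
    using assms by (simp add: del_def)
  moreover have "0 < del w \<alpha> \<eta>" using assms by (simp add: del_def)
  ultimately have "w * del w \<alpha> \<eta> < w' * del w' \<alpha> \<eta>"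
    using assms by (intro mult_strict_mono) auto
  then have "\<beta> - w' * del w' \<alpha> \<eta> / sqrt (gam \<alpha> \<eta>) < \<beta> - w * del w \<alpha> \<eta> / sqrt (gam \<alpha> \<eta>)"
    using g by (simp add: divide_strict_right_mono)
  then show ?thesis
    unfolding rho_def using assms by (intro mult_strict_left_mono Phi_bar_strict_antimono) auto
qed

lemma isCont_rho:
  assumes "0 < \<alpha>"
  shows "isCont (\<lambda>w. rho w \<alpha> \<beta> \<eta>) w"
proof -
  have "0 < gam \<alpha> \<eta>" using assms by (simp add: gam_def)
  then have g: "sqrt (gam \<alpha> \<eta>) \<noteq> 0" by auto
  have 1: "isCont (\<lambda>w. Phi_bar (\<eta> - w * sqrt \<alpha>)) w"
    by (rule isCont_o2[OF _ isCont_Phi_bar]) (intro continuous_intros)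
  have "isCont (\<lambda>w. \<beta> - w * (\<alpha> * Phi_bar (\<eta> - w * sqrt \<alpha>)) / sqrt (gam \<alpha> \<eta>)) w"
    by (intro continuous_intros 1 g)
  then have "isCont (\<lambda>w. Phi_bar (\<beta> - w * (\<alpha> * Phi_bar (\<eta> - w * sqrt \<alpha>)) / sqrt (gam \<alpha> \<eta>))) w"
    by (rule isCont_o2[OF _ isCont_Phi_bar])
  then show ?thesis
    unfolding rho_def del_def by (intro continuous_intros)
qed

text \<open>\<open>q\<close> is the factor gained by the ratio in one error-free iteration at ratio
  \<open>c\<close>, and \<open>c2\<close> the midpoint of \<open>c\<close> and \<open>c * q\<close>:
  it is reached after one iteration with room to spare, and \<open>rho\<close> at \<open>c2\<close>
  strictly exceeds \<open>r\<close>. Every condition on \<xi> other than positivity is strict at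
  \<xi> = 0 and continuous there, so a small \<xi> meets them all.\<close>

lemma step_constants:
  fixes \<alpha> \<beta> \<eta> c :: real
  defines "\<tau> \<equiv> tau \<alpha> \<beta>" and "r \<equiv> rho c \<alpha> \<beta> \<eta>"
  assumes \<alpha>: "0 < \<alpha>" "\<alpha> < 1" and c: "0 < c" and gain: "r\<^sup>2 / \<tau> > 1"
  obtains \<xi> c2 where "0 < \<xi>" "\<xi> < c" "0 < c2" "0 < rho (c - \<xi>) \<alpha> \<beta> \<eta> - \<xi>"
    "c2 * sqrt (\<tau> + \<xi>) \<le> (c - \<xi>) * (rho (c - \<xi>) \<alpha> \<beta> \<eta> - \<xi>)"
    "(1 + \<xi>) * r \<le> rho c2 \<alpha> \<beta> \<eta> - \<xi>" "sqrt (\<tau> + \<xi>) \<le> r" "\<xi> \<le> \<tau> / 2"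
proof -
  have \<tau>: "0 < \<tau>" using \<alpha> by (simp add: \<tau>_def tau_def)
  have r: "0 < r" using \<alpha> by (simp add: r_def rho_def)
  define q where "q = r / sqrt \<tau>"
  have "1 < q\<^sup>2" using gain \<tau> by (simp add: q_def power_divide)
  then have q: "1 < q" using r \<tau> by (intro power_less_imp_less_base[of 1 2 q]) (auto simp: q_def)
  have rq: "r = q * sqrt \<tau>" using \<tau> by (simp add: q_def)
  define c2 where "c2 = c * (1 + q) / 2"
  have "c * 1 < c * ((1 + q) / 2)" "c * ((1 + q) / 2) < c * q"
    using q c by (intro mult_strict_left_mono; simp)+
  then have c2: "c < c2" "c2 < c * q" by (auto simp: c2_def)
  have lim: "((\<lambda>e. rho (c - e) \<alpha> \<beta> \<eta>) \<longlongrightarrow> r) (at_right 0)"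
  proof -
    have "((\<lambda>e. c - e) \<longlongrightarrow> c - 0) (at_right 0)" by (intro tendsto_intros)
    then show ?thesis
      unfolding r_def by (intro isCont_tendsto_compose[OF isCont_rho[OF \<alpha>(1)]]) simp
  qed
  have "((\<lambda>e. (c - e) * (rho (c - e) \<alpha> \<beta> \<eta> - e) - c2 * sqrt (\<tau> + e)) \<longlongrightarrow> (c - 0) * (r - 0) - c2 * sqrt (\<tau> + 0)) (at_right 0)"
    by (intro tendsto_intros lim)
  moreover have "(c - 0) * (r - 0) - c2 * sqrt (\<tau> + 0) > 0"
    using mult_strict_right_mono[OF c2(2), of "sqrt \<tau>"] \<tau> by (simp add: rq mult_ac)
  ultimately have 1: "\<forall>\<^sub>F e in at_right 0. 0 < (c - e) * (rho (c - e) \<alpha> \<beta> \<eta> - e) - c2 * sqrt (\<tau> + e)"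
    by (rule order_tendstoD(1))
  have "((\<lambda>e. rho (c - e) \<alpha> \<beta> \<eta> - e) \<longlongrightarrow> r - 0) (at_right 0)"
    by (intro tendsto_intros lim)
  then have 2: "\<forall>\<^sub>F e in at_right 0. 0 < rho (c - e) \<alpha> \<beta> \<eta> - e"
    using r by (intro order_tendstoD(1)) auto
  have "((\<lambda>e. rho c2 \<alpha> \<beta> \<eta> - e - (1 + e) * r) \<longlongrightarrow> rho c2 \<alpha> \<beta> \<eta> - 0 - (1 + 0) * r) (at_right 0)"
    by (intro tendsto_intros)
  moreover have "rho c2 \<alpha> \<beta> \<eta> - 0 - (1 + 0) * r > 0"
    using rho_strict_mono[OF \<alpha> c c2(1)] by (simp add: r_def)
  ultimately have 3: "\<forall>\<^sub>F e in at_right 0. 0 < rho c2 \<alpha> \<beta> \<eta> - e - (1 + e) * r"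
    by (rule order_tendstoD(1))
  have "((\<lambda>e. r - sqrt (\<tau> + e)) \<longlongrightarrow> r - sqrt (\<tau> + 0)) (at_right 0)"
    by (intro tendsto_intros)
  moreover have "r - sqrt (\<tau> + 0) > 0"
    using mult_strict_right_mono[OF q, of "sqrt \<tau>"] \<tau> by (simp add: rq)
  ultimately have 4: "\<forall>\<^sub>F e in at_right 0. 0 < r - sqrt (\<tau> + e)"
    by (rule order_tendstoD(1))
  have 5: "\<forall>\<^sub>F e in at_right 0. e < min c (\<tau> / 2)"
    using c \<tau> by (intro order_tendstoD(2)[of "\<lambda>x. x" 0]) (auto intro: tendsto_ident_at)
  have 6: "\<forall>\<^sub>F e in at_right (0::real). 0 < e"
    by (simp add: eventually_at_right_less)
  from 1 2 3 4 5 6 have "\<forall>\<^sub>F \<xi> in at_right 0. 0 < \<xi> \<and> \<xi> < c \<and> 0 < c2 \<and> 0 < rho (c - \<xi>) \<alpha> \<beta> \<eta> - \<xi> \<and>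
    c2 * sqrt (\<tau> + \<xi>) \<le> (c - \<xi>) * (rho (c - \<xi>) \<alpha> \<beta> \<eta> - \<xi>) \<and>
    (1 + \<xi>) * r \<le> rho c2 \<alpha> \<beta> \<eta> - \<xi> \<and> sqrt (\<tau> + \<xi>) \<le> r \<and> \<xi> \<le> \<tau> / 2"
    by eventually_elim (use c c2 in auto)
  then show ?thesis
    using eventually_happens'[OF trivial_limit_at_right_real] that by blast
qed

section \<open>Success probability\<close>

text \<open>Given the clique, the model is the planted law, so all estimates can be made for a fixed
  \<open>K\<close>.\<close>

lemma run_eq:
  assumes "clique_size c n \<le> n"
  shows "run c \<alpha> \<beta> \<eta> \<epsilon> n = bind_pmf (pmf_of_set {K. K \<subseteq> {..<n} \<and> card K = clique_size c n}) (\<lambda>K.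
    bind_pmf (planted K {..<n}) (\<lambda>G. map_pmf (\<lambda>H. (K, outputs (card K)
      (nat \<lfloor>rho c \<alpha> \<beta> \<eta> ^ num_iterations c \<alpha> \<beta> \<eta> \<epsilon> n * clique_size c n\<rfloor>) G H))
      (phase1 \<alpha> \<beta> \<eta> (num_iterations c \<alpha> \<beta> \<eta> \<epsilon> n) G)))"
proof -
  have fin: "finite {K. K \<subseteq> {..<n} \<and> card K = clique_size c n}"
    by simp
  have ne: "{K. K \<subseteq> {..<n} \<and> card K = clique_size c n} \<noteq> {}"
    using assms by (auto intro!: exI[of _ "{..<clique_size c n}"])
  show ?thesis
    unfolding run_def hidden_clique_model_def Let_def bind_assoc_pmf
  proof (intro bind_pmf_cong refl)
    fix K assume "K \<in> set_pmf (pmf_of_set {K. K \<subseteq> {..<n} \<and> card K = clique_size c n})"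
    then have K: "K \<subseteq> {..<n}" "card K = clique_size c n"
      using fin ne by (auto simp: set_pmf_of_set)
    then have "K \<inter> {..<n} = K" by auto
    then show "bind_pmf (map_pmf (\<lambda>E. (K, {..<n}, pairs K \<union> E)) (random_subset (1/2) (pairs {..<n} - pairs K)))
          (\<lambda>(K, G). map_pmf (\<lambda>H. (K, outputs (clique_size c n)
            (nat \<lfloor>rho c \<alpha> \<beta> \<eta> ^ num_iterations c \<alpha> \<beta> \<eta> \<epsilon> n * clique_size c n\<rfloor>) G H))
            (phase1 \<alpha> \<beta> \<eta> (num_iterations c \<alpha> \<beta> \<eta> \<epsilon> n) G)) =
        bind_pmf (planted K {..<n}) (\<lambda>G. map_pmf (\<lambda>H. (K, outputs (card K)
            (nat \<lfloor>rho c \<alpha> \<beta> \<eta> ^ num_iterations c \<alpha> \<beta> \<eta> \<epsilon> n * clique_size c n\<rfloor>) G H))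
            (phase1 \<alpha> \<beta> \<eta> (num_iterations c \<alpha> \<beta> \<eta> \<epsilon> n) G))"
      by (simp add: planted_def clique_graph_def bind_map_pmf K(2))
  qed
qed

lemma success_prob_ge:
  fixes \<alpha> \<beta> \<eta> c :: real
  assumes \<alpha>: "0 < \<alpha>" "\<alpha> < 1" and \<beta>: "\<beta> > 0" and \<eta>: "\<eta> > 0" and c: "0 < c"
    and gain: "(rho c \<alpha> \<beta> \<eta>)\<^sup>2 / tau \<alpha> \<beta> > 1"
  obtains \<epsilon>4 \<epsilon>0 where "\<epsilon>4 > 0" "\<epsilon>0 > 0"
    "\<forall>\<^sub>F n in sequentially. success_prob c \<alpha> \<beta> \<eta> \<epsilon>4 n \<ge> 1 - exp (- (real n powr \<epsilon>0))"
proof -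
  define \<tau> where "\<tau> = tau \<alpha> \<beta>"
  define r where "r = rho c \<alpha> \<beta> \<eta>"
  have \<tau>: "0 < \<tau>" "\<tau> < 1"
  proof -
    have "(1 - \<alpha>) * Phi_bar \<beta> < (1 - \<alpha>) * 1" using \<alpha> by (intro mult_strict_left_mono) auto
    also have "(1 - \<alpha>) * 1 < 1" using \<alpha> by simp
    finally show "\<tau> < 1" by (simp add: \<tau>_def tau_def)
    show "0 < \<tau>" using \<alpha> by (simp add: \<tau>_def tau_def)
  qed
  have r: "0 < r" "r < 1"
  proof -
    have "(1 - \<alpha>) * Phi_bar (\<beta> - c * del c \<alpha> \<eta> / sqrt (gam \<alpha> \<eta>)) < (1 - \<alpha>) * 1"
      using \<alpha> by (intro mult_strict_left_mono) auto
    also have "(1 - \<alpha>) * 1 < 1" using \<alpha> by simp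
    finally show "r < 1" by (simp add: r_def rho_def)
    show "0 < r" using \<alpha> by (simp add: r_def rho_def)
  qed
  obtain \<xi> c2 where \<xi>: "0 < \<xi>" "\<xi> < c" and c2: "0 < c2" and r1: "0 < rho (c - \<xi>) \<alpha> \<beta> \<eta> - \<xi>"
    and h: "c2 * sqrt (\<tau> + \<xi>) \<le> (c - \<xi>) * (rho (c - \<xi>) \<alpha> \<beta> \<eta> - \<xi>)"
    "(1 + \<xi>) * r \<le> rho c2 \<alpha> \<beta> \<eta> - \<xi>" "sqrt (\<tau> + \<xi>) \<le> r" "\<xi> \<le> \<tau> / 2"
    using step_constants[OF \<alpha> c gain] unfolding \<tau>_def r_def by metis
  define r1 where "r1 = rho (c - \<xi>) \<alpha> \<beta> \<eta> - \<xi>"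
  have r1: "0 < r1" using r1 by (simp add: r1_def)
  obtain M where M: "\<And>(V :: nat set) K t (L :: real) Bad e'. finite V \<Longrightarrow> (c - \<xi>) * sqrt (card (V - K)) \<le> card (V \<inter> K) \<Longrightarrow>
      L = (\<tau> / 2) ^ t * card (V - K) \<Longrightarrow> M \<le> L \<Longrightarrow> card (V \<inter> K) \<le> L powr 0.6 \<Longrightarrow> 1 \<le> t \<Longrightarrow> 0 \<le> e' \<Longrightarrow>
      (\<And>W. W \<subseteq> V \<Longrightarrow> L \<le> card (W - K) \<Longrightarrow> c2 * (1 + \<xi>) ^ (t - 1) * sqrt (card (W - K)) \<le> card (W \<inter> K) \<Longrightarrow>
        r1 * ((1 + \<xi>) * r) ^ (t - 1) * card (V \<inter> K) \<le> card (W \<inter> K) \<Longrightarrow> prb (planted K W) Bad \<le> e') \<Longrightarrow>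
      prb (bind_pmf (planted K V) (phase1 \<alpha> \<beta> \<eta> t)) Bad \<le> t * exp (- (L powr (1/10))) + e'"
    by (rule phase1_prb[OF \<alpha> \<beta> \<eta> \<xi> c2, folded \<tau>_def r_def r1_def, OF r1 h(1)[folded r1_def] h(2-4)])
      (erule that)
  \<comment> \<open>The number of iterations will be the integer part of
    \<open>\<nu> * log 2 n\<close>; this \<nu> is small enough to keep both
    \<open>(\<tau> / 2) ^ t\<close> and \<open>r ^ t\<close> above n^(-1/100).\<close>
  define \<nu> where "\<nu> = 1 / (100 * (log 2 (2 / \<tau>) + log 2 (1 / r)))"
  have A: "0 < log 2 (2 / \<tau>)" and B: "0 < log 2 (1 / r)"
    using \<tau> r by auto
  have \<nu>: "0 < \<nu>" using A B by (simp add: \<nu>_def)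
  have \<nu>A: "\<nu> * log 2 (\<tau> / 2) \<ge> - (1/100)" and \<nu>B: "\<nu> * log 2 r \<ge> - (1/100)"
  proof -
    have "\<nu> * (log 2 (2 / \<tau>) + log 2 (1 / r)) = 1/100"
      using A B by (simp add: \<nu>_def)
    moreover have "0 < \<nu> * log 2 (2 / \<tau>)" "0 < \<nu> * log 2 (1 / r)"
      using \<nu> A B by simp_all
    ultimately have "\<nu> * log 2 (2 / \<tau>) \<le> 1/100" "\<nu> * log 2 (1 / r) \<le> 1/100"
      by (simp_all add: distrib_left)
    moreover have "log 2 (2 / \<tau>) = - log 2 (\<tau> / 2)" "log 2 (1 / r) = - log 2 r"
      using \<tau> r by (simp_all add: log_divide)
    ultimately show "\<nu> * log 2 (\<tau> / 2) \<ge> - (1/100)" "\<nu> * log 2 r \<ge> - (1/100)" by simp_all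
  qed
  \<comment> \<open>Taking \<epsilon>4 as \<open>\<nu> * l\<close> cancels the denominator in the
    prescribed number of iterations.\<close>
  define l where "l = log 2 (r\<^sup>2 / \<tau>)"
  have l: "0 < l" using gain by (simp add: l_def r_def \<tau>_def)
  \<comment> \<open>\<open>1 + \<xi>\<close> raised to \<open>\<nu> * log 2 n\<close> is n^\<mu>.
    The exponent \<open>- 2\<close> in \<open>C\<close> and \<open>a\<close> pays for rounding
    \<open>t\<close> down and for the first iteration, which does not contribute a factor.\<close>
  define \<mu> where "\<mu> = \<nu> * log 2 (1 + \<xi>)"
  have \<mu>: "0 < \<mu>" using \<nu> \<xi> by (simp add: \<mu>_def)
  define C where "C = (c2 * (1 + \<xi>) powr (- 2))\<^sup>2 / 64"
  have C: "0 < C" using c2 \<xi> by (simp add: C_def)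
  define a where "a = r1 * (1 + \<xi>) powr (- 2)"
  have a: "0 < a" using r1 \<xi> by (simp add: a_def)
  define \<epsilon>0 where "\<epsilon>0 = min \<mu> (1/20)"
  define t where "t n = num_iterations c \<alpha> \<beta> \<eta> (\<nu> * l) n" for n
  define k where "k n = clique_size c n" for n
  define m where "m n = nat \<lfloor>r ^ t n * k n\<rfloor>" for n
  \<comment> \<open>This power is far below \<open>m\<close> and the clique size, yet far above log
    n, as the union bound over bipartite subgraphs requires.\<close>
  define s where "s n = nat \<lceil>real n powr (1/10)\<rceil>" for n :: nat
  define d :: real where "d = ln 2"
  have d: "0 < d" and half_powr: "(1/2) powr x = exp (- d * x)" for x
    by (auto simp: d_def powr_def ln_div)
  \<comment> \<open>Multiplying n / 2 and the clique size by n^(-1/100) leaves orders n^0.99 and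
    n^0.49; lowering both exponents by another 1/100 swallows the constants. The error terms are
    made sixths of the target, one of them as two twelfths, and five sixths are added in the
    end.\<close>
  have ev: "\<forall>\<^sub>F n in sequentially. 1 \<le> real n" "\<forall>\<^sub>F n in sequentially. c * sqrt n \<le> n / 2"
    "\<forall>\<^sub>F n in sequentially. 1 \<le> \<xi> * sqrt n"
    "\<forall>\<^sub>F n in sequentially. real n powr 0.98 \<le> real n powr (-1/100) * (n / 2)"
    "\<forall>\<^sub>F n in sequentially. max M 2 \<le> real n powr 0.98"
    "\<forall>\<^sub>F n in sequentially. c * sqrt n \<le> (real n powr 0.98) powr 0.6"
    "\<forall>\<^sub>F n in sequentially. c * sqrt n \<le> real n powr 0.98"
    "\<forall>\<^sub>F n in sequentially. 2 \<le> \<nu> * log 2 n"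
    "\<forall>\<^sub>F n in sequentially. \<nu> * log 2 n \<le> n"
    "\<forall>\<^sub>F n in sequentially. real n powr 0.48 + 2 \<le> real n powr (-1/100) * (c * sqrt n - 1)"
    "\<forall>\<^sub>F n in sequentially. r \<le> a * real n powr \<mu>"
    "\<forall>\<^sub>F n in sequentially. real n powr (1/10) + 1 \<le> real n powr 0.48"
    "\<forall>\<^sub>F n in sequentially. 4 * real n powr (1/10) + 9 \<le> c * sqrt n"
    "\<forall>\<^sub>F n in sequentially. 32 \<le> real n powr 0.48"
    "\<forall>\<^sub>F n in sequentially. 256 \<le> real n powr (-1/100) * sqrt (real n powr 0.98 - 1)"
    "\<forall>\<^sub>F n in sequentially. real n * exp (- C * (real n powr \<mu>)\<^sup>2) \<le> exp (- (real n powr \<mu>)) / 6"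
    "\<forall>\<^sub>F n in sequentially. 2 * (real n)\<^sup>2 * exp (- d * (real n powr 0.48 / 32 - 1)) \<le> exp (- (real n powr (1/20))) / 12"
    "\<forall>\<^sub>F n in sequentially. 2 * (real n)\<^sup>2 * exp (- (real n powr 0.48) / 128) \<le> exp (- (real n powr (1/20))) / 12"
    "\<forall>\<^sub>F n in sequentially. real n * exp (- ((real n powr 0.98) powr (1/10))) \<le> exp (- (real n powr (1/20))) / 6"
    "\<forall>\<^sub>F n in sequentially. real n * exp (- (c * sqrt n - 1) / 8) \<le> exp (- (real n powr (1/20))) / 6"
    "\<forall>\<^sub>F n in sequentially. (real n)\<^sup>2 * exp (- d * real n powr (1/10)) \<le> 1/2"
    "\<forall>\<^sub>F n in sequentially. exp (- d * real n powr (1/10)) \<le> exp (- (real n powr (1/20))) / 6"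
    using c \<xi> \<nu> \<mu> C a d by real_asymp+
  have "\<forall>\<^sub>F n in sequentially. success_prob c \<alpha> \<beta> \<eta> (\<nu> * l) n \<ge> 1 - exp (- (real n powr \<epsilon>0))"
    using ev
  proof eventually_elim
    case (elim n)
    note n = elim(1) and e1 = elim(2) and e2 = elim(3) and e3 = elim(4) and e4 = elim(5) and e5 = elim(6) and e6 = elim(7) and e7 = elim(8)
      and e8 = elim(9) and e9 = elim(10) and e10 = elim(11) and e11 = elim(12) and e12 = elim(13) and e13 = elim(14) and e14 = elim(15) and e15 = elim(16)
      and e16a = elim(17) and e16b = elim(18) and e17 = elim(19) and e18 = elim(20) and e19 = elim(21) and e20 = elim(22)
    have e16: "2 * (real n)\<^sup>2 * ((1/2) powr (real n powr 0.48 / 32 - 1) + exp (- (real n powr 0.48) / 128)) \<le> exp (- (real n powr (1/20))) / 6"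
      using e16a e16b unfolding half_powr distrib_left by linarith
    note e19 = e19[folded half_powr] and e20 = e20[folded half_powr]
    have t_eq: "t n = nat \<lfloor>\<nu> * log 2 n\<rfloor>"
      using l by (simp add: t_def num_iterations_def l_def r_def \<tau>_def)
    have t_le: "real (t n) \<le> \<nu> * log 2 n" and t_ge: "\<nu> * log 2 n - 1 \<le> real (t n)"
      using e7 unfolding t_eq by linarith+
    have t1: "1 \<le> t n" using t_ge e7 by linarith
    have powr_log: "x powr (\<nu> * log 2 n) = real n powr (\<nu> * log 2 x)" if "0 < x" for x
      using that n by (simp add: powr_def log_def)
    have decay: "real n powr (-1/100) \<le> x ^ t n" if x: "0 < x" "x < 1" "\<nu> * log 2 x \<ge> - (1/100)" for x
    proof -
      have "real n powr (-1/100) \<le> real n powr (\<nu> * log 2 x)"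
        using x n by (intro powr_mono) auto
      also have "\<dots> = x powr (\<nu> * log 2 n)" using x by (simp add: powr_log)
      also have "\<dots> \<le> x powr t n" using x t_le by (intro powr_mono') auto
      finally show ?thesis using x by (simp add: powr_realpow)
    qed
    have growth: "(1 + \<xi>) powr (- 2) * real n powr \<mu> \<le> (1 + \<xi>) ^ (t n - 1)"
    proof -
      have "(1 + \<xi>) powr (- 2) * real n powr \<mu> = (1 + \<xi>) powr (\<nu> * log 2 n - 2)"
        using \<xi> by (simp add: \<mu>_def powr_log[symmetric] powr_diff powr_minus divide_inverse mult.commute)
      also have "\<dots> \<le> (1 + \<xi>) powr real (t n - 1)"
        using \<xi> t_ge t1 by (intro powr_mono) (auto simp: of_nat_diff)
      finally show ?thesis using \<xi> by (simp add: powr_realpow)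
    qed
    have k_le: "real (k n) \<le> c * sqrt n" and k_ge: "c * sqrt n - 1 \<le> real (k n)"
      using c unfolding k_def clique_size_def by (auto intro: order_less_imp_le)
    have kn: "k n \<le> n" using k_le e1 by linarith
    have rt: "0 < r ^ t n" using r by simp
    have m_le: "real (m n) \<le> r ^ t n * k n"
      using r unfolding m_def by simp
    have "real n powr (-1/100) * (c * sqrt n - 1) \<le> r ^ t n * k n"
    proof (rule mult_mono)
      have "0 \<le> real n powr (1/10)" by simp
      then show "0 \<le> c * sqrt n - 1" using e12 by linarith
    qed (use decay[OF r \<nu>B] k_ge rt in auto)
    then have rk: "real n powr 0.48 + 2 \<le> r ^ t n * k n" using e9 by linarith
    have m_ge: "real n powr 0.48 \<le> real (m n)" "r ^ t n * k n / 2 \<le> real (m n)"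
    proof -
      define y where "y = r ^ t n * k n"
      have y: "y - 1 \<le> real (m n)" unfolding m_def y_def by linarith
      then show "real n powr 0.48 \<le> real (m n)" using rk[folded y_def] by linarith
      have "0 \<le> real n powr 0.48" by simp
      then have "y / 2 \<le> real (m n)" using rk[folded y_def] y by linarith
      then show "r ^ t n * k n / 2 \<le> real (m n)" by (simp add: y_def)
    qed
    have s_le: "real (s n) \<le> real n powr (1/10) + 1" and s_ge: "real n powr (1/10) \<le> real (s n)"
      unfolding s_def using powr_ge_zero[of "real n" "1/10"] by linarith+
    have sm: "s n \<le> m n" using s_le e11 m_ge(1) by linarith
    have sk: "real (s n) \<le> real (k n) / 4 - 1" using s_le e12 k_ge by linarith
    let ?V = "{..<n}"
    define fail where "fail = {(K' :: nat set, Out :: nat set set). Out \<noteq> {K'}}"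
    have fail_le: "prb (bind_pmf (planted K ?V) (\<lambda>G. map_pmf (\<lambda>H. (K, outputs (card K) (m n) G H)) (phase1 \<alpha> \<beta> \<eta> (t n) G))) fail
        \<le> exp (- (real n powr \<epsilon>0))" if K: "K \<subseteq> ?V" "card K = k n" for K
    proof -
      have VK: "card (?V \<inter> K) = k n" using K by (simp add: Int_absorb1)
      have VmK: "real (card (?V - K)) = real n - k n"
        using K kn finite_subset[OF K(1)] by (simp add: card_Diff_subset of_nat_diff)
      define N0 where "N0 = real (card (?V - K))"
      have N0: "n / 2 \<le> N0" "N0 \<le> n" using VmK k_le e1 unfolding N0_def by linarith+
      define L where "L = (\<tau> / 2) ^ t n * N0"
      have LL: "real n powr 0.98 \<le> L"
      proof -
        have "real n powr (-1/100) * (n / 2) \<le> L"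
          unfolding L_def using decay[of "\<tau> / 2"] \<tau> \<nu>A N0 by (intro mult_mono) auto
        then show ?thesis using e3 by linarith
      qed
      have p1: "prb (planted K ?V) {G. \<not> phase3_good (s n) K G} \<le> exp (- (real n powr (1/20))) / 6 + exp (- (real n powr (1/20))) / 6"
      proof -
        have "prb (planted K ?V) {G. \<not> phase3_good (s n) K G} \<le>
          real (card ?V) * exp (- real (card K) / 8) + real (card ?V) ^ (2 * s n) * (1/2) ^ (s n * s n)"
          using K sk by (intro phase3_prb) auto
        moreover have "real (card ?V) * exp (- real (card K) / 8) \<le> n * exp (- (c * sqrt n - 1) / 8)"
          using k_ge K by (auto intro!: mult_left_mono)
        moreover have "real (card ?V) ^ (2 * s n) * (1/2) ^ (s n * s n) \<le> (1/2) powr (real n powr (1/10))"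
        proof -
          \<comment> \<open>Grouped this way, the union bound is an \<open>s\<close>-th power whose
            base is at most 1/2.\<close>
          have "real (card ?V) ^ (2 * s n) * (1/2) ^ (s n * s n) = ((real n)\<^sup>2 * (1/2) ^ s n) ^ s n"
            by (simp add: power_mult power_mult_distrib)
          also have "\<dots> \<le> (1/2) ^ s n"
          proof (rule power_mono)
            have "(1/2 :: real) ^ s n = (1/2) powr real (s n)" by (simp add: powr_realpow)
            also have "\<dots> \<le> (1/2) powr (real n powr (1/10))" using s_ge by (intro powr_mono') auto
            finally have "(real n)\<^sup>2 * (1/2) ^ s n \<le> (real n)\<^sup>2 * (1/2) powr (real n powr (1/10))"
              by (intro mult_left_mono) auto
            then show "(real n)\<^sup>2 * (1/2) ^ s n \<le> 1/2" using e19 by linarith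
          qed simp
          also have "\<dots> = (1/2) powr real (s n)" by (simp add: powr_realpow)
          also have "\<dots> \<le> (1/2) powr (real n powr (1/10))" using s_ge by (intro powr_mono') auto
          finally show ?thesis .
        qed
        ultimately show ?thesis using e18 e20 by linarith
      qed
      define e' where "e' = exp (- (real n powr \<mu>)) / 6 + exp (- (real n powr (1/20))) / 6"
      have "prb (bind_pmf (planted K ?V) (phase1 \<alpha> \<beta> \<eta> (t n))) {H. \<not> (phase2_good (m n) K H \<and> finite (verts H))}
          \<le> t n * exp (- (L powr (1/10))) + e'"
      proof (rule M)
        have "(c - \<xi>) * sqrt N0 \<le> (c - \<xi>) * sqrt n"
          using N0 \<xi> by (intro mult_left_mono) auto
        also have "\<dots> \<le> c * sqrt n - 1" using e2 by (simp add: algebra_simps)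
        finally show "(c - \<xi>) * sqrt (card (?V - K)) \<le> card (?V \<inter> K)"
          using k_ge unfolding N0_def VK by linarith
        show "L = (\<tau> / 2) ^ t n * card (?V - K)" by (simp add: L_def N0_def)
        show "M \<le> L" using LL e4 by linarith
        have "(real n powr 0.98) powr 0.6 \<le> L powr 0.6" using LL by (intro powr_mono2) auto
        then show "card (?V \<inter> K) \<le> L powr 0.6" using k_le e5 unfolding VK by linarith
        show "0 \<le> e'" by (simp add: e'_def)
      next
        fix W assume W: "W \<subseteq> ?V" and LW: "L \<le> card (W - K)"
          and W1: "c2 * (1 + \<xi>) ^ (t n - 1) * sqrt (card (W - K)) \<le> card (W \<inter> K)"
          and W2: "r1 * ((1 + \<xi>) * r) ^ (t n - 1) * card (?V \<inter> K) \<le> card (W \<inter> K)"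
        have finW: "finite W" using W finite_subset by blast
        define N where "N = real (card (W - K))"
        define \<kappa> where "\<kappa> = real (card (W \<inter> K))"
        have N: "real n powr 0.98 \<le> N" using LL LW by (simp add: N_def)
        have N2: "2 \<le> N" using N e4 by linarith
        have \<kappa>k: "\<kappa> \<le> k n"
          unfolding \<kappa>_def VK[symmetric] using W by (auto intro!: card_mono)
        have \<kappa>N: "\<kappa> \<le> N" using \<kappa>k k_le e6 N by linarith
        have cW: "N + \<kappa> \<le> n"
        proof -
          have "card W = card (W - K) + card (W \<inter> K)" using finW by (rule card_Diff_plus_Int)
          moreover have "card W \<le> n" using card_mono[OF _ W] by simp
          ultimately show ?thesis unfolding N_def \<kappa>_def by linarith
        qed
        \<comment> \<open>The constant by which the first iteration may fall short,
          \<open>r1\<close> against \<open>r\<close>, is outweighed by the later gain of order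
          n^\<mu>, so the actual clique has at least \<open>m\<close> vertices.\<close>
        have m\<kappa>: "m n \<le> card (W \<inter> K)"
        proof -
          have "r \<le> r1 * ((1 + \<xi>) powr (- 2) * real n powr \<mu>)" using e10 by (simp add: a_def)
          also have "\<dots> \<le> r1 * (1 + \<xi>) ^ (t n - 1)" using growth r1 by (intro mult_left_mono) auto
          finally have "r * (r ^ (t n - 1) * k n) \<le> r1 * (1 + \<xi>) ^ (t n - 1) * (r ^ (t n - 1) * k n)"
            using r by (intro mult_right_mono) auto
          moreover have "r * (r ^ (t n - 1) * k n) = r ^ t n * k n"
            using t1 by (simp flip: power_Suc mult.assoc)
          moreover have "r1 * (1 + \<xi>) ^ (t n - 1) * (r ^ (t n - 1) * k n) = r1 * ((1 + \<xi>) * r) ^ (t n - 1) * k n"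
            by (simp add: power_mult_distrib mult_ac)
          ultimately have "r ^ t n * k n \<le> r1 * ((1 + \<xi>) * r) ^ (t n - 1) * k n"
            by argo
          then show ?thesis using W2 m_le unfolding VK by linarith
        qed
        define b where "b = nat \<lfloor>real (m n) / 32\<rfloor>"
        have b: "real b \<le> real (m n) / 32" "real n powr 0.48 / 32 - 1 \<le> real b"
          using m_ge(1) unfolding b_def by linarith+
        have m32: "32 \<le> m n" using m_ge(1) e13 by linarith
        have bound: "prb (planted K W) {H. \<not> phase2_good (m n) K H} \<le>
          (N + \<kappa>) * exp (- \<kappa>\<^sup>2 / (32 * (N + \<kappa>))) +
          N * (N + 1) * ((64 * \<kappa> / (m n * sqrt (N - 1))) ^ b + exp (- real (m n) / 128))"
          unfolding N_def \<kappa>_def using m\<kappa> m32 N2 b(1)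
          by (intro phase2_prb finW) (auto simp: N_def)
        \<comment> \<open>Here the growth of the ratio pays off: \<kappa> is at least of order
          n^\<mu> sqrt N, and N + \<kappa> \<le> 2 N, so the exponent is at least of order n^(2
          \<mu>).\<close>
        have T1: "(N + \<kappa>) * exp (- \<kappa>\<^sup>2 / (32 * (N + \<kappa>))) \<le> exp (- (real n powr \<mu>)) / 6"
        proof -
          have "c2 * ((1 + \<xi>) powr (- 2) * real n powr \<mu>) * sqrt N \<le> c2 * (1 + \<xi>) ^ (t n - 1) * sqrt N"
            using growth c2 N2 by (intro mult_right_mono mult_left_mono) auto
          then have "c2 * ((1 + \<xi>) powr (- 2) * real n powr \<mu>) * sqrt N \<le> \<kappa>"
            using W1 unfolding N_def \<kappa>_def by linarith
          then have "(c2 * ((1 + \<xi>) powr (- 2) * real n powr \<mu>) * sqrt N)\<^sup>2 \<le> \<kappa>\<^sup>2"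
            using c2 N2 by (intro power_mono) auto
          then have "64 * C * (real n powr \<mu>)\<^sup>2 * N \<le> \<kappa>\<^sup>2"
            using N2 by (simp add: C_def power_mult_distrib mult_ac)
          then have "C * (real n powr \<mu>)\<^sup>2 \<le> \<kappa>\<^sup>2 / (64 * N)"
            using N2 by (simp add: field_simps)
          also have "\<dots> \<le> \<kappa>\<^sup>2 / (32 * (N + \<kappa>))"
            using \<kappa>N N2 by (intro divide_left_mono) (auto simp: \<kappa>_def)
          finally have "(N + \<kappa>) * exp (- \<kappa>\<^sup>2 / (32 * (N + \<kappa>))) \<le> n * exp (- C * (real n powr \<mu>)\<^sup>2)"
            using cW by (intro mult_mono) auto
          then show ?thesis using e15 by linarith
        qed
        have T2: "N * (N + 1) * ((64 * \<kappa> / (m n * sqrt (N - 1))) ^ b + exp (- real (m n) / 128)) \<le> exp (- (real n powr (1/20))) / 6"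
        proof -
          have kpos: "0 < real (k n)" using rk rt powr_ge_zero[of "real n" "0.48"]
            by (metis add_nonneg_pos less_le_trans zero_less_mult_pos zero_less_numeral)
          have sq: "0 < sqrt (N - 1)" using N2 by simp
          have "real n powr (-1/100) * sqrt (real n powr 0.98 - 1) \<le> r ^ t n * sqrt (N - 1)"
            using decay[OF r \<nu>B] N e4 rt by (intro mult_mono) auto
          then have q: "256 \<le> r ^ t n * sqrt (N - 1)" using e14 by linarith
          \<comment> \<open>\<kappa> is at most the initial \<open>k\<close> and \<open>m\<close> at
            least half of \<open>r ^ t * k\<close>. So \<open>k\<close> cancels, and the denominator
            keeps \<open>r ^ t * sqrt (N - 1)\<close>, which is at least 256 by
            \<open>q\<close>.\<close>
          have "64 * \<kappa> / (m n * sqrt (N - 1)) \<le> 64 * k n / (r ^ t n * k n / 2 * sqrt (N - 1))"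
            using \<kappa>k m_ge(2) sq kpos rt by (intro frac_le mult_right_mono mult_left_mono) (auto simp: \<kappa>_def)
          also have "\<dots> = 128 / (r ^ t n * sqrt (N - 1))"
            using kpos rt sq by (simp add: field_simps)
          also have "\<dots> \<le> 1/2" using q by (simp add: field_simps)
          finally have "(64 * \<kappa> / (m n * sqrt (N - 1))) ^ b \<le> (1/2) ^ b"
            using sq by (intro power_mono) (auto simp: \<kappa>_def)
          also have "\<dots> = (1/2) powr real b" by (simp add: powr_realpow)
          also have "\<dots> \<le> (1/2) powr (real n powr 0.48 / 32 - 1)" using b by (intro powr_mono') auto
          finally have bnd1: "(64 * \<kappa> / (m n * sqrt (N - 1))) ^ b + exp (- real (m n) / 128) \<le>
              (1/2) powr (real n powr 0.48 / 32 - 1) + exp (- (real n powr 0.48) / 128)"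
            using m_ge(1) by (intro add_mono) auto
          have bnd2: "N * (N + 1) \<le> 2 * (real n)\<^sup>2"
          proof -
            have "N \<le> n" using cW by (simp add: \<kappa>_def)
            then have "N * (N + 1) \<le> real n * (2 * real n)"
              using N2 n by (intro mult_mono) auto
            then show ?thesis by (simp add: power2_eq_square)
          qed
          have "N * (N + 1) * ((64 * \<kappa> / (m n * sqrt (N - 1))) ^ b + exp (- real (m n) / 128)) \<le>
              2 * (real n)\<^sup>2 * ((1/2) powr (real n powr 0.48 / 32 - 1) + exp (- (real n powr 0.48) / 128))"
            by (rule mult_mono[OF bnd2 bnd1]) (use N2 sq in \<open>auto simp: \<kappa>_def intro!: add_nonneg_nonneg\<close>)
          then show ?thesis using e16 by linarith
        qed
        have "prb (planted K W) {H. \<not> (phase2_good (m n) K H \<and> finite (verts H))} \<le> prb (planted K W) {H. \<not> phase2_good (m n) K H}"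
          using finW by (intro prb_mono) (auto dest!: verts_planted)
        then show "prb (planted K W) {H. \<not> (phase2_good (m n) K H \<and> finite (verts H))} \<le> e'"
          using bound T1 T2 unfolding e'_def by linarith
      qed (use t1 in auto)
      moreover have "t n * exp (- (L powr (1/10))) \<le> exp (- (real n powr (1/20))) / 6"
      proof -
        have "(real n powr 0.98) powr (1/10) \<le> L powr (1/10)" using LL by (intro powr_mono2) auto
        then have "t n * exp (- (L powr (1/10))) \<le> n * exp (- ((real n powr 0.98) powr (1/10)))"
          using t_le e8 by (intro mult_mono) auto
        then show ?thesis using e17 by linarith
      qed
      moreover have "prb (bind_pmf (planted K ?V) (\<lambda>G. map_pmf (\<lambda>H. (K, outputs (card K) (m n) G H)) (phase1 \<alpha> \<beta> \<eta> (t n) G))) fail \<le>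
          prb (planted K ?V) {G. \<not> phase3_good (s n) K G} +
          prb (bind_pmf (planted K ?V) (phase1 \<alpha> \<beta> \<eta> (t n))) {H. \<not> (phase2_good (m n) K H \<and> finite (verts H))}"
        unfolding fail_def using K sm by (intro fail_le) auto
      moreover have "exp (- (real n powr \<mu>)) \<le> exp (- (real n powr \<epsilon>0))" "exp (- (real n powr (1/20))) \<le> exp (- (real n powr \<epsilon>0))"
        using n by (auto simp: \<epsilon>0_def intro!: powr_mono)
      moreover have "0 \<le> exp (- (real n powr \<epsilon>0))" by simp
      ultimately show ?thesis using p1 unfolding e'_def by linarith
    qed
    have fin: "finite {K. K \<subseteq> ?V \<and> card K = k n}" by simp
    have ne: "{K. K \<subseteq> ?V \<and> card K = k n} \<noteq> {}"
      using kn by (auto intro!: exI[of _ "{..<k n}"])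
    have "prb (run c \<alpha> \<beta> \<eta> (\<nu> * l) n) fail \<le> exp (- (real n powr \<epsilon>0))"
      unfolding run_eq[OF kn[unfolded k_def]] k_def[symmetric] t_def[symmetric] r_def[symmetric] m_def[symmetric]
      using fin ne by (intro prb_bind_le' fail_le) (auto simp: set_pmf_of_set)
    moreover have "success_prob c \<alpha> \<beta> \<eta> (\<nu> * l) n = 1 - prb (run c \<alpha> \<beta> \<eta> (\<nu> * l) n) fail"
      using prb_Collect_not[of "run c \<alpha> \<beta> \<eta> (\<nu> * l) n" "\<lambda>x. snd x \<noteq> {fst x}"]
      by (simp add: success_prob_def fail_def case_prod_unfold)
    ultimately show ?case by linarith
  qed
  moreover have "0 < \<nu> * l" "0 < \<epsilon>0" using \<nu> l \<mu> by (auto simp: \<epsilon>0_def)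
  ultimately show ?thesis using that by blast
qed

theorem theorem19:
  fixes c :: real
  assumes "c \<ge> 1.261"
  shows "\<exists>\<alpha> \<beta> \<eta> \<epsilon>\<^sub>4 \<epsilon>\<^sub>0 :: real.
           0 < \<alpha> \<and> \<alpha> < 1 \<and> \<beta> > 0 \<and> \<eta> > 0 \<and> \<epsilon>\<^sub>4 > 0 \<and> \<epsilon>\<^sub>0 > 0 \<and>
           (rho c \<alpha> \<beta> \<eta>)\<^sup>2 / tau \<alpha> \<beta> > 1 \<and>
           (\<exists>g \<in> \<Theta>(\<lambda>n::nat. real n powr \<epsilon>\<^sub>0).
              \<forall>\<^sub>F n in sequentially.
                g n > 0 \<and> success_prob c \<alpha> \<beta> \<eta> \<epsilon>\<^sub>4 n \<ge> 1 - exp (- g n))"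
proof -
  have gain: "(rho c 0.8 2.3 1.2)\<^sup>2 / tau 0.8 2.3 > 1"
    using assms by (rule parameters)
  obtain \<epsilon>4 \<epsilon>0 where pos: "\<epsilon>4 > 0" "\<epsilon>0 > 0"
    and ev: "\<forall>\<^sub>F n in sequentially. success_prob c 0.8 2.3 1.2 \<epsilon>4 n \<ge> 1 - exp (- (real n powr \<epsilon>0))"
    by (rule success_prob_ge[of "0.8" "2.3" "1.2" c]) (use assms gain in auto)
  \<comment> \<open>The power of n itself serves as the function in the \<Theta> class; it is
    positive from n = 1 on.\<close>
  have "\<forall>\<^sub>F n in sequentially. real n powr \<epsilon>0 > 0 \<and>
      success_prob c 0.8 2.3 1.2 \<epsilon>4 n \<ge> 1 - exp (- (real n powr \<epsilon>0))"
    using ev eventually_gt_at_top[of 0] by eventually_elim auto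
  then show ?thesis
    using pos gain
    by (intro exI[of _ "0.8 :: real"] exI[of _ "2.3 :: real"] exI[of _ "1.2 :: real"]
        exI[of _ \<epsilon>4] exI[of _ \<epsilon>0] conjI bexI[of _ "\<lambda>n. real n powr \<epsilon>0"]) auto
qed

end
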